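(* Let $p>3$ be a prime. (i) We have $$\sum_{k=0}^{p-1}g_k(x)\left(1-p^2H_k^{(2)}\right)\equiv \sum_{k=0}^{p-1}\frac{p}{2k+1}\left(1-2p^2H_k^{(2)}\right)x^k\pmod{p^4}.$$ Consequently, $$\sum_{k=1}^{p-1}g_k\equiv p^2\sum_{k=1}^{p-1}g_kH_k^{(2)}+\frac 76p^3B_{p-3}\pmod{p^4},$$ $$\sum_{k=0}^{p-1}g_k(-1)\equiv\left(\frac{-1}p\right)+p^2\left(\sum_{k=0}^{p-1}g_k(-1)H_k^{(2)}-E_{p-3}\right)\pmod{p^3},$$ $$\sum_{k=0}^{p-1}g_k(-3)\equiv\left(\frac p3\right)\pmod{p^2}.$$ (ii) We also have $$\sum_{k=1}^{p-1}\frac{g_k(x)}k\equiv 0\pmod{p},$$ $$\sum_{k=1}^{p-1}\frac{g_{k-1}}k\equiv-\left(\frac p3\right)2q_p(3)\pmod p,$$ $$\sum_{k=1}^{p-1}kg_k\equiv-\frac 34\pmod{p^2},$$ and moreover $$\frac1{3n^2}\sum_{k=0}^{n-1}(4k+3)g_k=\sum_{k=0}^{n-1}\binom{n-1}k^2C_k$$ for all positive integers $n$. (iii) Provided $p>5$, we have $$\sum_{k=1}^{p-1}\frac{g_k(-1)}{k^2}\equiv 0\pmod{p},$$ $$\sum_{k=1}^{p-1}\frac{g_k(-1)}{k}\equiv 0\pmod {p^2},$$ $$\sum_{k=1}^{p-1}\frac{(-1)^kf_k(-1)}{k}H_k\equiv-2\left(\frac{-1}p\right)E_{p-3}\pmo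d{p}.$$
   Context: For $n\in\{0,1,2,\ldots\}$ define the polynomials $$g_n(x)=\sum_{k=0}^n\binom nk^2\binom{2k}kx^k,\qquad f_n(x)=\sum_{k=0}^n\binom nk^2\binom{2k}nx^k,$$ and put $g_n=g_n(1)$. Let $H_n=\sum_{0<k\le n}\frac1k$ and $H_n^{(2)}=\sum_{0<k\le n}\frac1{k^2}$ (so $H_0=H_0^{(2)}=0$). $C_k=\binom{2k}k/(k+1)$ is the $k$-th Catalan number. $B_0,B_1,\ldots$ are the Bernoulli numbers ($\frac{t}{e^t-1}=\sum_n B_n\frac{t^n}{n!}$) and $E_0,E_1,\ldots$ are the Euler numbers ($\frac{2}{e^t+e^{-t}}=\sum_n E_n\frac{t^n}{n!}$). $\left(\frac{a}{p}\right)$ denotes the Legendre symbol for an odd prime $p$; in particular $\left(\frac p3\right)$ is the Legendre symbol modulo $3$. For an integer $a$ not divisible by $p$, $q_p(a)=(a^{p-1}-1)/p$ is the Fermat quotient. Congruences modulo $p^m$ between rational numbers are in the ring of $p$-integral rationals (rationals whose denominator is prime to $p$), and congruences between polynomials in the indeterminate $x$ are coefficientwise in that sense. *)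

theory Defs
  imports
    "HOL-Computational_Algebra.Computational_Algebra"
    "HOL-Number_Theory.Number_Theory"
begin

definition g_poly :: "nat \<Rightarrow> rat poly" where
  "g_poly n = (\<Sum>k=0..n. Polynomial.monom (of_nat ((n choose k)^2 * ((2 * k) choose k))) k)"

definition f_poly :: "nat \<Rightarrow> rat poly" where
  "f_poly n = (\<Sum>k=0..n. Polynomial.monom (of_nat ((n choose k)^2 * ((2 * k) choose n))) k)"

definition g_num :: "nat \<Rightarrow> rat" where
  "g_num n = poly (g_poly n) 1"

definition harmonic :: "nat \<Rightarrow> rat" where
  "harmonic n = (\<Sum>k=1..n. 1 / of_nat k)"

definition harmonic2 :: "nat \<Rightarrow> rat" where
  "harmonic2 n = (\<Sum>k=1..n. 1 / (of_nat k)^2)"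

definition catalan_num :: "nat \<Rightarrow> rat" where
  "catalan_num k = of_nat ((2 * k) choose k) / of_nat (k + 1)"

(* Division in rat fps cancels common powers of the variable, so the quotient below is the
   power series t / (e^t - 1) although e^t - 1 is not a unit; see bernoulli_fps. *)
definition bernoulli_num :: "nat \<Rightarrow> rat" where
  "bernoulli_num n = fact n * fps_nth (fps_X / (fps_exp 1 - 1)) n"

definition euler_num :: "nat \<Rightarrow> rat" where
  "euler_num n = fact n * fps_nth (2 / (fps_exp 1 + fps_exp (-1))) n"

lemma bernoulli_fps:
  "Abs_fps (\<lambda>n. bernoulli_num n / fact n) * (fps_exp 1 - 1) = fps_X"
proof -
  let ?e = "fps_exp 1 - 1 :: rat fps"
  have nz: "fps_nth ?e 1 \<noteq> 0" by simp
  then have "?e \<noteq> 0" by (metis fps_zero_nth)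
  moreover have "subdegree ?e = 1"
    using nz by (intro subdegreeI) auto
  ultimately have "fps_X / ?e * ?e = fps_X"
    by (simp add: fps_dvd_iff)
  moreover have "Abs_fps (\<lambda>n. bernoulli_num n / fact n) = fps_X / ?e"
    by (rule fps_ext) (simp add: bernoulli_num_def)
  ultimately show ?thesis by simp
qed

definition fermat_quotient :: "nat \<Rightarrow> int \<Rightarrow> rat" where
  "fermat_quotient p a = (of_int a ^ (p - 1) - 1) / of_nat p"

(* quotient_of yields the reduced fraction with positive denominator. *)
definition p_integral :: "nat \<Rightarrow> rat \<Rightarrow> bool" where
  "p_integral p r \<longleftrightarrow> coprime (snd (quotient_of r)) (int p)"

(* a \<equiv> b (mod p^m) in the ring of p-integral rationals; both sides are required to lie
   in that ring. *)
definition rat_cong :: "nat \<Rightarrow> nat \<Rightarrow> rat \<Rightarrow> rat \<Rightarrow> bool" where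
  "rat_cong p m a b \<longleftrightarrow>
     p_integral p a \<and> p_integral p b \<and> (\<exists>c. p_integral p c \<and> a - b = of_nat p ^ m * c)"

definition poly_cong :: "nat \<Rightarrow> nat \<Rightarrow> rat poly \<Rightarrow> rat poly \<Rightarrow> bool" where
  "poly_cong p m F G \<longleftrightarrow> (\<forall>i. rat_cong p m (Polynomial.coeff F i) (Polynomial.coeff G i))"

end

theory Submission
  imports Defs
begin

text \<open>
  Let \<open>h = (p - 1) / 2\<close>. The product \<open>\<Prod>\<^sub>j\<^sub>\<le>\<^sub>k (1 - p\<^sup>2 / j\<^sup>2)\<close> equals
  \<open>(-1)\<^sup>k C(p-1, k) C(p+k, k)\<close> and is congruent to \<open>1 - p\<^sup>2 H\<^sub>k\<^sup>(\<^sup>2\<^sup>)\<close> modulo \<open>p\<^sup>4\<close>. With this weight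
  the sum of the coefficients of \<open>g\<^sub>k\<close> is a finite difference of a binomial coefficient and has
  a closed form, which is (i). At \<open>x = 1, -1, -3\<close> one pairs the indices \<open>h + i\<close> and \<open>h - i\<close>,
  whose denominators are \<open>p + 2 i\<close> and \<open>p - 2 i\<close>. For \<open>x = 1\<close> all sums of weight 3 reduce modulo \<open>p\<close>
  to \<open>\<Sum> H\<^sub>k / k\<^sup>2\<close>, which is \<open>B\<^sub>p\<^sub>-\<^sub>3\<close> by Faulhaber's formula; for \<open>x = -3\<close> one compares with the two
  halves of the binomial expansion of \<open>(1 + \<surd>-3)\<^sup>p\<close>.

  Since \<open>g\<^sub>n\<close> is the binomial transform of \<open>f\<^sub>k\<close>, sums of \<open>g\<^sub>k / k\<close> reduce to alternating sums of
  \<open>f\<^sub>k / k\<close>, whose coefficients telescope. What remains for (iii) is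
  \<open>\<Sum> (-1)\<^sup>i C(2i, i) / i\<^sup>2 \<equiv> 0\<close> over \<open>i \<le> h\<close>, obtained by multiplying Apery's identity for
  \<open>\<Sum> 1 / k\<^sup>3\<close> by \<open>p\<close>; the factor \<open>5/2\<close> in that identity is the reason for \<open>p > 5\<close>. The exact
  identity in (ii) is the symmetry of \<open>g\<^sub>n = \<Sum> (n! / (a! b! c!))\<^sup>2\<close> over \<open>a + b + c = n\<close>.
\<close>

text \<open>The weight differs from 1 only by a multiple of \<open>p^2\<close>. Therefore the sums
  with \<open>harmonic2\<close> stay on the right at \<open>x = 1\<close> and \<open>x = -1\<close>,
  where the precision is \<open>p^4\<close> and \<open>p^3\<close>, and drop out at
  \<open>x = -3\<close>, where it is \<open>p^2\<close>. Among the denominators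
  \<open>2 k + 1\<close> with \<open>k < p\<close> only that of \<open>k = h\<close> is divisible by
  \<open>p\<close>, and it equals \<open>p\<close>. The middle term is thus a unit and gives the
  leading term; all other terms carry a factor \<open>p\<close>. For \<open>x^2 = 1\<close> the
  parts of order \<open>p\<close> in a symmetric pair cancel. For \<open>x = -3\<close> the two
  powers of \<open>x\<close> differ, and the comparison with \<open>(1 + sqrt(-3))^p\<close> takes
  the place of this cancellation. A recurring obstacle is division by \<open>p\<close>: many
  congruences modulo \<open>p\<close> are reached by multiplying a sum by \<open>p\<close>,
  recognising \<open>C(p, j)\<close> or \<open>C(p-1, k)\<close> modulo \<open>p^2\<close>, and
  dividing again. This shapes the definition of the congruence relation, in which powers of
  \<open>p\<close> can be cancelled freely.\<close>

lemma p_integral_iff: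
  assumes "prime p"
  shows "p_integral p r \<longleftrightarrow> (\<exists>a b. \<not> int p dvd b \<and> r = of_int a / of_int b)"
proof
  assume r: "p_integral p r"
  obtain a b where ab: "quotient_of r = (a, b)" by fastforce
  have "coprime b (int p)" using r ab by (simp add: p_integral_def)
  then have "\<not> int p dvd b"
    using assms by (metis coprime_absorb_right not_prime_unit prime_nat_int_transfer)
  then show "\<exists>a b. \<not> int p dvd b \<and> r = of_int a / of_int b"
    using quotient_of_div[OF ab] by blast
next
  assume "\<exists>a b. \<not> int p dvd b \<and> r = of_int a / of_int b"
  then obtain a b where b: "\<not> int p dvd b" and r: "r = of_int a / of_int b" by blast
  obtain c d where cd: "quotient_of r = (c, d)" by fastforce
  have "d > 0" and "coprime c d"
    using quotient_of_denom_pos[OF cd] quotient_of_coprime[OF cd] by auto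
  moreover have "b \<noteq> 0" using b by auto
  moreover have "(of_int a / of_int b :: rat) = of_int c / of_int d"
    using quotient_of_div[OF cd] r by simp
  ultimately have "(of_int (a * d) :: rat) = of_int (c * b)"
    by (simp add: field_simps)
  then have "a * d = c * b" by (simp only: of_int_eq_iff)
  then have "d dvd b"
    using \<open>coprime c d\<close> by (metis coprime_commute coprime_dvd_mult_right_iff dvd_triv_right)
  then have "\<not> int p dvd d" using b dvd_trans by blast
  then have "coprime d (int p)"
    using assms by (metis coprime_commute prime_imp_coprime prime_nat_int_transfer)
  then show "p_integral p r" using cd by (simp add: p_integral_def)
qed

subsection \<open>Congruences in the ring of \<open>p\<close>-integral rationals\<close>

text \<open>Integrality is asked of the quotient only, not of \<open>a\<close> and \<open>b\<close>.
  Addition and cancellation of powers of \<open>p\<close> then have no side conditions;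
  \<open>rat_cong_iff\<close> recovers the stricter notion of the statement.\<close>

definition pcong :: "nat \<Rightarrow> nat \<Rightarrow> rat \<Rightarrow> rat \<Rightarrow> bool" where
  "pcong p m a b \<longleftrightarrow> p_integral p ((a - b) / of_nat p ^ m)"

locale large_prime =
  fixes p :: nat
  assumes prime_p: "prime p" and p_gt_3: "p > 3"
begin

abbreviation P :: rat where "P \<equiv> of_nat p"
abbreviation Zp :: "rat \<Rightarrow> bool" where "Zp \<equiv> p_integral p"
abbreviation cong_p :: "rat \<Rightarrow> rat \<Rightarrow> nat \<Rightarrow> bool" (\<open>(_ \<simeq> _ '(p^_'))\<close> [51, 51, 0] 50) where
  "a \<simeq> b (p^m) \<equiv> pcong p m a b"

named_theorems pint

lemma Zp_I: "\<not> int p dvd b \<Longrightarrow> Zp (of_int a / of_int b)"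
  using prime_p p_integral_iff by blast

lemma Zp_of_int [pint, simp]: "Zp (of_int a)"
  using Zp_I[of 1 a] prime_gt_1_nat[OF prime_p] by simp

lemma Zp_of_nat [pint, simp]: "Zp (of_nat n)"
  using Zp_of_int[of "int n"] by simp

lemma Zp_0 [pint, simp]: "Zp 0" and Zp_1 [pint, simp]: "Zp 1"
  and Zp_numeral [pint, simp]: "Zp (numeral w)"
  using Zp_of_int[of 0] Zp_of_int[of 1] Zp_of_int[of "numeral w"] by simp_all

lemma
  assumes "Zp a" "Zp b"
  shows Zp_add [pint]: "Zp (a + b)" and Zp_mult [pint]: "Zp (a * b)"
proof -
  obtain u v x y where *: "\<not> int p dvd v" "a = of_int u / of_int v"
      "\<not> int p dvd y" "b = of_int x / of_int y"
    using assms prime_p p_integral_iff by meson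
  have pr: "prime (int p)" using prime_p by simp
  have nd: "\<not> int p dvd v * y" using * pr by (simp add: prime_dvd_mult_iff)
  have "v \<noteq> 0" "y \<noteq> 0" using * by auto
  then have "a + b = of_int (u * y + x * v) / of_int (v * y)" "a * b = of_int (u * x) / of_int (v * y)"
    using * by (simp_all add: field_simps)
  then show "Zp (a + b)" "Zp (a * b)" using nd Zp_I by metis+
qed

lemma Zp_uminus [pint]: "Zp a \<Longrightarrow> Zp (- a)"
  using Zp_mult[of "-1" a] Zp_of_int[of "-1"] by simp

lemma Zp_diff [pint]: "Zp a \<Longrightarrow> Zp b \<Longrightarrow> Zp (a - b)"
  using Zp_add[of a "- b"] Zp_uminus by simp

lemma Zp_power [pint]: "Zp a \<Longrightarrow> Zp (a ^ n)"
  by (induction n) (auto intro: pint)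

lemma Zp_sum [pint]: "(\<And>i. i \<in> A \<Longrightarrow> Zp (f i)) \<Longrightarrow> Zp (sum f A)"
  by (induction A rule: infinite_finite_induct) (auto intro: pint)

text \<open>The condition that \<open>a\<close> is nonzero matters: \<open>1 / 0 = 0\<close> is
  integral, so 0 would otherwise count as a unit.\<close>

definition unit_p :: "rat \<Rightarrow> bool" where
  "unit_p a \<longleftrightarrow> a \<noteq> 0 \<and> Zp a \<and> Zp (1 / a)"

lemma unit_pD: "unit_p a \<Longrightarrow> Zp a" "unit_p a \<Longrightarrow> a \<noteq> 0"
  by (auto simp: unit_p_def)

lemma Zp_divide [pint]: assumes "Zp a" "unit_p b" shows "Zp (a / b)"
  using Zp_mult[of a "1 / b"] assms by (simp add: unit_p_def)

lemma unit_p_of_int: "\<not> int p dvd b \<Longrightarrow> unit_p (of_int b)"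
  using Zp_I[of b 1] by (auto simp: unit_p_def)

lemma unit_p_of_nat: "\<not> p dvd b \<Longrightarrow> unit_p (of_nat b)"
  using unit_p_of_int[of "int b"] by simp

lemma unit_p_less: "0 < k \<Longrightarrow> k < p \<Longrightarrow> unit_p (of_nat k)"
  by (intro unit_p_of_nat) (auto dest: dvd_imp_le)

lemma unit_p_1: "unit_p 1" by (simp add: unit_p_def)

lemma unit_p_mult: "unit_p a \<Longrightarrow> unit_p b \<Longrightarrow> unit_p (a * b)"
  using Zp_mult[of "1 / a" "1 / b"] by (auto simp: unit_p_def intro: pint)

lemma unit_p_uminus: "unit_p a \<Longrightarrow> unit_p (- a)"
  using Zp_uminus by (auto simp: unit_p_def)

lemma unit_p_power: "unit_p a \<Longrightarrow> unit_p (a ^ n)"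
  by (induction n) (auto intro: unit_p_mult unit_p_1)

lemma unit_p_divide: "unit_p a \<Longrightarrow> unit_p b \<Longrightarrow> unit_p (a / b)"
  using Zp_mult[of "1 / a" b] Zp_mult[of a "1 / b"] by (auto simp: unit_p_def)

lemma not_dvd_2_3: "\<not> p dvd 2" "\<not> p dvd 3" "\<not> p dvd 4" "\<not> p dvd 6"
proof -
  show 2: "\<not> p dvd 2" and 3: "\<not> p dvd 3"
    using p_gt_3 by (auto dest!: dvd_imp_le)
  then show "\<not> p dvd 4" "\<not> p dvd 6"
    using prime_dvd_mult_iff[OF prime_p, of 2 2] prime_dvd_mult_iff[OF prime_p, of 2 3] by simp_all
qed


lemma p_nz [simp]: "p \<noteq> 0" using p_gt_3 by simp

lemma cong_refl [simp]: "a \<simeq> a (p^m)" by (simp add: pcong_def)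

lemma cong_sym: "a \<simeq> b (p^m) \<Longrightarrow> b \<simeq> a (p^m)"
  using Zp_uminus[of "(a - b) / P ^ m"] by (simp add: pcong_def minus_divide_left)

lemma cong_trans [trans]: "a \<simeq> b (p^m) \<Longrightarrow> b \<simeq> c (p^m) \<Longrightarrow> a \<simeq> c (p^m)"
  unfolding pcong_def using Zp_add[of "(a - b) / P ^ m" "(b - c) / P ^ m"]
  by (simp add: add_divide_distrib[symmetric])

text \<open>Stated separately because the general substitution rules behind \<open>also\<close> lead to an
  explosion of higher-order unifiers on large summands.\<close>

lemma cong_eq_trans [trans]: "a \<simeq> b (p^m) \<Longrightarrow> b = c \<Longrightarrow> a \<simeq> c (p^m)"
  and eq_cong_trans [trans]: "a = b \<Longrightarrow> b \<simeq> c (p^m) \<Longrightarrow> a \<simeq> c (p^m)"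
  by simp_all

lemma cong_add: "a \<simeq> b (p^m) \<Longrightarrow> c \<simeq> d (p^m) \<Longrightarrow> a + c \<simeq> b + d (p^m)"
  unfolding pcong_def using Zp_add[of "(a - b) / P ^ m" "(c - d) / P ^ m"]
  by (simp add: add_divide_distrib[symmetric] algebra_simps)

lemma cong_uminus: "a \<simeq> b (p^m) \<Longrightarrow> - a \<simeq> - b (p^m)"
  unfolding pcong_def using Zp_uminus[of "(a - b) / P ^ m"]
  by (simp add: minus_divide_left algebra_simps)

lemma cong_diff: "a \<simeq> b (p^m) \<Longrightarrow> c \<simeq> d (p^m) \<Longrightarrow> a - c \<simeq> b - d (p^m)"
  using cong_add[of m a b "- c" "- d"] cong_uminus by simp

lemma cong_sum: "(\<And>i. i \<in> A \<Longrightarrow> f i \<simeq> g i (p^m)) \<Longrightarrow> sum f A \<simeq> sum g A (p^m)"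
  by (induction A rule: infinite_finite_induct) (auto intro: cong_add)

lemma cong_mult_left: "a \<simeq> b (p^m) \<Longrightarrow> Zp c \<Longrightarrow> c * a \<simeq> c * b (p^m)"
  unfolding pcong_def using Zp_mult[of c "(a - b) / P ^ m"]
  by (simp add: algebra_simps)

lemma cong_mult: "a \<simeq> b (p^m) \<Longrightarrow> c \<simeq> d (p^m) \<Longrightarrow> Zp b \<Longrightarrow> Zp c \<Longrightarrow> a * c \<simeq> b * d (p^m)"
  using cong_mult_left[of m a b c] cong_mult_left[of m c d b] cong_trans
  by (metis mult.commute)

lemma cong_divide: "a \<simeq> b (p^m) \<Longrightarrow> unit_p c \<Longrightarrow> a / c \<simeq> b / c (p^m)"
  using cong_mult_left[of m a b "1 / c"] by (simp add: unit_p_def)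

lemma cong_Zp: "a \<simeq> b (p^m) \<Longrightarrow> Zp b \<Longrightarrow> Zp a"
  unfolding pcong_def using Zp_add[of "P ^ m * ((a - b) / P ^ m)" b] Zp_mult[of "P ^ m" "(a - b) / P ^ m"]
  by (auto intro: pint)

lemma cong_power: "a \<simeq> b (p^m) \<Longrightarrow> Zp b \<Longrightarrow> a ^ n \<simeq> b ^ n (p^m)"
  by (induction n) (auto intro!: cong_mult pint dest: cong_Zp)

lemma cong_mono: assumes "a \<simeq> b (p^n)" "m \<le> n" shows "a \<simeq> b (p^m)"
proof -
  have "(a - b) / P ^ m = P ^ (n - m) * ((a - b) / P ^ n)"
    using assms(2) by (simp add: power_diff)
  moreover have "Zp (P ^ (n - m) * ((a - b) / P ^ n))"
    using assms(1) by (intro Zp_mult) (auto simp: pcong_def intro: pint)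
  ultimately show ?thesis by (simp add: pcong_def)
qed

text \<open>The trade between factors and precision, in both directions: a factor
  \<open>P ^ k\<close> lets its cofactor be known less precisely, and can be divided out at the cost
  of \<open>k\<close> in the exponent.\<close>

lemma cong_scale_iff: "P ^ k * a \<simeq> P ^ k * b (p^(k + m)) \<longleftrightarrow> a \<simeq> b (p^m)"
proof -
  have "(P ^ k * a - P ^ k * b) / P ^ (k + m) = (a - b) / P ^ m"
    by (simp add: power_add right_diff_distrib[symmetric])
  then show ?thesis by (simp add: pcong_def)
qed

lemma cong_P_iff: "P * a \<simeq> P * b (p^Suc m) \<longleftrightarrow> a \<simeq> b (p^m)"
  using cong_scale_iff[of 1 m a b] by simp

lemma cong_0_I: "Zp c \<Longrightarrow> P ^ m * c \<simeq> 0 (p^m)"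
  by (simp add: pcong_def)

lemma cong_mult_0: "a \<simeq> 0 (p^m) \<Longrightarrow> b \<simeq> 0 (p^n) \<Longrightarrow> a * b \<simeq> 0 (p^(m + n))"
  unfolding pcong_def using Zp_mult[of "a / P ^ m" "b / P ^ n"] by (simp add: power_add)

lemma cong_0_iff: "a \<simeq> b (p^m) \<longleftrightarrow> a - b \<simeq> 0 (p^m)"
  by (simp add: pcong_def)

lemma cong_sum_0: "(\<And>i. i \<in> A \<Longrightarrow> f i \<simeq> 0 (p^m)) \<Longrightarrow> sum f A \<simeq> 0 (p^m)"
  using cong_sum[of A m f "\<lambda>_. 0"] by simp

text \<open>If \<open>p\<close> divided the numerator of \<open>a\<close>, then \<open>b\<close>
  would be congruent to 0, hence also \<open>1 = (1 / b) * b\<close>, and \<open>1 / p\<close> would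
  be integral.\<close>

lemma unit_p_cong: assumes "unit_p b" "a \<simeq> b (p^1)" shows "unit_p a"
proof -
  have "Zp a" using assms cong_Zp unit_pD by blast
  then obtain u v where uv: "\<not> int p dvd v" "a = of_int u / of_int v"
    using prime_p p_integral_iff by meson
  show ?thesis
  proof (cases "int p dvd u")
    case True
    then obtain w where "u = int p * w" by blast
    then have "a = P * (of_int w / of_int v)" using uv by simp
    moreover have "P ^ 1 * (of_int w / of_int v) \<simeq> 0 (p^1)" using Zp_I uv by (intro cong_0_I) auto
    ultimately have "a \<simeq> 0 (p^1)" by simp
    then have "b \<simeq> 0 (p^1)" using assms cong_sym cong_trans by blast
    then have "(1 / b) * b \<simeq> (1 / b) * 0 (p^1)"
      using assms by (intro cong_mult_left) (auto simp: unit_p_def)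
    then have "Zp (1 / P)" using assms by (simp add: pcong_def unit_p_def)
    then obtain x y where xy: "\<not> int p dvd y" "1 / P = of_int x / of_int y"
      using prime_p p_integral_iff by meson
    have "y \<noteq> 0" using xy by auto
    then have "(of_int y :: rat) = of_int (int p * x)" using xy(2) by (simp add: field_simps)
    then have "y = int p * x" by (simp only: of_int_eq_iff)
    then show ?thesis using xy by simp
  next
    case False
    then have "unit_p (of_int u / of_int v)" using uv unit_p_divide unit_p_of_int by blast
    then show ?thesis using uv by simp
  qed
qed

lemma cong_inverse:
  assumes "a \<simeq> b (p^m)" "unit_p a" "unit_p b" shows "1 / a \<simeq> 1 / b (p^m)"
proof -
  have "a / (a * b) \<simeq> b / (a * b) (p^m)" using assms by (intro cong_divide unit_p_mult)
  then show ?thesis using assms unit_pD by (simp add: cong_sym)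
qed

lemma cong_cancel: "c * a \<simeq> c * b (p^m) \<Longrightarrow> unit_p c \<Longrightarrow> a \<simeq> b (p^m)"
  using cong_divide[of m "c * a" "c * b" c] unit_pD by simp

lemma rat_cong_iff: "rat_cong p m a b \<longleftrightarrow> Zp b \<and> a \<simeq> b (p^m)"
proof
  assume "rat_cong p m a b"
  then obtain c where "Zp b" "Zp c" "a - b = P ^ m * c" by (auto simp: rat_cong_def)
  then show "Zp b \<and> a \<simeq> b (p^m)" by (simp add: pcong_def)
next
  assume "Zp b \<and> a \<simeq> b (p^m)"
  then show "rat_cong p m a b"
    unfolding rat_cong_def using cong_Zp
    by (auto simp: pcong_def intro!: exI[of _ "(a - b) / P ^ m"])
qed

lemma unit_p_numeral: "unit_p 2" "unit_p 3" "unit_p 4" "unit_p 6"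
  using unit_p_of_nat[OF not_dvd_2_3(1)] unit_p_of_nat[OF not_dvd_2_3(2)]
    unit_p_of_nat[OF not_dvd_2_3(3)] unit_p_of_nat[OF not_dvd_2_3(4)] by simp_all

lemma odd_p: "odd p"
  using prime_p p_gt_3 prime_odd_nat by auto

definition h :: nat where "h = (p - 1) div 2"

lemma p_eq: "p = 2 * h + 1"
  using odd_p by (auto simp: h_def elim!: oddE)

end

subsection \<open>Exact identities over the rationals\<close>

lemma harmonic_simps [simp]:
  "harmonic 0 = 0" "harmonic (Suc n) = harmonic n + 1 / of_nat (Suc n)"
  "harmonic2 0 = 0" "harmonic2 (Suc n) = harmonic2 n + 1 / (of_nat (Suc n))\<^sup>2"
  by (simp_all add: harmonic_def harmonic2_def)

lemma of_nat_choose_Suc_Suc: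
  "(of_nat (Suc n choose Suc k) :: rat) = of_nat (Suc n) / of_nat (Suc k) * of_nat (n choose k)"
proof -
  have "(of_nat (Suc k * (Suc n choose Suc k)) :: rat) = of_nat (Suc n * (n choose k))"
    by (simp only: Suc_times_binomial_eq mult.commute)
  then show ?thesis by (simp add: field_simps del: binomial_Suc_Suc)
qed

lemma of_nat_choose_Suc_right:
  "of_nat (Suc k) * (of_nat (n choose Suc k) :: rat) = (of_nat n - of_nat k) * of_nat (n choose k)"
proof (cases "k \<le> n")
  case True
  have "(of_nat (Suc k * (n choose Suc k)) :: rat) = of_nat ((n - k) * (n choose k))"
    by (metis binomial_absorb_comp binomial_absorption)
  then show ?thesis by (simp only: of_nat_mult of_nat_diff[OF True])
qed (simp add: binomial_eq_0)

lemma of_nat_choose_Suc_left: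
  "of_nat (Suc n) * (of_nat (n choose k) :: rat) = (of_nat (Suc n) - of_nat k) * of_nat (Suc n choose k)"
proof (cases "k \<le> Suc n")
  case True
  have "(of_nat ((Suc n - k) * (Suc n choose k)) :: rat) = of_nat (Suc n * (n choose k))"
    by (metis binomial_absorb_comp diff_Suc_1)
  then show ?thesis by (simp only: of_nat_mult of_nat_diff[OF True])
qed (simp add: binomial_eq_0)

lemma central_binomial_Suc:
  "(of_nat (2 * Suc k choose Suc k) :: rat) = 2 * of_nat (2 * k + 1) / of_nat (Suc k) * of_nat (2 * k choose k)"
proof -
  have "(of_nat (Suc (Suc (2 * k)) choose Suc k) :: rat)
      = of_nat (Suc (Suc (2 * k))) / of_nat (Suc k) * of_nat (Suc (2 * k) choose k)"
    by (rule of_nat_choose_Suc_Suc)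
  also have "(of_nat (Suc (2 * k) choose k) :: rat)
      = of_nat (Suc (2 * k)) / of_nat (Suc k) * of_nat (2 * k choose k)"
    using of_nat_choose_Suc_left[of "2 * k" k] by (simp add: field_simps)
  finally have "(of_nat (Suc (Suc (2 * k)) choose Suc k) :: rat)
      = of_nat (Suc (Suc (2 * k))) / of_nat (Suc k) * (of_nat (Suc (2 * k)) / of_nat (Suc k) * of_nat (2 * k choose k))" .
  moreover have "(of_nat (Suc (Suc (2 * k))) / of_nat (Suc k) :: rat) = 2"
    by (simp add: field_simps)
  moreover have "2 * Suc k = Suc (Suc (2 * k))" by simp
  ultimately show ?thesis by (simp only: Suc_eq_plus1)
qed

text \<open>Pascal's rule splits the binomial coefficient; shifting one of the two sums turns a
  finite difference of order \<open>N + 1\<close> into one of order \<open>N\<close> of the first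
  differences of \<open>F\<close>.\<close>

lemma alternating_binomial_sum_Suc:
  fixes F :: "nat \<Rightarrow> rat"
  shows "(\<Sum>j\<le>Suc N. (-1) ^ j * of_nat (Suc N choose j) * F j)
    = (\<Sum>j\<le>N. (-1) ^ j * of_nat (N choose j) * (F j - F (Suc j)))"
proof -
  have "(\<Sum>j\<le>Suc N. (-1) ^ j * of_nat (Suc N choose j) * F j)
      = F 0 + (\<Sum>j\<le>N. (-1) ^ Suc j * of_nat (Suc N choose Suc j) * F (Suc j))"
    by (subst sum.atMost_Suc_shift) simp
  also have "(\<Sum>j\<le>N. (-1) ^ Suc j * of_nat (Suc N choose Suc j) * F (Suc j))
      = (\<Sum>j\<le>N. (-1) ^ Suc j * of_nat (N choose j) * F (Suc j))
        + (\<Sum>j\<le>N. (-1) ^ Suc j * of_nat (N choose Suc j) * F (Suc j))"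
    by (simp add: sum.distrib[symmetric] algebra_simps)
  also have "F 0 + (\<dots>) = (\<Sum>j\<le>N. (-1) ^ Suc j * of_nat (N choose j) * F (Suc j))
        + (\<Sum>j\<le>Suc N. (-1) ^ j * of_nat (N choose j) * F j)"
    by (subst sum.atMost_Suc_shift) simp
  also have "\<dots> = (\<Sum>j\<le>N. (-1) ^ j * of_nat (N choose j) * (F j - F (Suc j)))"
    by (simp add: sum.distrib[symmetric] algebra_simps)
  finally show ?thesis .
qed

text \<open>Each difference in the upper index lowers the lower index by one and changes the sign;
  after \<open>N\<close> of them \<open>b + N\<close> has become \<open>b\<close>.\<close>

lemma alternating_binomial_choose_sum:
  "(\<Sum>j\<le>N. (-1) ^ j * of_nat (N choose j) * of_nat ((a + j) choose (b + N)) :: rat)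
    = (-1) ^ N * of_nat (a choose b)"
proof (induction N)
  case (Suc N)
  have *: "(of_nat ((a + j) choose Suc (b + N)) - of_nat ((a + Suc j) choose Suc (b + N)) :: rat)
      = - of_nat ((a + j) choose (b + N))" for j
    by simp
  show ?case
    using Suc by (simp only: alternating_binomial_sum_Suc * add_Suc_right) (simp add: sum_negf)
qed simp

section \<open>The weight and the closed form of the weighted coefficient sums\<close>

text \<open>A partial product of Euler's product for \<open>sin(pi n) / (pi n)\<close>.\<close>

definition trunc_sinc :: "nat \<Rightarrow> nat \<Rightarrow> rat" where
  "trunc_sinc n k = (\<Prod>j=1..k. 1 - (of_nat n)\<^sup>2 / (of_nat j)\<^sup>2)"

text \<open>Each factor is minus the product of \<open>(n - j) / j\<close> and
  \<open>(n + j) / j\<close>, which are the ratios of consecutive values of the two binomial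
  coefficients.\<close>

lemma trunc_sinc_eq:
  assumes "k < n"
  shows "trunc_sinc n k = (-1) ^ k * of_nat ((n - 1) choose k) * of_nat ((n + k) choose k)"
  using assms
proof (induction k)
  case (Suc k)
  have 1: "(of_nat ((n - 1) choose Suc k) :: rat) = (of_nat n - of_nat (Suc k)) / of_nat (Suc k) * of_nat ((n - 1) choose k)"
    using Suc.prems of_nat_choose_Suc_right[of k "n - 1"] by (simp add: field_simps of_nat_diff del: binomial_Suc_Suc)
  have 2: "(of_nat ((n + Suc k) choose Suc k) :: rat) = of_nat (Suc (n + k)) / of_nat (Suc k) * of_nat ((n + k) choose k)"
    using of_nat_choose_Suc_Suc[of "n + k" k] by simp
  have "trunc_sinc n (Suc k) = trunc_sinc n k * (1 - (of_nat n)\<^sup>2 / (of_nat (Suc k))\<^sup>2)"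
    by (simp add: trunc_sinc_def)
  also have "1 - (of_nat n)\<^sup>2 / (of_nat (Suc k))\<^sup>2
      = - ((of_nat n - of_nat (Suc k)) / of_nat (Suc k) * (of_nat (Suc (n + k)) / of_nat (Suc k)) :: rat)"
    by (simp add: field_simps power2_eq_square del: of_nat_Suc) (simp add: algebra_simps)
  finally show ?case
    using Suc unfolding 1 2 by simp
qed (simp add: trunc_sinc_def)

lemma sum_atMost_shift_from:
  fixes F :: "nat \<Rightarrow> 'a :: comm_monoid_add"
  assumes "i \<le> n" "\<And>k. k < i \<Longrightarrow> F k = 0"
  shows "(\<Sum>k\<le>n. F k) = (\<Sum>j\<le>n-i. F (i + j))"
proof -
  have "(\<Sum>k\<le>n. F k) = (\<Sum>k=i..n. F k)"
    using assms by (intro sum.mono_neutral_right) auto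
  also have "\<dots> = (\<Sum>j\<le>n-i. F (i + j))"
    using assms by (intro sum.reindex_bij_witness[of _ "\<lambda>j. i + j" "\<lambda>k. k - i"]) auto
  finally show ?thesis .
qed

text \<open>Each of the two binomial coefficients in \<open>trunc_sinc_eq\<close> absorbs one factor
  \<open>k choose i\<close>. Apart from constants this leaves \<open>C(N, j) C(n+i+j, n+i)\<close>
  with \<open>k = i + j\<close>, so the sum over \<open>k\<close> is a finite difference of order
  \<open>N\<close>.\<close>

lemma trunc_sinc_sum:
  assumes "i < n"
  shows "(\<Sum>k=0..n-1. trunc_sinc n k * of_nat ((k choose i)\<^sup>2 * (2 * i choose i)))
    = (-1) ^ (n - 1) * of_nat n / of_nat (2 * i + 1) * (trunc_sinc n i)\<^sup>2"
proof -
  define N where "N = n - 1 - i"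
  have n: "n = N + i + 1" using assms by (simp add: N_def)
  \<comment> \<open>The lower index \<open>n + i\<close> is written as \<open>2 * i + 1 + N\<close>
    to fit \<open>alternating_binomial_choose_sum\<close>; the remainder \<open>2 * i + 1\<close> is
    the origin of the denominators in the result.\<close>
  have *: "trunc_sinc n (i + j) * of_nat ((i + j) choose i) ^ 2
    = (-1) ^ i * (of_nat ((n - 1) choose i) * of_nat ((n + i) choose i))
      * ((-1) ^ j * of_nat (N choose j) * of_nat ((n + i + j) choose (2 * i + 1 + N)))" if "j \<le> N" for j
  proof -
    have "(of_nat ((n - 1) choose (i + j)) * of_nat ((i + j) choose i) :: rat)
        = of_nat ((n - 1) choose i) * of_nat (N choose j)"
      using choose_mult[of i "i + j" "n - 1"] that n by (simp flip: of_nat_mult)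
    moreover have "(of_nat ((n + (i + j)) choose (i + j)) * of_nat ((i + j) choose i) :: rat)
        = of_nat ((n + i) choose i) * of_nat ((n + i + j) choose (2 * i + 1 + N))"
    proof -
      have "(of_nat ((n + (i + j)) choose (i + j)) :: rat) = fact (n + i + j) / (fact (i + j) * fact n)"
        by (subst binomial_fact) (auto simp: add.assoc)
      moreover have "(of_nat ((i + j) choose i) :: rat) = fact (i + j) / (fact i * fact j)"
        by (subst binomial_fact) auto
      moreover have "(of_nat ((n + i) choose i) :: rat) = fact (n + i) / (fact i * fact n)"
        by (subst binomial_fact) auto
      moreover have "(of_nat ((n + i + j) choose (2 * i + 1 + N)) :: rat) = fact (n + i + j) / (fact (n + i) * fact j)"
      proof -
        have e: "2 * i + 1 + N = n + i" using n by simp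
        show ?thesis unfolding e by (subst binomial_fact) auto
      qed
      ultimately show ?thesis by simp
    qed
    moreover have "trunc_sinc n (i + j) * of_nat ((i + j) choose i) ^ 2
      = (-1) ^ i * (-1) ^ j * (of_nat ((n - 1) choose (i + j)) * of_nat ((i + j) choose i))
          * (of_nat ((n + (i + j)) choose (i + j)) * of_nat ((i + j) choose i))"
      using that n by (subst trunc_sinc_eq) (simp_all only: power2_eq_square power_add mult_ac)
    ultimately show ?thesis by (simp only: mult_ac)
  qed
  have "(\<Sum>k=0..n-1. trunc_sinc n k * of_nat ((k choose i)\<^sup>2 * (2 * i choose i)))
      = of_nat (2 * i choose i) * (\<Sum>j\<le>N. trunc_sinc n (i + j) * of_nat ((i + j) choose i) ^ 2)"
    using assms unfolding atLeast0AtMost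
    by (subst sum_atMost_shift_from[of i]) (auto simp: N_def sum_distrib_left mult_ac)
  also have "(\<Sum>j\<le>N. trunc_sinc n (i + j) * of_nat ((i + j) choose i) ^ 2)
      = (-1) ^ i * (of_nat ((n - 1) choose i) * of_nat ((n + i) choose i))
        * (\<Sum>j\<le>N. (-1) ^ j * of_nat (N choose j) * of_nat ((n + i + j) choose (2 * i + 1 + N)))"
    by (simp add: * sum_distrib_left)
  also have "(\<Sum>j\<le>N. (-1) ^ j * of_nat (N choose j) * of_nat ((n + i + j) choose (2 * i + 1 + N)) :: rat)
      = (-1) ^ N * of_nat ((n + i) choose (2 * i + 1))"
    by (rule alternating_binomial_choose_sum)
  finally have "(\<Sum>k=0..n-1. trunc_sinc n k * of_nat ((k choose i)\<^sup>2 * (2 * i choose i)))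
      = (-1) ^ (n - 1) * (of_nat ((n - 1) choose i) * of_nat ((n + i) choose i))
        * (of_nat ((n + i) choose (2 * i + 1)) * of_nat (2 * i choose i))"
    using n by (simp add: power_add)
  \<comment> \<open>The factor left over by the difference reproduces the product standing in front
    of it, so the weight at \<open>i\<close> comes out squared.\<close>
  also have "(of_nat ((n + i) choose (2 * i + 1)) * of_nat (2 * i choose i) :: rat)
      = of_nat n / of_nat (2 * i + 1) * (of_nat ((n - 1) choose i) * of_nat ((n + i) choose i))"
  proof -
    have f: "(fact (2 * i + 1) :: rat) = of_nat (2 * i + 1) * fact (2 * i)" "(fact n :: rat) = of_nat n * fact (n - 1)"
      using n by simp_all
    have e1: "(of_nat ((n + i) choose (2 * i + 1)) :: rat) = fact (n + i) / (fact (2 * i + 1) * fact N)"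
      using n by (subst binomial_fact) auto
    have e2: "(of_nat ((n - 1) choose i) :: rat) = fact (n - 1) / (fact i * fact N)"
      using n by (subst binomial_fact) auto
    have e3: "(of_nat (2 * i choose i) :: rat) = fact (2 * i) / (fact i * fact i)"
      by (subst binomial_fact) auto
    have e4: "(of_nat ((n + i) choose i) :: rat) = fact (n + i) / (fact i * fact n)"
      by (subst binomial_fact) auto
    show ?thesis unfolding e1 e2 e3 e4 f using n by (simp add: field_simps del: of_nat_Suc)
  qed
  also have "(-1) ^ (n - 1) * (of_nat ((n - 1) choose i) * of_nat ((n + i) choose i)) * (\<dots>)
      = (-1) ^ (n - 1) * of_nat n / of_nat (2 * i + 1) * (trunc_sinc n i)\<^sup>2"
    using assms by (simp add: trunc_sinc_eq power2_eq_square field_simps power_mult_distrib flip: power_add)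
  finally show ?thesis .
qed

section \<open>Coefficients of \<open>g_n\<close> and \<open>f_n\<close> and the binomial transform
  between them\<close>

definition g_coeff :: "nat \<Rightarrow> nat \<Rightarrow> rat" where
  "g_coeff n i = of_nat ((n choose i)\<^sup>2 * (2 * i choose i))"

definition f_coeff :: "nat \<Rightarrow> nat \<Rightarrow> rat" where
  "f_coeff n i = of_nat ((n choose i)\<^sup>2 * (2 * i choose n))"

lemma coeff_g_poly: "Polynomial.coeff (g_poly n) i = g_coeff n i"
  by (simp add: g_poly_def g_coeff_def Polynomial.coeff_sum binomial_eq_0)

lemma poly_g_poly: "poly (g_poly n) x = (\<Sum>i\<le>n. g_coeff n i * x ^ i)"
  by (simp add: g_poly_def g_coeff_def poly_sum poly_monom atLeast0AtMost)

lemma poly_f_poly: "poly (f_poly n) x = (\<Sum>i\<le>n. f_coeff n i * x ^ i)"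
  by (simp add: f_poly_def f_coeff_def poly_sum poly_monom atLeast0AtMost)

lemma g_coeff_eq_0: "n < i \<Longrightarrow> g_coeff n i = 0" and f_coeff_eq_0: "n < i \<Longrightarrow> f_coeff n i = 0"
  by (simp_all add: g_coeff_def f_coeff_def binomial_eq_0)

text \<open>With \<open>k = i + j\<close>, the two factors \<open>k choose i\<close> are absorbed
  into \<open>n choose k\<close> and \<open>2 * i choose k\<close>; the rest is Vandermonde's
  convolution for \<open>i + (n - i)\<close>.\<close>

lemma g_coeff_eq_binomial_transform:
  "g_coeff n i = (\<Sum>k\<le>n. of_nat (n choose k) * f_coeff k i)"
proof (cases "i \<le> n")
  case True
  have *: "(n choose (i + j)) * (((i + j) choose i)\<^sup>2 * (2 * i choose (i + j)))
      = (n choose i) * (2 * i choose i) * ((i choose j) * ((n - i) choose (n - i - j)))"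
    if "j \<le> n - i" for j
  proof -
    have "(n choose (i + j)) * ((i + j) choose i) = (n choose i) * ((n - i) choose j)"
      using choose_mult[of i "i + j" n] that True by simp
    moreover have "(2 * i choose (i + j)) * ((i + j) choose i) = (2 * i choose i) * (i choose j)"
      using choose_mult[of i "i + j" "2 * i"] by (cases "j \<le> i") (simp_all add: binomial_eq_0)
    moreover have "(n - i) choose (n - i - j) = (n - i) choose j" using that binomial_symmetric by metis
    moreover have "(n choose (i + j)) * (((i + j) choose i)\<^sup>2 * (2 * i choose (i + j)))
      = ((n choose (i + j)) * ((i + j) choose i)) * ((2 * i choose (i + j)) * ((i + j) choose i))"
      by (simp add: power2_eq_square)
    ultimately show ?thesis by (simp only:) simp
  qed
  have "(\<Sum>k\<le>n. (n choose k) * ((k choose i)\<^sup>2 * (2 * i choose k)))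
    = (\<Sum>j\<le>n-i. (n choose i) * (2 * i choose i) * ((i choose j) * ((n - i) choose (n - i - j))))"
    using True by (subst sum_atMost_shift_from[of i]) (simp_all add: * binomial_eq_0)
  also have "\<dots> = (n choose i)\<^sup>2 * (2 * i choose i)"
    using True vandermonde[of i "n - i" "n - i"] binomial_symmetric[of i n]
    by (simp add: sum_distrib_left[symmetric] power2_eq_square)
  finally show ?thesis
    by (simp only: g_coeff_def f_coeff_def of_nat_mult[symmetric] of_nat_sum[symmetric])
qed (simp add: g_coeff_def f_coeff_def binomial_eq_0)

text \<open>For \<open>k >= 1\<close>,
  \<open>C(N+1, k) / k - C(N, k) / k = C(N+1, k) / (N+1)\<close>, so raising \<open>N\<close> adds
  the transform divided by \<open>N + 1\<close>. The index \<open>k = 0\<close> falls outside this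
  pattern and accounts for the harmonic number.\<close>

lemma sum_g_coeff_over_index:
  "(\<Sum>n=1..N. g_coeff n i / of_nat n)
    = f_coeff 0 i * harmonic N + (\<Sum>k=1..N. of_nat (N choose k) * f_coeff k i / of_nat k)"
proof (induction N)
  case (Suc N)
  have *: "of_nat (Suc N choose k) * f_coeff k i / of_nat k - of_nat (N choose k) * f_coeff k i / of_nat k
      = of_nat (Suc N choose k) * f_coeff k i / of_nat (Suc N)" if "k \<ge> 1" for k
  proof -
    have "(of_nat (N choose k) :: rat) = (of_nat (Suc N) - of_nat k) / of_nat (Suc N) * of_nat (Suc N choose k)"
      using of_nat_choose_Suc_left[of N k] by (simp add: field_simps del: of_nat_Suc binomial_Suc_Suc)
    then show ?thesis using that by (simp only:) (simp add: field_simps del: of_nat_Suc binomial_Suc_Suc)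
  qed
  have "(\<Sum>k=1..Suc N. of_nat (Suc N choose k) * f_coeff k i / of_nat k) - (\<Sum>k=1..N. of_nat (N choose k) * f_coeff k i / of_nat k)
    = (\<Sum>k=1..Suc N. of_nat (Suc N choose k) * f_coeff k i / of_nat k - of_nat (N choose k) * f_coeff k i / of_nat k)"
    by (simp add: sum_subtractf binomial_eq_0)
  also have "\<dots> = (\<Sum>k=1..Suc N. of_nat (Suc N choose k) * f_coeff k i / of_nat (Suc N))"
    using * by (intro sum.cong) auto
  also have "\<dots> = (g_coeff (Suc N) i - f_coeff 0 i) / of_nat (Suc N)"
  proof -
    have "g_coeff (Suc N) i = (\<Sum>k=0..Suc N. of_nat (Suc N choose k) * f_coeff k i)"
      by (simp only: g_coeff_eq_binomial_transform[of "Suc N"] atLeast0AtMost)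
    also have "\<dots> = f_coeff 0 i + (\<Sum>k=1..Suc N. of_nat (Suc N choose k) * f_coeff k i)"
      by (subst sum.atLeast_Suc_atMost) simp_all
    finally show ?thesis by (simp only: sum_divide_distrib[symmetric]) simp
  qed
  finally show ?case using Suc by (simp add: add_divide_distrib diff_divide_distrib distrib_left)
qed simp

text \<open>The right side is an antidifference of the summand. At \<open>N = p - 1\<close> its
  factor \<open>Suc N\<close> is \<open>p\<close>, and \<open>2 * i choose Suc N\<close> vanishes as
  soon as \<open>2 * i <= N\<close>.\<close>

lemma alternating_f_coeff_sum:
  assumes "i \<ge> 1"
  shows "(\<Sum>k=1..N. (-1) ^ k * f_coeff k i / of_nat k)
    = (-1) ^ N * of_nat (Suc N) / (of_nat i)\<^sup>2 * of_nat (2 * i choose Suc N) * (of_nat (N choose i))\<^sup>2"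
proof (induction N)
  case (Suc N)
  let ?c = "of_nat (2 * i choose Suc N) :: rat" and ?x = "of_nat (Suc N) :: rat" and ?i = "of_nat i :: rat"
    and ?b = "of_nat (Suc N choose i) :: rat"
  have 1: "of_nat (Suc (Suc N)) * (of_nat (2 * i choose Suc (Suc N)) :: rat) = (2 * ?i - ?x) * ?c"
    using of_nat_choose_Suc_right[of "Suc N" "2 * i"] by simp
  have 2: "(of_nat (N choose i) :: rat) = (?x - ?i) / ?x * ?b"
    using of_nat_choose_Suc_left[of N i] by (simp add: field_simps del: of_nat_Suc binomial_Suc_Suc)
  have "(\<Sum>k=1..Suc N. (-1) ^ k * f_coeff k i / of_nat k)
    = (-1) ^ N * (?x / ?i\<^sup>2 * ?c * (of_nat (N choose i))\<^sup>2 - ?b\<^sup>2 * ?c / ?x)"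
    using Suc by (simp add: f_coeff_def algebra_simps del: of_nat_Suc binomial_Suc_Suc)
  also have "?x / ?i\<^sup>2 * ?c * (of_nat (N choose i))\<^sup>2 - ?b\<^sup>2 * ?c / ?x = - (((2 * ?i - ?x) * ?c) / ?i\<^sup>2 * ?b\<^sup>2)"
  proof -
    have "?x \<noteq> 0" "?i \<noteq> 0" using assms by simp_all
    then show ?thesis unfolding 2
      by (simp add: power2_eq_square field_simps del: of_nat_Suc binomial_Suc_Suc)
  qed
  finally show ?case unfolding 1[symmetric] by (simp del: binomial_Suc_Suc of_nat_Suc)
qed (use assms in simp)

section \<open>Finite differences of polynomials and summation by parts\<close>

text \<open>Absorption, \<open>(j+1) C(n+1, j+1) = (n+1) C(n, j)\<close>, uses up one power of
  \<open>j + 1\<close> and lowers the order of the difference and the degree together.\<close>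

lemma alternating_binomial_power_sum:
  assumes "r \<le> n"
  shows "(\<Sum>j\<le>n. (-1) ^ j * of_nat (n choose j) * of_nat j ^ r :: rat) = (if r = n then (-1) ^ n * fact n else 0)"
  using assms
proof (induction n arbitrary: r)
  case (Suc n)
  show ?case
  proof (cases r)
    case 0
    then show ?thesis using choose_alternating_sum[of "Suc n", where 'a = rat] by (simp del: binomial_Suc_Suc)
  next
    case r: (Suc s)
    have "(\<Sum>j\<le>Suc n. (-1) ^ j * of_nat (Suc n choose j) * of_nat j ^ r :: rat)
      = (\<Sum>j\<le>n. (-1) ^ Suc j * of_nat (Suc n choose Suc j) * of_nat (Suc j) ^ r)"
      using r by (subst sum.atMost_Suc_shift) simp
    also have "\<dots> = (\<Sum>j\<le>n. - of_nat (Suc n) * (\<Sum>t\<le>s. of_nat (s choose t) * ((-1) ^ j * of_nat (n choose j) * of_nat j ^ t)))"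
    proof (intro sum.cong refl)
      fix j
      have "(of_nat (Suc j) :: rat) ^ s = (\<Sum>t\<le>s. of_nat (s choose t) * of_nat j ^ t)"
        using binomial_ring[of "of_nat j :: rat" 1 s] by (simp add: add.commute)
      moreover have "(-1) ^ Suc j * of_nat (Suc n choose Suc j) * (of_nat (Suc j) :: rat) ^ r
        = - of_nat (Suc n) * ((-1) ^ j * of_nat (n choose j) * of_nat (Suc j) ^ s)"
        by (simp add: of_nat_choose_Suc_Suc r del: of_nat_Suc binomial_Suc_Suc)
      ultimately show "(-1) ^ Suc j * of_nat (Suc n choose Suc j) * (of_nat (Suc j) :: rat) ^ r
        = - of_nat (Suc n) * (\<Sum>t\<le>s. of_nat (s choose t) * ((-1) ^ j * of_nat (n choose j) * of_nat j ^ t))"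
        by (simp only: sum_distrib_left mult_ac)
    qed
    also have "\<dots> = - of_nat (Suc n) * (\<Sum>t\<le>s. of_nat (s choose t) * (\<Sum>j\<le>n. (-1) ^ j * of_nat (n choose j) * of_nat j ^ t))"
      unfolding sum_distrib_left by (rule sum.swap)
    also have "(\<Sum>t\<le>s. of_nat (s choose t) * (\<Sum>j\<le>n. (-1) ^ j * of_nat (n choose j) * of_nat j ^ t))
      = (\<Sum>t\<le>s. if t = n then of_nat (s choose t) * ((-1) ^ n * fact n :: rat) else 0)"
      using Suc r by (intro sum.cong) auto
    also have "\<dots> = (if s = n then (-1) ^ n * fact n else 0)"
      using Suc.prems r by (auto simp: sum.delta)
    finally show ?thesis using r by (auto simp: algebra_simps simp del: sum.atMost_Suc)
  qed
qed simp

lemma alternating_binomial_poly_sum: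
  assumes "degree q \<le> n"
  shows "(\<Sum>j\<le>n. (-1) ^ j * of_nat (n choose j) * poly q (of_nat j) :: rat) = (-1) ^ n * fact n * Polynomial.coeff q n"
proof -
  have "(\<Sum>j\<le>n. (-1) ^ j * of_nat (n choose j) * poly q (of_nat j))
    = (\<Sum>j\<le>n. \<Sum>r\<le>n. Polynomial.coeff q r * ((-1) ^ j * of_nat (n choose j) * of_nat j ^ r))"
  proof (intro sum.cong refl)
    fix j
    have "poly q (of_nat j) = (\<Sum>r\<le>n. Polynomial.coeff q r * of_nat j ^ r)"
      unfolding poly_altdef using assms by (intro sum.mono_neutral_left) (auto simp: coeff_eq_0)
    then show "(-1) ^ j * of_nat (n choose j) * poly q (of_nat j)
        = (\<Sum>r\<le>n. Polynomial.coeff q r * ((-1) ^ j * of_nat (n choose j) * of_nat j ^ r))"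
      by (simp add: sum_distrib_left mult_ac)
  qed
  also have "\<dots> = (\<Sum>r\<le>n. Polynomial.coeff q r * (\<Sum>j\<le>n. (-1) ^ j * of_nat (n choose j) * of_nat j ^ r))"
    unfolding sum_distrib_left by (rule sum.swap)
  also have "\<dots> = (\<Sum>r\<le>n. if r = n then Polynomial.coeff q n * ((-1) ^ n * fact n) else 0)"
    by (intro sum.cong) (auto simp: alternating_binomial_power_sum)
  finally show ?thesis by (simp add: mult_ac)
qed

text \<open>Abel summation; it is applied to a sequence \<open>a\<close> whose partial sums are
  known in closed form.\<close>

lemma sum_mult_harmonic:
  fixes a :: "nat \<Rightarrow> rat"
  shows "(\<Sum>k=1..N. a k * harmonic k)
    = harmonic N * (\<Sum>k=1..N. a k) - (\<Sum>j<N. (\<Sum>k=1..j. a k) / of_nat (Suc j))"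
  by (induction N) (simp_all add: algebra_simps)

text \<open>The squares are the values at \<open>j + 1\<close> of a polynomial of degree
  \<open>2 i\<close> with leading coefficient \<open>1 / (i!)^2\<close>, whose difference of order
  \<open>2 i\<close> is \<open>C(2i, i)\<close>. The sum lacks only the value at 0, which is
  1.\<close>

lemma alternating_sum_shifted_choose_square:
  "(\<Sum>j<2*i. (-1) ^ j * of_nat (2 * i choose Suc j) * (of_nat (j choose i))\<^sup>2 :: rat)
    = 1 - of_nat (2 * i choose i)"
proof (cases "i = 0")
  case False
  \<comment> \<open>As polynomials in \<open>x\<close>, \<open>r\<close> is \<open>i!\<close> times
    \<open>C(x - 1, i)\<close>, and \<open>q\<close> is the square of
    \<open>C(x - 1, i)\<close>.\<close>
  define r :: "rat poly" where "r = (\<Prod>l=1..i. [:- of_nat l, 1:])"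
  define q where "q = Polynomial.smult (1 / (fact i)\<^sup>2) (r\<^sup>2)"
  have r: "degree r = i" "lead_coeff r = 1"
  proof -
    show "degree r = i" unfolding r_def by (simp add: degree_prod_eq_sum_degree)
    show "lead_coeff r = 1" unfolding r_def by (subst lead_coeff_prod) simp
  qed
  then have "r \<noteq> 0" by auto
  then have "degree (r\<^sup>2) = 2 * i" using r by (simp add: degree_power_eq)
  moreover have "lead_coeff (r\<^sup>2) = 1" using r by (subst lead_coeff_power) simp
  ultimately have q: "degree q = 2 * i" "Polynomial.coeff q (2 * i) = 1 / (fact i)\<^sup>2"
    by (simp_all add: q_def)
  have q0: "poly q 0 = 1"
  proof -
    have "poly r 0 = (-1) ^ i * fact i"
      by (simp add: r_def poly_prod fact_prod prod.distrib[symmetric] flip: prod_constant) 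
        (simp add: prod_uminus)
    then show ?thesis by (simp add: q_def power_mult_distrib flip: power_mult)
  qed
  have qS: "poly q (of_nat (Suc j)) = (of_nat (j choose i))\<^sup>2" for j
  proof -
    have "poly r (of_nat (Suc j)) = (\<Prod>l=1..i. of_nat (Suc j) - of_nat l)"
      by (simp add: r_def poly_prod)
    also have "\<dots> = (\<Prod>l=0..<i. of_nat j - of_nat l)"
      by (rule prod.reindex_bij_witness[of _ Suc "\<lambda>l. l - 1"]) auto
    also have "\<dots> = fact i * of_nat (j choose i)"
      by (simp add: binomial_gbinomial gbinomial_prod_rev)
    finally show ?thesis by (simp add: q_def power_mult_distrib)
  qed
  have "(\<Sum>j\<le>2*i. (-1) ^ j * of_nat (2 * i choose j) * poly q (of_nat j)) = fact (2 * i) / (fact i)\<^sup>2"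
    using alternating_binomial_poly_sum[of q "2 * i"] q by simp
  also have "fact (2 * i) / (fact i)\<^sup>2 = (of_nat (2 * i choose i) :: rat)"
    by (subst binomial_fact) (auto simp: power2_eq_square)
  also have "(\<Sum>j\<le>2*i. (-1) ^ j * of_nat (2 * i choose j) * poly q (of_nat j))
    = 1 - (\<Sum>j<2*i. (-1) ^ j * of_nat (2 * i choose Suc j) * (of_nat (j choose i))\<^sup>2)"
    unfolding lessThan_Suc_atMost[symmetric]
    by (subst sum.lessThan_Suc_shift)
      (simp add: q0 qS sum_negf del: of_nat_Suc sum.lessThan_Suc)
  finally show ?thesis by simp
qed simp

text \<open>In the summation by parts the boundary term vanishes because
  \<open>2 * i < Suc N\<close>, and the factor \<open>Suc j\<close> of the partial sums cancels the
  weight \<open>1 / Suc j\<close>.\<close>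

lemma alternating_f_coeff_harmonic_sum:
  assumes "i \<ge> 1" "2 * i \<le> N"
  shows "(\<Sum>k=1..N. (-1) ^ k * f_coeff k i / of_nat k * harmonic k) = (of_nat (2 * i choose i) - 1) / (of_nat i)\<^sup>2"
proof -
  have "(\<Sum>k=1..N. (-1) ^ k * f_coeff k i / of_nat k * harmonic k)
    = - (\<Sum>j<N. (-1) ^ j * of_nat (Suc j) / (of_nat i)\<^sup>2 * of_nat (2 * i choose Suc j) * (of_nat (j choose i))\<^sup>2 / of_nat (Suc j))"
    using assms unfolding sum_mult_harmonic alternating_f_coeff_sum[OF assms(1)]
    by (simp add: binomial_eq_0 del: of_nat_Suc)
  also have "(\<Sum>j<N. (-1) ^ j * of_nat (Suc j) / (of_nat i)\<^sup>2 * of_nat (2 * i choose Suc j) * (of_nat (j choose i))\<^sup>2 / of_nat (Suc j) :: rat)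
     = (\<Sum>j<N. (-1) ^ j * of_nat (2 * i choose Suc j) * (of_nat (j choose i))\<^sup>2) / (of_nat i)\<^sup>2"
    by (simp add: sum_divide_distrib field_simps del: of_nat_Suc)
  also have "(\<Sum>j<N. (-1) ^ j * of_nat (2 * i choose Suc j) * (of_nat (j choose i))\<^sup>2 :: rat)
     = (\<Sum>j<2*i. (-1) ^ j * of_nat (2 * i choose Suc j) * (of_nat (j choose i))\<^sup>2)"
    using assms by (intro sum.mono_neutral_right) (auto simp: binomial_eq_0)
  finally show ?thesis by (simp add: alternating_sum_shifted_choose_square minus_divide_left)
qed

text \<open>The finite form of Apery's series for \<open>zeta(3)\<close>: as \<open>n\<close> grows,
  the second sum on the left tends to 0. In the induction the change of that sum with
  \<open>n\<close> telescopes in \<open>k\<close>.\<close>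

lemma apery_identity:
  "(\<Sum>k=1..n. 1 / (of_nat k) ^ 3) + (\<Sum>k=1..n. (-1) ^ Suc k / (of_nat k ^ 3 * of_nat (n choose k) * of_nat ((n + k) choose k))) / 2
    = 5 / 2 * (\<Sum>k=1..n. (-1) ^ Suc k / (of_nat k ^ 3 * of_nat (2 * k choose k)) :: rat)"
proof (induction n)
  case (Suc n)
  define y :: "nat \<Rightarrow> nat \<Rightarrow> rat" where
    "y n k = (-1) ^ Suc k / (of_nat k ^ 3 * of_nat (n choose k) * of_nat ((n + k) choose k))" for n k
  \<comment> \<open>The telescoping certificate, of Wilf-Zeilberger type: up to a factor independent
    of \<open>k\<close>, an antidifference in \<open>k\<close> of the change of \<open>y\<close>
    from \<open>n\<close> to \<open>Suc n\<close>.\<close>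
  define t :: "nat \<Rightarrow> rat" where "t k = (-1) ^ k * (fact k)\<^sup>2 * fact (n - k) / fact (Suc n + k)" for k
  define C :: rat where "C = of_nat (2 * Suc n choose Suc n)"
  let ?x = "of_nat (Suc n) :: rat"
  have y: "y n k = (-1) ^ Suc k / of_nat k ^ 3 * ((fact k)\<^sup>2 * fact (n - k) / fact (n + k))" if "k \<le> n" for n k
  proof -
    have "(of_nat (n choose k) :: rat) = fact n / (fact k * fact (n - k))"
      "(of_nat ((n + k) choose k) :: rat) = fact (n + k) / (fact k * fact n)"
      using that by (simp_all add: binomial_fact)
    then show ?thesis by (simp add: y_def power2_eq_square)
  qed
  have *: "y (Suc n) k - y n k = 2 / ?x\<^sup>2 * (t k - t (k - 1))" if kn: "k \<in> {1..n}" for k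
  proof -
    obtain l where k: "k = Suc l" using kn by (cases k) auto
    obtain d where n: "n = k + d" using kn le_Suc_ex by auto
    have 1: "Suc n - k = Suc d" "n - k = d" "n - l = Suc d" "Suc n + k = Suc (n + k)" "Suc n + l = n + k" 
      using n k by auto
    have "y (Suc n) k - y n k = (-1) ^ Suc k / of_nat k ^ 3 * ((fact k)\<^sup>2 * fact d / fact (Suc (n + k))) * (of_nat (Suc d) - of_nat (Suc (n + k)))"
    proof -
      have y1: "y (Suc n) k = (-1) ^ Suc k / of_nat k ^ 3
          * ((fact k)\<^sup>2 * (of_nat (Suc d) * fact d) / (of_nat (Suc (n + k)) * fact (n + k)))"
        using y[of k "Suc n"] kn by (simp add: 1)
      have y2: "y n k = (-1) ^ Suc k / of_nat k ^ 3 * ((fact k)\<^sup>2 * fact d / fact (n + k))"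
        using y[of k n] kn by (simp add: 1)
      show ?thesis using k unfolding y1 y2 fact_Suc by (simp add: field_simps del: of_nat_Suc)
    qed
    also have "(of_nat (Suc d) - of_nat (Suc (n + k)) :: rat) = - 2 * of_nat k"
      using n by simp
    finally have "y (Suc n) k - y n k = (-1) ^ k * 2 / of_nat k ^ 2 * ((fact k)\<^sup>2 * fact d / fact (Suc (n + k)))"
      using k by (simp add: power2_eq_square power3_eq_cube del: of_nat_Suc)
    also have "fact k = of_nat k * (fact l :: rat)" using k by simp
    finally have y': "y (Suc n) k - y n k = (-1) ^ k * 2 * ((fact l)\<^sup>2 * fact d / fact (Suc (n + k)))"
      using k by (simp add: power_mult_distrib del: of_nat_Suc)
    have "t k - t l = (-1) ^ k * (fact l)\<^sup>2 * fact d / fact (Suc (n + k)) * (of_nat k ^ 2 + of_nat (Suc d) * of_nat (Suc (n + k)))"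
      unfolding t_def 1 by (simp add: k power2_eq_square field_simps del: of_nat_Suc)
    also have "of_nat k ^ 2 + of_nat (Suc d) * of_nat (Suc (n + k)) = ?x\<^sup>2"
      using n by (simp add: power2_eq_square algebra_simps)
    finally show ?thesis using y' k by (simp del: of_nat_Suc)
  qed
  have "(\<Sum>k=1..n. y (Suc n) k) - (\<Sum>k=1..n. y n k) = 2 / ?x\<^sup>2 * (\<Sum>k=1..n. t k - t (k - 1))"
    unfolding sum_distrib_left sum_subtractf[symmetric] using * by (intro sum.cong) auto
  also have "(\<Sum>k=1..n. t k - t (k - 1)) = t n - t 0"
    by (induction n) simp_all
  also have "t 0 = 1 / ?x"
    by (simp add: t_def del: of_nat_Suc)
  also have "t n = (-1) ^ n * 2 / (?x * C)"
  proof -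
    have "C = fact (2 * Suc n) / (fact (Suc n))\<^sup>2"
      unfolding C_def by (subst binomial_fact) (auto simp: power2_eq_square)
    also have "(fact (2 * Suc n) :: rat) = 2 * ?x * fact (Suc n + n)"
    proof -
      have "2 * Suc n = Suc (Suc n + n)" by simp
      then have "(fact (2 * Suc n) :: rat) = of_nat (Suc (Suc n + n)) * fact (Suc n + n)"
        by (simp only: fact_Suc)
      then show ?thesis by simp
    qed
    finally have C: "C = 2 * ?x * fact (Suc n + n) / (?x * fact n)\<^sup>2" by simp
    have "fact (Suc n + n) \<noteq> (0 :: rat)" "?x \<noteq> 0" by (simp_all del: fact_Suc add_Suc)
    then show ?thesis unfolding C t_def
      by (simp add: power2_eq_square field_simps del: of_nat_Suc fact_Suc add_Suc)
  qed
  finally have "(\<Sum>k=1..n. y (Suc n) k) = (\<Sum>k=1..n. y n k) + 2 / ?x\<^sup>2 * ((-1) ^ n * 2 / (?x * C) - 1 / ?x)"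
    by simp
  moreover have "y (Suc n) (Suc n) = (-1) ^ n / (?x ^ 3 * C)"
    by (simp add: y_def C_def mult_2 del: of_nat_Suc binomial_Suc_Suc)
  ultimately have "(\<Sum>k=1..Suc n. 1 / (of_nat k) ^ 3) + (\<Sum>k=1..Suc n. y (Suc n) k) / 2
     = ((\<Sum>k=1..n. 1 / (of_nat k) ^ 3) + (\<Sum>k=1..n. y n k) / 2)
       + (1 / ?x ^ 3 + (2 / ?x\<^sup>2 * ((-1) ^ n * 2 / (?x * C) - 1 / ?x) + (-1) ^ n / (?x ^ 3 * C)) / 2)"
    by (simp add: add_divide_distrib del: of_nat_Suc)
  \<comment> \<open>The boundary value \<open>t 0\<close> cancels \<open>1 / ?x ^ 3\<close>. The
    boundary value \<open>t n\<close> contributes 2 and the new diagonal term \<open>1 / 2\<close>,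
    which together make the constant \<open>5 / 2\<close>.\<close>
  also have "(1 / ?x ^ 3 + (2 / ?x\<^sup>2 * ((-1) ^ n * 2 / (?x * C) - 1 / ?x) + (-1) ^ n / (?x ^ 3 * C)) / 2)
     = 5 / 2 * ((-1) ^ n / (?x ^ 3 * C))"
  proof -
    have "C \<noteq> 0" unfolding C_def of_nat_eq_0_iff binomial_eq_0_iff by simp
    then show ?thesis by (simp add: field_simps power2_eq_square power3_eq_cube del: of_nat_Suc)
  qed
  also note Suc[folded y_def]
  also have "5 / 2 * (\<Sum>k=1..n. (-1) ^ Suc k / (of_nat k ^ 3 * of_nat (2 * k choose k))) + 5 / 2 * ((-1) ^ n / (?x ^ 3 * C))
     = 5 / 2 * (\<Sum>k=1..Suc n. (-1) ^ Suc k / (of_nat k ^ 3 * of_nat (2 * k choose k)))"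
    by (simp add: C_def distrib_left del: of_nat_Suc binomial_Suc_Suc mult_Suc_right)
  finally show ?case by (simp only: y_def)
qed simp

section \<open>Binomial sums with harmonic numbers and reciprocals\<close>

text \<open>By Pascal's rule, passing from \<open>n\<close> to \<open>n + 1\<close> multiplies the
  sum by \<open>1 + y\<close> and adds \<open>((1 + y)^(n+1) - 1) / (n + 1)\<close>. The case of
  interest is \<open>y = -4\<close>.\<close>

lemma binomial_harmonic_sum:
  fixes y :: rat
  shows "(\<Sum>k\<le>n. of_nat (n choose k) * y ^ k * harmonic k)
    = (1 + y) ^ n * harmonic n - (\<Sum>k=1..n. (1 + y) ^ (n - k) / of_nat k)"
proof (induction n)
  case (Suc n)
  have "(\<Sum>k\<le>Suc n. of_nat (Suc n choose k) * y ^ k * harmonic k)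
     = (\<Sum>k\<le>n. of_nat (Suc n choose Suc k) * y ^ Suc k * harmonic (Suc k))"
    by (subst sum.atMost_Suc_shift) simp
  also have "\<dots> = (\<Sum>k\<le>n. of_nat (n choose Suc k) * y ^ Suc k * harmonic (Suc k))
      + y * (\<Sum>k\<le>n. of_nat (n choose k) * y ^ k * harmonic k)
      + (\<Sum>k\<le>n. of_nat (n choose k) / of_nat (Suc k) * y ^ Suc k)"
    by (simp add: sum_distrib_left sum.distrib[symmetric] algebra_simps add_divide_distrib)
  also have "(\<Sum>k\<le>n. of_nat (n choose Suc k) * y ^ Suc k * harmonic (Suc k))
      = (\<Sum>k\<le>n. of_nat (n choose k) * y ^ k * harmonic k)"
    using sum.atMost_Suc_shift[of "\<lambda>k. of_nat (n choose k) * y ^ k * harmonic k" n]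
    by (simp add: binomial_eq_0)
  also have "(\<Sum>k\<le>n. of_nat (n choose k) / of_nat (Suc k) * y ^ Suc k) = ((1 + y) ^ Suc n - 1) / of_nat (Suc n)"
  proof -
    have "(1 + y) ^ Suc n = (\<Sum>k\<le>Suc n. of_nat (Suc n choose k) * y ^ k)"
      using binomial_ring[of y 1 "Suc n"] by (simp add: add.commute)
    also have "\<dots> = 1 + (\<Sum>k\<le>n. of_nat (Suc n choose Suc k) * y ^ Suc k)"
      by (subst sum.atMost_Suc_shift) simp
    finally show ?thesis
      by (simp add: of_nat_choose_Suc_Suc sum_divide_distrib del: of_nat_Suc binomial_Suc_Suc power_Suc)
  qed
  also note Suc
  finally have "(\<Sum>k\<le>Suc n. of_nat (Suc n choose k) * y ^ k * harmonic k)
     = (1 + y) * ((1 + y) ^ n * harmonic n - (\<Sum>k=1..n. (1 + y) ^ (n - k) / of_nat k)) + ((1 + y) ^ Suc n - 1) / of_nat (Suc n)"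
    by (simp only: distrib_right mult_1)
  moreover have "(1 + y) * (\<Sum>k=1..n. (1 + y) ^ (n - k) / of_nat k) = (\<Sum>k=1..n. (1 + y) ^ (Suc n - k) / of_nat k)"
    unfolding sum_distrib_left by (intro sum.cong) (auto simp: Suc_diff_le)
  ultimately show ?case
    by (simp add: right_diff_distrib distrib_left diff_divide_distrib del: sum.atMost_Suc binomial_Suc_Suc)
qed simp

text \<open>The increment in \<open>n\<close> is \<open>1 / (n+1)\<close> times an alternating row
  sum without its term at 0, and that row sum equals 1.\<close>

lemma alternating_choose_div_sum:
  "(\<Sum>k=1..n. (-1) ^ Suc k * of_nat (n choose k) / of_nat k) = harmonic n"
proof (induction n)
  case (Suc n)
  have *: "(-1) ^ Suc k * of_nat (Suc n choose k) / of_nat k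
     = (-1) ^ Suc k * of_nat (n choose k) / of_nat k + 1 / of_nat (Suc n) * ((-1) ^ Suc k * of_nat (Suc n choose k) :: rat)"
    if "k \<ge> 1" for k
  proof -
    have "(of_nat (n choose k) :: rat) = (of_nat (Suc n) - of_nat k) / of_nat (Suc n) * of_nat (Suc n choose k)"
      using of_nat_choose_Suc_left[of n k] by (simp add: field_simps del: of_nat_Suc binomial_Suc_Suc)
    then show ?thesis using that by (simp only:) (simp add: field_simps del: of_nat_Suc binomial_Suc_Suc)
  qed
  have "(\<Sum>k=1..Suc n. (-1) ^ Suc k * of_nat (Suc n choose k) / of_nat k :: rat)
     = (\<Sum>k=1..Suc n. (-1) ^ Suc k * of_nat (n choose k) / of_nat k)
       + 1 / of_nat (Suc n) * (\<Sum>k=1..Suc n. (-1) ^ Suc k * of_nat (Suc n choose k))"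
    unfolding sum_distrib_left sum.distrib[symmetric] using * by (intro sum.cong) auto
  moreover have "(\<Sum>k=1..Suc n. (-1) ^ Suc k * of_nat (Suc n choose k) :: rat) = 1"
  proof -
    have "0 = (\<Sum>k=0..Suc n. (-1) ^ k * of_nat (Suc n choose k) :: rat)"
      using choose_alternating_sum[of "Suc n", where 'a = rat] by (simp only: atLeast0AtMost)
    also have "\<dots> = 1 - (\<Sum>k=1..Suc n. (-1) ^ Suc k * of_nat (Suc n choose k))"
      by (subst sum.atLeast_Suc_atMost) (simp_all add: sum_negf)
    finally show ?thesis by simp
  qed
  ultimately show ?case using Suc by (simp add: binomial_eq_0)
qed simp

text \<open>With one more power of \<open>k\<close> in the denominator, the increment in
  \<open>n\<close> is \<open>1 / (n+1)\<close> times the previous identity.\<close>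

lemma alternating_choose_div_square_sum:
  "(\<Sum>k=1..n. (-1) ^ Suc k * of_nat (n choose k) / (of_nat k)\<^sup>2) = ((harmonic n)\<^sup>2 + harmonic2 n) / 2"
proof (induction n)
  case (Suc n)
  have *: "(-1) ^ Suc k * of_nat (Suc n choose k) / (of_nat k)\<^sup>2
     = (-1) ^ Suc k * of_nat (n choose k) / (of_nat k)\<^sup>2 + 1 / of_nat (Suc n) * ((-1) ^ Suc k * of_nat (Suc n choose k) / of_nat k :: rat)"
    if "k \<ge> 1" for k
  proof -
    have "(of_nat (n choose k) :: rat) = (of_nat (Suc n) - of_nat k) / of_nat (Suc n) * of_nat (Suc n choose k)"
      using of_nat_choose_Suc_left[of n k] by (simp add: field_simps del: of_nat_Suc binomial_Suc_Suc)
    then show ?thesis using that by (simp only:) (simp add: field_simps power2_eq_square del: of_nat_Suc binomial_Suc_Suc)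
  qed
  have "(\<Sum>k=1..Suc n. (-1) ^ Suc k * of_nat (Suc n choose k) / (of_nat k)\<^sup>2 :: rat)
     = (\<Sum>k=1..Suc n. (-1) ^ Suc k * of_nat (n choose k) / (of_nat k)\<^sup>2)
       + 1 / of_nat (Suc n) * (\<Sum>k=1..Suc n. (-1) ^ Suc k * of_nat (Suc n choose k) / of_nat k)"
    unfolding sum_distrib_left sum.distrib[symmetric] using * by (intro sum.cong) auto
  moreover have "(\<Sum>k=1..Suc n. (-1) ^ Suc k * of_nat (n choose k) / (of_nat k)\<^sup>2 :: rat)
    = ((harmonic n)\<^sup>2 + harmonic2 n) / 2"
    using Suc by (simp add: binomial_eq_0)
  ultimately have "(\<Sum>k=1..Suc n. (-1) ^ Suc k * of_nat (Suc n choose k) / (of_nat k)\<^sup>2 :: rat)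
     = ((harmonic n)\<^sup>2 + harmonic2 n) / 2 + 1 / of_nat (Suc n) * (harmonic n + 1 / of_nat (Suc n))"
    unfolding alternating_choose_div_sum by (simp del: of_nat_Suc)
  also have "\<dots> = ((harmonic (Suc n))\<^sup>2 + harmonic2 (Suc n)) / 2"
    by (simp add: field_simps power2_eq_square del: of_nat_Suc)
  finally show ?case .
qed simp

text \<open>The summand counts triples \<open>a + b + c = n\<close> with weight
  \<open>(n! / (a! b! c!))\<^sup>2\<close>, where \<open>k = b + c\<close>; by symmetry the average of \<open>k\<close> is \<open>2 n / 3\<close>.\<close>

lemma sum_trinomial_squares:
  "(\<Sum>k\<le>n. g_coeff n k * (2 * of_nat n - 3 * of_nat k)) = 0"
proof -
  define M :: "nat \<Rightarrow> nat \<Rightarrow> rat" where "M a b = (of_nat (n choose a) * of_nat ((n - a) choose b))\<^sup>2" for a b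
  define X where "X a = (\<Sum>b\<le>n. M a b * of_nat b)" for a
  define S where "S = (\<Sum>a\<le>n. X a)"
  have ext: "(\<Sum>b\<le>n. M a b * f b) = (\<Sum>b\<le>n-a. M a b * f b)" for a f
    by (intro sum.mono_neutral_right) (auto simp: M_def binomial_eq_0)
  have c2: "(\<Sum>b\<le>N. (of_nat (N choose b))\<^sup>2) = (of_nat (2 * N choose N) :: rat)" for N
    using choose_square_sum[of N] by (simp flip: of_nat_power of_nat_sum)
  have g: "(\<Sum>b\<le>n. M a b) = g_coeff n (n - a)" if "a \<le> n" for a
    using ext[of a "\<lambda>_. 1"] that binomial_symmetric[OF that]
    by (simp add: M_def power_mult_distrib sum_distrib_left[symmetric] c2 g_coeff_def)
  have sym: "M a b = M b a" if "a \<le> n" "b \<le> n" for a b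
  proof (cases "a + b \<le> n")
    case True
    have "(n choose a) * ((n - a) choose b) = (n choose b) * ((n - b) choose a)"
      using choose_mult[of a "a + b" n] choose_mult[of b "a + b" n] binomial_symmetric[of a "a + b"] True by simp
    then show ?thesis unfolding M_def by (simp flip: of_nat_mult)
  qed (use that in \<open>simp add: M_def binomial_eq_0\<close>)
  have Sa: "(\<Sum>a\<le>n. \<Sum>b\<le>n. M a b * of_nat a) = S"
    unfolding S_def X_def by (subst sum.swap) (intro sum.cong refl, simp add: sym)
  \<comment> \<open>Exchange of \<open>b\<close> and \<open>c\<close>. Here \<open>c\<close> is a
    difference of rationals, because \<open>b\<close> also runs over values above
    \<open>n - a\<close>, where \<open>M\<close> vanishes.\<close>
  have reflect: "(\<Sum>b\<le>n. M a b * (of_nat (n - a) - of_nat b)) = X a" if "a \<le> n" for a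
  proof -
    have "(\<Sum>b\<le>n-a. M a b * (of_nat (n - a) - of_nat b)) = (\<Sum>b\<le>n-a. M a b * of_nat b)"
      by (rule sum.reindex_bij_witness[of _ "\<lambda>b. n - a - b" "\<lambda>b. n - a - b"])
        (auto simp: M_def of_nat_diff binomial_symmetric[of _ "n - a"])
    then show ?thesis using ext X_def by simp
  qed
  have "(\<Sum>a\<le>n. g_coeff n (n - a) * of_nat (n - a)) = (\<Sum>a\<le>n. 2 * X a)"
  proof (intro sum.cong refl)
    fix a assume "a \<in> {..n}"
    then have "2 * X a = (\<Sum>b\<le>n. M a b * (of_nat (n - a) - of_nat b)) + (\<Sum>b\<le>n. M a b * of_nat b)"
      using reflect by (simp add: X_def)
    also have "\<dots> = (\<Sum>b\<le>n. M a b) * of_nat (n - a)"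
      by (simp add: sum.distrib[symmetric] sum_distrib_right distrib_left[symmetric])
    finally show "g_coeff n (n - a) * of_nat (n - a) = 2 * X a" using \<open>a \<in> {..n}\<close> g by simp
  qed
  also have "\<dots> = 2 * S" by (simp add: S_def sum_distrib_left)
  finally have 1: "(\<Sum>a\<le>n. g_coeff n (n - a) * of_nat (n - a)) = 2 * S" .
  have "(\<Sum>a\<le>n. g_coeff n (n - a) * of_nat a) = S"
    unfolding Sa[symmetric] by (intro sum.cong refl) (simp add: g[symmetric] sum_distrib_right)
  with 1 have "(\<Sum>a\<le>n. g_coeff n (n - a) * (2 * of_nat a - of_nat (n - a))) = 0"
    by (simp add: right_diff_distrib sum_subtractf mult.left_commute sum_distrib_left[symmetric])
  moreover have "(\<Sum>k\<le>n. g_coeff n k * (2 * of_nat n - 3 * of_nat k))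
      = (\<Sum>a\<le>n. g_coeff n (n - a) * (2 * of_nat a - of_nat (n - a)))"
    by (rule sum.reindex_bij_witness[of _ "\<lambda>b. n - b" "\<lambda>b. n - b"]) (auto simp: of_nat_diff)
  ultimately show ?thesis by simp
qed

lemma g_num_eq: "g_num n = (\<Sum>k\<le>n. g_coeff n k)"
  by (simp add: g_num_def poly_g_poly)

text \<open>The right side telescopes. Term by term its increment differs from
  \<open>(4 n + 3) g_coeff n k\<close> by \<open>g_coeff n k * (2 n - 3 k)\<close>, and these
  differences sum to 0 by \<open>sum_trinomial_squares\<close>.\<close>

lemma weighted_g_num_sum:
  assumes "n > 0"
  shows "(\<Sum>k=0..n-1. of_nat (4 * k + 3) * g_num k)
    = 3 * (of_nat n)\<^sup>2 * (\<Sum>k=0..n-1. of_nat (((n - 1) choose k)\<^sup>2) * catalan_num k)"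
proof -
  define T where "T n = (\<Sum>k\<le>n. of_nat ((n choose k)\<^sup>2) * catalan_num k)" for n
  \<comment> \<open>For \<open>n = 0\<close> the truncated predecessor is harmless, since
    \<open>T (n - 1)\<close> carries the factor 0.\<close>
  have step: "3 * (of_nat (Suc n))\<^sup>2 * T n - 3 * (of_nat n)\<^sup>2 * T (n - 1) = of_nat (4 * n + 3) * g_num n" for n
  proof (cases n)
    case (Suc l)
    have "3 * (of_nat (Suc n))\<^sup>2 * (of_nat ((n choose k)\<^sup>2) * catalan_num k) - 3 * (of_nat n)\<^sup>2 * (of_nat ((l choose k)\<^sup>2) * catalan_num k)
      = of_nat (4 * n + 3) * g_coeff n k + g_coeff n k * (2 * of_nat n - 3 * of_nat k)" for k
    proof -
      have "of_nat n * (of_nat (l choose k) :: rat) = (of_nat n - of_nat k) * of_nat (n choose k)"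
        using of_nat_choose_Suc_left[of l k] Suc by simp
      then have "(of_nat n)\<^sup>2 * (of_nat (l choose k))\<^sup>2 = ((of_nat n - of_nat k) * of_nat (n choose k) :: rat)\<^sup>2"
        by (simp only: power_mult_distrib[symmetric])
      then have "3 * (of_nat (Suc n))\<^sup>2 * (of_nat ((n choose k)\<^sup>2) * catalan_num k) - 3 * (of_nat n)\<^sup>2 * (of_nat ((l choose k)\<^sup>2) * catalan_num k)
        = 3 * ((of_nat (Suc n))\<^sup>2 - (of_nat n - of_nat k)\<^sup>2) * (of_nat (n choose k))\<^sup>2 * catalan_num k"
        by (simp only: power_mult_distrib of_nat_power) (simp add: algebra_simps)
      also have "\<dots> = 3 * (2 * of_nat n + 1 - of_nat k) * g_coeff n k"
        by (simp add: g_coeff_def catalan_num_def field_simps power2_eq_square)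
      finally show ?thesis by (simp add: algebra_simps)
    qed
    moreover have "T l = (\<Sum>k\<le>n. of_nat ((l choose k)\<^sup>2) * catalan_num k)"
      unfolding T_def by (rule sum.mono_neutral_left) (auto simp: Suc binomial_eq_0)
    ultimately have "3 * (of_nat (Suc n))\<^sup>2 * T n - 3 * (of_nat n)\<^sup>2 * T l
      = (\<Sum>k\<le>n. of_nat (4 * n + 3) * g_coeff n k + g_coeff n k * (2 * of_nat n - 3 * of_nat k))"
      by (simp only: T_def sum_distrib_left sum_subtractf[symmetric])
    also have "\<dots> = of_nat (4 * n + 3) * g_num n"
      by (simp only: sum.distrib sum_trinomial_squares g_num_eq sum_distrib_left add_0_right)
    finally show ?thesis using Suc by simp
  qed (simp add: T_def g_num_eq g_coeff_def catalan_num_def)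
  have "(\<Sum>k=0..n. of_nat (4 * k + 3) * g_num k) = 3 * (of_nat (Suc n))\<^sup>2 * T n" for n
  proof (induction n)
    case (Suc n)
    then show ?case using step[of "Suc n"] by simp
  qed (use step[of 0] in simp)
  from this[of "n - 1"] show ?thesis using assms by (simp add: T_def atLeast0AtMost)
qed

section \<open>Pairings of the indices up to an even bound\<close>

lemma sum_odd_interval_centre:
  fixes f :: "nat \<Rightarrow> 'a :: comm_monoid_add"
  shows "(\<Sum>k=0..2*h. f k) = f h + (\<Sum>i=1..h. f (h + i) + f (h - i))"
proof -
  have "(\<Sum>k=0..2*h. f k) = (\<Sum>k\<in>{0..<h} \<union> {h} \<union> {h<..2*h}. f k)"
    by (intro sum.cong) auto
  also have "\<dots> = (\<Sum>k\<in>{0..<h}. f k) + f h + (\<Sum>k\<in>{h<..2*h}. f k)"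
    by (subst sum.union_disjoint; auto simp: sum.union_disjoint add_ac)
  also have "(\<Sum>k\<in>{0..<h}. f k) = (\<Sum>i=1..h. f (h - i))"
    by (rule sum.reindex_bij_witness[of _ "\<lambda>i. h - i" "\<lambda>k. h - k"]) auto
  also have "(\<Sum>k\<in>{h<..2*h}. f k) = (\<Sum>i=1..h. f (h + i))"
    by (rule sum.reindex_bij_witness[of _ "\<lambda>i. h + i" "\<lambda>k. k - h"]) auto
  finally show ?thesis by (simp add: sum.distrib add_ac)
qed

lemma sum_even_interval_halves:
  fixes f :: "nat \<Rightarrow> 'a :: comm_monoid_add"
  shows "(\<Sum>k=1..2*h. f k) = (\<Sum>k=1..h. f k + f (2 * h + 1 - k))"
proof -
  have "(\<Sum>k=1..2*h. f k) = (\<Sum>k\<in>{1..h} \<union> {h<..2*h}. f k)"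
    by (intro sum.cong) auto
  also have "\<dots> = (\<Sum>k=1..h. f k) + (\<Sum>k\<in>{h<..2*h}. f k)"
    by (rule sum.union_disjoint) auto
  also have "(\<Sum>k\<in>{h<..2*h}. f k) = (\<Sum>k=1..h. f (2 * h + 1 - k))"
    by (rule sum.reindex_bij_witness[of _ "\<lambda>i. 2 * h + 1 - i" "\<lambda>k. 2 * h + 1 - k"]) auto
  finally show ?thesis by (simp add: sum.distrib)
qed

text \<open>With \<open>p = 2 h + 1\<close>, every index below \<open>p\<close> is either
  \<open>2 i\<close> or \<open>p - 2 i\<close>. Compared with the pairing of \<open>k\<close> and
  \<open>p - k\<close>, this yields a second relation for the same sum.\<close>

lemma sum_even_interval_parity:
  fixes f :: "nat \<Rightarrow> 'a :: comm_monoid_add"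
  shows "(\<Sum>k=1..2*h. f k) = (\<Sum>i=1..h. f (2 * i) + f (2 * h + 1 - 2 * i))"
proof -
  have "(\<Sum>k=1..2*h. f k) = (\<Sum>k\<in>{k\<in>{1..2*h}. even k} \<union> {k\<in>{1..2*h}. odd k}. f k)"
    by (intro sum.cong) auto
  also have "\<dots> = (\<Sum>k | k\<in>{1..2*h} \<and> even k. f k) + (\<Sum>k | k\<in>{1..2*h} \<and> odd k. f k)"
    by (rule sum.union_disjoint) auto
  also have "(\<Sum>k | k\<in>{1..2*h} \<and> even k. f k) = (\<Sum>i=1..h. f (2 * i))"
    by (rule sum.reindex_bij_witness[of _ "\<lambda>i. 2 * i" "\<lambda>k. k div 2"]) auto
  also have "(\<Sum>k | k\<in>{1..2*h} \<and> odd k. f k) = (\<Sum>i=1..h. f (2 * h + 1 - 2 * i))"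
    by (rule sum.reindex_bij_witness[of _ "\<lambda>i. 2 * h + 1 - 2 * i" "\<lambda>k. (2 * h + 1 - k) div 2"])
      (auto elim!: oddE simp flip: diff_mult_distrib2)
  finally show ?thesis by (simp add: sum.distrib)
qed

subsection \<open>Harmonic sums modulo powers of \<open>p\<close>\<close>

context large_prime
begin

lemma p_minus_1: "p - 1 = 2 * h" and P_eq: "P = 2 * of_nat h + 1" and h_less: "h < p"
  using p_eq by (simp_all)

lemma unit_p_range: "k \<in> {1..p - 1} \<Longrightarrow> unit_p (of_nat k)"
  using unit_p_less[of k] by auto

lemma unit_p_half_range: "k \<in> {1..h} \<Longrightarrow> unit_p (of_nat k)"
  using unit_p_range p_eq by auto

lemma Zp_harmonic [pint]: "n < p \<Longrightarrow> Zp (harmonic n)"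
  and Zp_harmonic2 [pint]: "n < p \<Longrightarrow> Zp (harmonic2 n)"
  unfolding harmonic_def harmonic2_def by (auto intro!: pint unit_p_power unit_p_less)

text \<open>\<open>C(p-1, k)\<close> is the product of \<open>p / j - 1\<close> over
  \<open>j <= k\<close>; modulo \<open>p^2\<close> only the constant and linear terms in
  \<open>p\<close> survive.\<close>

lemma cong_choose_pred: "k < p \<Longrightarrow> of_nat ((p - 1) choose k) \<simeq> (-1) ^ k * (1 - P * harmonic k) (p^2)"
proof (induction k)
  case (Suc k)
  have u: "unit_p (of_nat (Suc k))" using Suc.prems by (intro unit_p_less) auto
  have "of_nat (Suc k) * (of_nat ((p - 1) choose Suc k) :: rat) = (P - of_nat (Suc k)) * of_nat ((p - 1) choose k)"
    using of_nat_choose_Suc_right[of k "p - 1"] p_gt_3 by (simp add: of_nat_diff)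
  then have 1: "of_nat ((p - 1) choose Suc k) = (P / of_nat (Suc k) - 1) * of_nat ((p - 1) choose k)"
    by (simp add: field_simps del: of_nat_Suc)
  have "(P / of_nat (Suc k) - 1) * of_nat ((p - 1) choose k)
      \<simeq> (P / of_nat (Suc k) - 1) * ((-1) ^ k * (1 - P * harmonic k)) (p^2)"
    using Suc u by (intro cong_mult_left pint) auto
  also have "\<dots> \<simeq> (-1) ^ Suc k * (1 - P * harmonic (Suc k)) (p^2)"
  proof -
    have "(P / of_nat (Suc k) - 1) * ((-1) ^ k * (1 - P * harmonic k)) - (-1) ^ Suc k * (1 - P * harmonic (Suc k))
      = P ^ 2 * ((-1) ^ Suc k * harmonic k / of_nat (Suc k))"
      by (simp add: algebra_simps power2_eq_square del: of_nat_Suc)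
    then show ?thesis
      unfolding cong_0_iff[of _ "(P / of_nat (Suc k) - 1) * ((-1) ^ k * (1 - P * harmonic k))"]
      using Suc.prems u by (simp only:) (intro cong_0_I pint; simp)
  qed
  finally show ?case unfolding 1 .
qed simp

lemma cong_choose_pred': "k < p \<Longrightarrow> of_nat ((p - 1) choose k) \<simeq> (-1) ^ k (p^1)"
proof -
  assume k: "k < p"
  have "of_nat ((p - 1) choose k) \<simeq> (-1) ^ k * (1 - P * harmonic k) (p^1)"
    using cong_choose_pred[OF k] cong_mono by simp
  also have "(-1) ^ k * (1 - P * harmonic k) \<simeq> (-1) ^ k (p^1)"
  proof -
    have "(-1) ^ k * (1 - P * harmonic k) - (-1) ^ k = P ^ 1 * ((-1) ^ Suc k * harmonic k)"
      by (simp add: algebra_simps)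
    moreover have "P ^ 1 * ((-1) ^ Suc k * harmonic k) \<simeq> 0 (p^1)"
      using k by (intro cong_0_I pint) auto
    ultimately show ?thesis by (metis cong_0_iff)
  qed
  finally show ?thesis .
qed

text \<open>In the expansion of the product by powers of \<open>p^2\<close>, everything beyond the
  linear term carries \<open>p^4\<close>.\<close>

lemma cong_trunc_sinc: "k < p \<Longrightarrow> trunc_sinc p k \<simeq> 1 - P\<^sup>2 * harmonic2 k (p^4)"
proof (induction k)
  case (Suc k)
  have u: "unit_p ((of_nat (Suc k))\<^sup>2)" using Suc.prems by (intro unit_p_power unit_p_less) auto
  have "trunc_sinc p (Suc k) = trunc_sinc p k * (1 - P\<^sup>2 / (of_nat (Suc k))\<^sup>2)"
    by (simp add: trunc_sinc_def)
  also have "\<dots> \<simeq> (1 - P\<^sup>2 * harmonic2 k) * (1 - P\<^sup>2 / (of_nat (Suc k))\<^sup>2) (p^4)"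
    using Suc u by (intro cong_mult pint) auto
  also have "\<dots> \<simeq> 1 - P\<^sup>2 * harmonic2 (Suc k) (p^4)"
  proof -
    have "(1 - P\<^sup>2 * harmonic2 k) * (1 - P\<^sup>2 / (of_nat (Suc k))\<^sup>2) - (1 - P\<^sup>2 * harmonic2 (Suc k))
       = P ^ 4 * (harmonic2 k / (of_nat (Suc k))\<^sup>2)"
      by (simp add: field_simps power4_eq_xxxx power2_eq_square del: of_nat_Suc)
    moreover have "P ^ 4 * (harmonic2 k / (of_nat (Suc k))\<^sup>2) \<simeq> 0 (p^4)"
      using Suc.prems u by (intro cong_0_I pint) auto
    ultimately show ?thesis by (metis cong_0_iff)
  qed
  finally show ?case .
qed (simp add: trunc_sinc_def)

lemma Zp_trunc_sinc [pint]: "k < p \<Longrightarrow> Zp (trunc_sinc p k)"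
  using cong_trunc_sinc[of k] cong_Zp by (auto intro!: pint)

lemma fermat_cong: "unit_p (of_nat k) \<Longrightarrow> of_nat k ^ (p - 1) \<simeq> 1 (p^1)"
proof -
  assume u: "unit_p (of_nat k)"
  have "\<not> p dvd k"
  proof
    assume "p dvd k"
    then obtain l where "k = p * l" by blast
    then have "P ^ 1 * of_nat l = of_nat k" by simp
    moreover have "P ^ 1 * of_nat l \<simeq> 0 (p^1)" by (intro cong_0_I pint)
    ultimately have "0 \<simeq> of_nat k (p^1)" using cong_sym by metis
    then have "unit_p 0" using u unit_p_cong by blast
    then show False by (simp add: unit_p_def)
  qed
  then have "[k ^ (p - 1) = 1] (mod p)" using prime_p fermat_theorem by blast
  then have "[int (k ^ (p - 1)) = int 1] (mod int p)" using cong_int_iff by blast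
  then have "int p dvd int (k ^ (p - 1)) - 1" by (simp add: cong_iff_dvd_diff)
  then obtain l where l: "int (k ^ (p - 1)) - 1 = int p * l" by blast
  have "(of_nat k ^ (p - 1) :: rat) - 1 = of_int (int (k ^ (p - 1)) - 1)" by simp
  also have "\<dots> = P ^ 1 * of_int l" unfolding l by simp
  finally show ?thesis unfolding cong_0_iff[of _ "of_nat k ^ (p - 1)"]
    using cong_0_I[of "of_int l" 1] by simp
qed

text \<open>The differences \<open>(k+1)^(j+1) - k^(j+1)\<close> add up to \<open>p^(j+1)\<close>.
  Expanded, they express this by the power sums up to exponent \<open>j\<close>, and the coefficient
  \<open>j + 1\<close> of the last one is a unit. Since \<open>0 ^ 0 = 1\<close>, the sum for
  \<open>j = 0\<close> is \<open>p\<close>.\<close>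

lemma power_sum_cong_0:
  assumes "j < p - 1" shows "(\<Sum>k=0..p-1. of_nat k ^ j) \<simeq> 0 (p^1)"
  using assms
proof (induction j rule: less_induct)
  case (less j)
  have *: "(\<Sum>k=0..n. (of_nat (Suc k) ^ Suc j - of_nat k ^ Suc j :: rat)) = of_nat (Suc n) ^ Suc j" for n
    by (induction n) simp_all
  have "P ^ Suc j = (\<Sum>k=0..p-1. \<Sum>i\<le>j. of_nat (Suc j choose i) * of_nat k ^ i)"
    using *[of "p - 1", symmetric] p_gt_3 binomial_ring[of "of_nat _ :: rat" 1 "Suc j"]
    by (simp add: add.commute del: power_Suc binomial_Suc_Suc)
  also have "\<dots> = (\<Sum>i\<le>j. of_nat (Suc j choose i) * (\<Sum>k=0..p-1. of_nat k ^ i))"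
    unfolding sum_distrib_left by (rule sum.swap)
  also have "{..j} = insert j {..<j}" by auto
  also have "(\<Sum>i\<in>insert j {..<j}. of_nat (Suc j choose i) * (\<Sum>k=0..p-1. of_nat k ^ i :: rat))
     = of_nat (Suc j) * (\<Sum>k=0..p-1. of_nat k ^ j) + (\<Sum>i<j. of_nat (Suc j choose i) * (\<Sum>k=0..p-1. of_nat k ^ i))"
    by (subst sum.insert) auto
  finally have "of_nat (Suc j) * (\<Sum>k=0..p-1. of_nat k ^ j)
      = P ^ 1 * P ^ j - (\<Sum>i<j. of_nat (Suc j choose i) * (\<Sum>k=0..p-1. of_nat k ^ i))"
    by simp
  also have "\<dots> \<simeq> 0 - 0 (p^1)"
  proof (intro cong_diff cong_0_I pint cong_sum_0)
    fix i assume "i \<in> {..<j}"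
    then have "(\<Sum>k=0..p-1. of_nat k ^ i) \<simeq> 0 (p^1)" using less by simp
    from cong_mult_left[OF this, of "of_nat (Suc j choose i)"]
    show "of_nat (Suc j choose i) * (\<Sum>k=0..p-1. of_nat k ^ i) \<simeq> 0 (p^1)" by (simp del: binomial_Suc_Suc)
  qed
  also have "0 - 0 = of_nat (Suc j) * (0 :: rat)" by simp
  finally show ?case using less.prems by (elim cong_cancel) (intro unit_p_less; simp)
qed

lemma inverse_power_cong:
  assumes "k \<in> {1..p-1}" "j \<le> p - 1"
  shows "1 / of_nat k ^ j \<simeq> of_nat k ^ (p - 1 - j) (p^1)"
proof -
  have u: "unit_p (of_nat k)" using assms unit_p_range by blast
  then have "of_nat k ^ (p - 1) / of_nat k ^ j \<simeq> 1 / of_nat k ^ j (p^1)"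
    by (intro cong_divide unit_p_power fermat_cong)
  also have "of_nat k ^ (p - 1) / of_nat k ^ j = (of_nat k ^ (p - 1 - j) :: rat)"
    using assms u by (subst power_diff) (auto simp: unit_p_def)
  finally show ?thesis by (rule cong_sym)
qed

text \<open>Fermat replaces the exponent \<open>-j\<close> by \<open>p - 1 - j\<close>, which is
  positive, so the index 0 can be added without changing the sum.\<close>

lemma inverse_power_sum_cong_0:
  assumes "j \<ge> 1" "j < p - 1"
  shows "(\<Sum>k=1..p-1. 1 / of_nat k ^ j) \<simeq> 0 (p^1)"
proof -
  have "(\<Sum>k=1..p-1. 1 / of_nat k ^ j) \<simeq> (\<Sum>k=1..p-1. of_nat k ^ (p - 1 - j)) (p^1)"
    using assms by (intro cong_sum inverse_power_cong) auto
  also have "(\<Sum>k=1..p-1. of_nat k ^ (p - 1 - j) :: rat) = (\<Sum>k=0..p-1. of_nat k ^ (p - 1 - j))"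
    using assms by (intro sum.mono_neutral_left) (auto simp: Suc_le_eq)
  also have "\<dots> \<simeq> 0 (p^1)" using assms by (intro power_sum_cong_0) auto
  finally show ?thesis .
qed

lemma harmonic2_pred_cong_0: "harmonic2 (p - 1) \<simeq> 0 (p^1)"
  unfolding harmonic2_def using inverse_power_sum_cong_0[of 2] p_gt_3 by simp

section \<open>Reflection of \<open>k\<close> into \<open>p - k\<close>\<close>

lemma cong_0_divide_I: "Zp c \<Longrightarrow> a - b = P ^ n * c \<Longrightarrow> a \<simeq> b (p^n)"
  using cong_0_I cong_0_iff by metis

lemma unit_p_P_minus: "unit_p a \<Longrightarrow> unit_p (P - a)"
proof -
  assume "unit_p a"
  moreover have "P - a \<simeq> - a (p^1)" by (rule cong_0_divide_I[of 1]) simp_all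
  ultimately show ?thesis using unit_p_cong unit_p_uminus by blast
qed

lemma reflect_inverse_cong: "unit_p a \<Longrightarrow> 1 / (P - a) \<simeq> - (1 / a) (p^1)"
proof -
  assume a: "unit_p a"
  have "1 / (P - a) - - (1 / a) = P ^ 1 * (1 / (a * (P - a)))"
    using a unit_p_P_minus[OF a] by (simp add: unit_p_def field_simps)
  then show ?thesis using a unit_p_P_minus[OF a]
    by (intro cong_0_divide_I[of "1 / (a * (P - a))"]) (auto intro!: pint unit_p_mult)
qed

text \<open>The first two terms of the expansion of \<open>(1 - P / a)^(-2) / a^2\<close> in powers
  of \<open>P\<close>.\<close>

lemma reflect_inverse_square_cong: "unit_p a \<Longrightarrow> 1 / (P - a)\<^sup>2 \<simeq> 1 / a\<^sup>2 + 2 * P / a ^ 3 (p^2)"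
proof -
  assume a: "unit_p a"
  define b where "b = P - a"
  have b: "unit_p b" unfolding b_def using a by (rule unit_p_P_minus)
  have P: "P = a + b" by (simp add: b_def)
  have "1 / b\<^sup>2 - (1 / a\<^sup>2 + 2 * P / a ^ 3) = P ^ 2 * ((3 * a - 2 * P) / (a ^ 3 * b\<^sup>2))"
    using unit_pD[OF a] unit_pD[OF b] unfolding P power2_eq_square power3_eq_cube by (simp add: field_simps)
  then show ?thesis unfolding b_def[symmetric]
    using a b by (intro cong_0_divide_I[of "(3 * a - 2 * P) / (a ^ 3 * b\<^sup>2)"] pint unit_p_mult unit_p_power)
      (auto intro: unit_pD)
qed

lemma harmonic_reflect_cong: "k < p \<Longrightarrow> harmonic (p - 1 - k) \<simeq> harmonic (p - 1) + harmonic k (p^1)"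
proof (induction k)
  case (Suc k)
  have "p - 1 - k = Suc (p - 1 - Suc k)" using Suc.prems by simp
  then have "harmonic (p - 1 - k) = harmonic (p - 1 - Suc k) + 1 / of_nat (p - 1 - k)" by simp
  moreover have "of_nat (p - 1 - k) = P - of_nat (Suc k)" using Suc.prems by (simp add: of_nat_diff)
  ultimately have "harmonic (p - 1 - Suc k) = harmonic (p - 1 - k) - 1 / (P - of_nat (Suc k))" by simp
  also have "\<dots> \<simeq> (harmonic (p - 1) + harmonic k) - - (1 / of_nat (Suc k)) (p^1)"
    using Suc by (intro cong_diff reflect_inverse_cong unit_p_less) auto
  finally show ?case by (simp add: add_ac)
qed simp

lemma harmonic2_reflect_cong: "k < p \<Longrightarrow> harmonic2 (p - 1 - k) \<simeq> harmonic2 (p - 1) - harmonic2 k (p^1)"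
proof (induction k)
  case (Suc k)
  have "p - 1 - k = Suc (p - 1 - Suc k)" using Suc.prems by simp
  then have "harmonic2 (p - 1 - k) = harmonic2 (p - 1 - Suc k) + 1 / (of_nat (p - 1 - k))\<^sup>2" by simp
  moreover have "of_nat (p - 1 - k) = P - of_nat (Suc k)" using Suc.prems by (simp add: of_nat_diff)
  ultimately have "harmonic2 (p - 1 - Suc k) = harmonic2 (p - 1 - k) - (1 / (P - of_nat (Suc k)))\<^sup>2" 
    by (simp add: power_divide)
  also have "\<dots> \<simeq> (harmonic2 (p - 1) - harmonic2 k) - (- (1 / of_nat (Suc k)))\<^sup>2 (p^1)"
    using Suc by (intro cong_diff cong_power reflect_inverse_cong unit_p_less pint) auto
  finally show ?case by (simp add: power_divide algebra_simps)
qed simp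

text \<open>Wolstenholme's theorem: adding the terms of \<open>k\<close> and \<open>p - k\<close>
  pulls out a factor \<open>p\<close>, and what remains is \<open>- harmonic2 (p - 1)\<close> modulo
  \<open>p\<close>.\<close>

lemma harmonic_pred_cong_0: "harmonic (p - 1) \<simeq> 0 (p^2)"
proof -
  have "harmonic (p - 1) = (\<Sum>k=1..p-1. 1 / of_nat (p - k))"
    unfolding harmonic_def by (rule sum.reindex_bij_witness[of _ "\<lambda>k. p - k" "\<lambda>k. p - k"]) auto
  also have "\<dots> = (\<Sum>k=1..p-1. 1 / (P - of_nat k))"
    by (intro sum.cong refl) (auto simp: of_nat_diff)
  finally have "2 * harmonic (p - 1) = (\<Sum>k=1..p-1. 1 / of_nat k + 1 / (P - of_nat k))"
    by (simp add: sum.distrib harmonic_def)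
  also have "\<dots> = P * (\<Sum>k=1..p-1. 1 / of_nat k * (1 / (P - of_nat k)))"
    unfolding sum_distrib_left
  proof (intro sum.cong refl)
    fix k assume "k \<in> {1..p-1}"
    then have "unit_p (of_nat k)" by (rule unit_p_range)
    then show "1 / of_nat k + 1 / (P - of_nat k) = P * (1 / of_nat k * (1 / (P - of_nat k)))"
      using unit_p_P_minus[of "of_nat k"] by (simp add: unit_p_def field_simps)
  qed
  finally have 1: "2 * harmonic (p - 1) = P * (\<Sum>k=1..p-1. 1 / of_nat k * (1 / (P - of_nat k)))" .
  have "(\<Sum>k=1..p-1. 1 / of_nat k * (1 / (P - of_nat k))) \<simeq> (\<Sum>k=1..p-1. 1 / of_nat k * - (1 / of_nat k)) (p^1)"
    by (intro cong_sum cong_mult_left reflect_inverse_cong pint unit_p_range)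
  also have "\<dots> = - harmonic2 (p - 1)"
    by (simp add: harmonic2_def sum_negf power2_eq_square)
  also have "\<dots> \<simeq> - 0 (p^1)" by (intro cong_uminus harmonic2_pred_cong_0)
  finally have "P * (\<Sum>k=1..p-1. 1 / of_nat k * (1 / (P - of_nat k))) \<simeq> P * 0 (p^Suc 1)"
    unfolding cong_P_iff by simp
  then have "2 * harmonic (p - 1) \<simeq> 2 * 0 (p^2)" using 1 by (simp add: numeral_2_eq_2)
  then show ?thesis by (rule cong_cancel) (rule unit_p_numeral)
qed

lemma harmonic_reflect_cong': "k < p \<Longrightarrow> harmonic (p - 1 - k) \<simeq> harmonic k (p^1)"
  using cong_trans[OF harmonic_reflect_cong cong_add[OF cong_mono[OF harmonic_pred_cong_0, of 1] cong_refl]] by simp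

lemma harmonic2_reflect_cong': "k < p \<Longrightarrow> harmonic2 (p - 1 - k) \<simeq> - harmonic2 k (p^1)"
  using cong_trans[OF harmonic2_reflect_cong cong_diff[OF harmonic2_pred_cong_0 cong_refl]] by simp

lemma of_nat_p_minus: "k \<le> p \<Longrightarrow> of_nat (p - k) = P - of_nat k"
  by (simp add: of_nat_diff)

lemma two_mult_le_p: "i \<in> {1..h} \<Longrightarrow> 2 * i \<le> p"
  by (metis atLeastAtMost_iff le_add1 mult_le_mono2 order_trans p_eq)

lemma sum_p_halves: "(\<Sum>k=1..p-1. f k) = (\<Sum>k=1..h. f k + f (p - k))"
  using sum_even_interval_halves[of f h] p_eq p_minus_1 by simp

lemma sum_p_parity: "(\<Sum>k=1..p-1. f k) = (\<Sum>i=1..h. f (2 * i) + f (p - 2 * i))"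
  using sum_even_interval_parity[of f h] p_eq p_minus_1 by simp

lemma sum_p_centre: "(\<Sum>k=0..p-1. f k) = f h + (\<Sum>i=1..h. f (h + i) + f (h - i))"
  using sum_odd_interval_centre[of f h] p_minus_1 by simp

end

subsection \<open>Bernoulli numbers and sums of weight three\<close>

text \<open>Comparison of coefficients of \<open>t^(n+1)\<close> after multiplying
  \<open>t / (e^t - 1)\<close> by \<open>e^(kt) - 1\<close>, which is \<open>e^t - 1\<close> times
  the geometric sum of the \<open>e^(jt)\<close> with \<open>j < k\<close>.\<close>

lemma bernoulli_faulhaber:
  "(\<Sum>r\<le>n. of_nat (Suc n choose r) * bernoulli_num r * of_nat k ^ (Suc n - r))
    = of_nat (Suc n) * (\<Sum>j<k. of_nat j ^ n)"
proof -
  let ?B = "Abs_fps (\<lambda>n. bernoulli_num n / fact n)"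
  define S :: "rat fps" where "S = (\<Sum>j<k. fps_exp (of_nat j))"
  have "(fps_exp 1 - 1) * S = fps_exp (of_nat k) - 1"
    unfolding S_def by (induction k) (simp_all add: algebra_simps fps_exp_add_mult)
  then have "?B * (fps_exp (of_nat k) - 1) = fps_X * S"
    by (metis bernoulli_fps mult.assoc)
  then have "fps_nth (?B * (fps_exp (of_nat k) - 1)) (Suc n) = fps_nth (fps_X * S) (Suc n)" by simp
  also have "\<dots> = (\<Sum>j<k. of_nat j ^ n) / fact n"
    by (simp add: S_def fps_sum_nth sum_divide_distrib)
  finally have "(\<Sum>j<k. of_nat j ^ n) / fact n = fps_nth (?B * (fps_exp (of_nat k) - 1)) (Suc n)" by simp
  also have "\<dots> = (\<Sum>r=0..Suc n. bernoulli_num r / fact r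
      * (of_nat k ^ (Suc n - r) / fact (Suc n - r) - (if Suc n - r = 0 then 1 else 0)))"
    unfolding fps_mult_nth by (intro sum.cong refl) simp
  \<comment> \<open>The term \<open>r = Suc n\<close> drops out: its bracket is
    \<open>k^0 / 0! - 1 = 0\<close>.\<close>
  also have "\<dots> = (\<Sum>r=0..n. bernoulli_num r / fact r
      * (of_nat k ^ (Suc n - r) / fact (Suc n - r) - (if Suc n - r = 0 then 1 else 0)))"
    by (simp add: mult.commute del: fact_Suc)
  also have "\<dots> = (\<Sum>r\<le>n. bernoulli_num r / fact r * (of_nat k ^ (Suc n - r) / fact (Suc n - r)))"
    by (intro sum.cong) auto
  finally have "(\<Sum>j<k. of_nat j ^ n) / fact n
    = (\<Sum>r\<le>n. bernoulli_num r / fact r * (of_nat k ^ (Suc n - r) / fact (Suc n - r)))" .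
  then have "of_nat (Suc n) * (\<Sum>j<k. of_nat j ^ n)
    = fact (Suc n) * (\<Sum>r\<le>n. bernoulli_num r / fact r * (of_nat k ^ (Suc n - r) / fact (Suc n - r)))"
    by (simp add: field_simps)
  also have "\<dots> = (\<Sum>r\<le>n. fact (Suc n) * (bernoulli_num r / fact r * (of_nat k ^ (Suc n - r) / fact (Suc n - r))))"
    by (rule sum_distrib_left)
  also have "\<dots> = (\<Sum>r\<le>n. of_nat (Suc n choose r) * bernoulli_num r * of_nat k ^ (Suc n - r))"
    by (intro sum.cong refl) (simp add: binomial_fact del: fact_Suc binomial_Suc_Suc)
  finally show ?thesis by simp
qed

text \<open>In the induction step, with \<open>i + j = N\<close>, the partial fraction
  \<open>1 / (i j^2) = (1/i + 1/j) / N^2 + 1 / (N j^2)\<close> turns the increment of the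
  convolution into harmonic numbers.\<close>

lemma sum_harmonic2_convolution:
  "(\<Sum>i=1..M. harmonic2 (M - i) / of_nat i)
    = harmonic M * harmonic2 M + (\<Sum>k=1..M. harmonic k / (of_nat k)\<^sup>2) - 2 * (\<Sum>k=1..M. 1 / of_nat k ^ 3)"
proof (induction M)
  case (Suc M)
  let ?N = "of_nat (Suc M) :: rat"
  have "(\<Sum>i=1..Suc M. harmonic2 (Suc M - i) / of_nat i)
    = (\<Sum>i=1..M. harmonic2 (M - i) / of_nat i + (1 / ?N\<^sup>2 * (1 / of_nat i + 1 / of_nat (Suc M - i)) + 1 / ?N * (1 / (of_nat (Suc M - i))\<^sup>2)))"
  proof -
    have "(\<Sum>i=1..Suc M. harmonic2 (Suc M - i) / of_nat i) = (\<Sum>i=1..M. harmonic2 (Suc M - i) / of_nat i)"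
      by simp
    also have "\<dots> = (\<Sum>i=1..M. harmonic2 (M - i) / of_nat i + (1 / ?N\<^sup>2 * (1 / of_nat i + 1 / of_nat (Suc M - i)) + 1 / ?N * (1 / (of_nat (Suc M - i))\<^sup>2)))"
    proof (intro sum.cong refl)
      fix i assume i: "i \<in> {1..M}"
      define j where "j = M - i"
      have N: "?N = of_nat i + of_nat (Suc j)" using i by (simp add: j_def of_nat_diff)
      have "Suc M - i = Suc j" using i by (auto simp: j_def Suc_diff_le)
      moreover have "1 / (of_nat i * (of_nat (Suc j))\<^sup>2) = 1 / ?N\<^sup>2 * (1 / of_nat i + 1 / of_nat (Suc j)) + 1 / ?N * (1 / (of_nat (Suc j))\<^sup>2)"
      proof -
        have nz: "(of_nat i :: rat) \<noteq> 0" "(of_nat (Suc j) :: rat) \<noteq> 0" "of_nat i + of_nat (Suc j) \<noteq> (0 :: rat)"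
          using i by (simp_all del: of_nat_Suc flip: of_nat_add)
        define a b :: rat where "a = of_nat i" and "b = of_nat (Suc j)"
        have "a \<noteq> 0" "b \<noteq> 0" "a + b \<noteq> 0" using nz by (simp_all add: a_def b_def)
        then show ?thesis unfolding N a_def[symmetric] b_def[symmetric] power2_eq_square
          by (simp add: divide_simps) (simp add: algebra_simps)
      qed
      ultimately show "harmonic2 (Suc M - i) / of_nat i = harmonic2 (M - i) / of_nat i
          + (1 / ?N\<^sup>2 * (1 / of_nat i + 1 / of_nat (Suc M - i)) + 1 / ?N * (1 / (of_nat (Suc M - i))\<^sup>2))"
        by (simp add: j_def[symmetric] add_divide_distrib mult.commute del: of_nat_Suc)
    qed
    finally show ?thesis .
  qed
  also have "\<dots> = (\<Sum>i=1..M. harmonic2 (M - i) / of_nat i)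
     + (1 / ?N\<^sup>2 * (harmonic M + (\<Sum>i=1..M. 1 / of_nat (Suc M - i))) + 1 / ?N * (\<Sum>i=1..M. 1 / (of_nat (Suc M - i))\<^sup>2))"
    by (simp only: sum.distrib sum_distrib_left[symmetric] harmonic_def)
  also have "(\<Sum>i=1..M. 1 / of_nat (Suc M - i)) = harmonic M"
    unfolding harmonic_def by (rule sum.reindex_bij_witness[of _ "\<lambda>k. Suc M - k" "\<lambda>k. Suc M - k"]) auto
  also have "(\<Sum>i=1..M. 1 / (of_nat (Suc M - i))\<^sup>2) = harmonic2 M"
    unfolding harmonic2_def by (rule sum.reindex_bij_witness[of _ "\<lambda>k. Suc M - k" "\<lambda>k. Suc M - k"]) auto
  finally have E: "(\<Sum>i=1..Suc M. harmonic2 (Suc M - i) / of_nat i)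
    = harmonic M * harmonic2 M + (\<Sum>k=1..M. harmonic k / (of_nat k)\<^sup>2) - 2 * (\<Sum>k=1..M. 1 / of_nat k ^ 3)
      + (1 / ?N\<^sup>2 * (harmonic M + harmonic M) + 1 / ?N * harmonic2 M)"
    unfolding Suc .
  have alg: "H * H2 + V - 2 * T + (1 / N\<^sup>2 * (H + H) + 1 / N * H2)
    = (H + 1 / N) * (H2 + 1 / N\<^sup>2) + (V + (H + 1 / N) / N\<^sup>2) - 2 * (T + 1 / N ^ 3)"
    if "N \<noteq> 0" for H H2 V T N :: rat
    using that by (simp add: field_simps power2_eq_square power3_eq_cube)
  show ?case unfolding E using alg[of ?N] by (simp del: of_nat_Suc)
qed simp

context large_prime
begin

text \<open>At \<open>k = 1\<close> Faulhaber's formula is the usual recurrence, which divides only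
  by \<open>r + 1 < p\<close>.\<close>

lemma Zp_bernoulli: "r \<le> p - 2 \<Longrightarrow> Zp (bernoulli_num r)"
proof (induction r rule: less_induct)
  case (less r)
  have "of_nat (Suc r) * bernoulli_num r
    = of_nat (Suc r) * (\<Sum>j<1. of_nat j ^ r) - (\<Sum>s<r. of_nat (Suc r choose s) * bernoulli_num s)"
    using bernoulli_faulhaber[where n = r and k = 1]
    by (simp add: lessThan_Suc_atMost[symmetric] algebra_simps del: binomial_Suc_Suc)
  moreover have "Zp \<dots>" using less by (intro pint) auto
  moreover have "unit_p (of_nat (Suc r))" using less p_gt_3 by (intro unit_p_less) auto
  ultimately have "Zp (of_nat (Suc r) * bernoulli_num r / of_nat (Suc r))"
    by (metis Zp_divide)
  then show ?case by (simp del: of_nat_Suc)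
qed

definition harmonic_half2 :: rat where "harmonic_half2 = harmonic2 h"
definition harmonic_half3 :: rat where "harmonic_half3 = (\<Sum>k=1..h. 1 / of_nat k ^ 3)"
definition weight3_sum :: rat where "weight3_sum = (\<Sum>k=1..p-1. harmonic k / (of_nat k)\<^sup>2)"

lemma Zp_weight3 [pint]: "Zp harmonic_half2" "Zp harmonic_half3" "Zp weight3_sum"
proof -
  show "Zp harmonic_half2" unfolding harmonic_half2_def using h_less by (intro pint)
  show "Zp harmonic_half3" unfolding harmonic_half3_def by (intro pint unit_p_power unit_p_half_range)
  show "Zp weight3_sum" unfolding weight3_sum_def by (intro pint unit_p_power unit_p_range) auto
qed

text \<open>By Fermat, \<open>H_(k-1)\<close> is the sum of the \<open>j^(p-2)\<close> with
  \<open>j < k\<close>, hence by Faulhaber a polynomial in \<open>k\<close>. After division by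
  \<open>k^2\<close> and summation over \<open>k\<close>, only the constant term survives modulo
  \<open>p\<close>, the one with index \<open>r = p - 3\<close>.\<close>

lemma weight3_sum_cong_bernoulli: "weight3_sum \<simeq> bernoulli_num (p - 3) (p^1)"
proof -
  define n where "n = p - 2"
  have n: "Suc n = p - 1" "p - 3 < n" "n = Suc (p - 3)" "n \<ge> 1" using p_gt_3 by (auto simp: n_def)
  have H: "harmonic (k - 1) \<simeq> (\<Sum>j<k. of_nat j ^ n) (p^1)" if "k \<in> {1..p-1}" for k
  proof -
    have "harmonic (k - 1) = (\<Sum>j=1..k-1. 1 / of_nat j ^ 1)" by (simp add: harmonic_def)
    also have "\<dots> \<simeq> (\<Sum>j=1..k-1. of_nat j ^ (p - 1 - 1)) (p^1)"
      using that by (intro cong_sum inverse_power_cong) auto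
    also have "(\<Sum>j=1..k-1. of_nat j ^ (p - 1 - 1) :: rat) = (\<Sum>j<k. of_nat j ^ n)"
      using that n by (intro sum.mono_neutral_cong_left) (auto simp: n_def Suc_le_eq numeral_2_eq_2)
    finally show ?thesis .
  qed
  have "of_nat (Suc n) * (\<Sum>k=1..p-1. harmonic (k - 1) / (of_nat k)\<^sup>2)
     \<simeq> of_nat (Suc n) * (\<Sum>k=1..p-1. (\<Sum>j<k. of_nat j ^ n) / (of_nat k)\<^sup>2) (p^1)"
    by (intro cong_mult_left cong_sum cong_divide H pint unit_p_power unit_p_range)
  also have "of_nat (Suc n) * (\<Sum>k=1..p-1. (\<Sum>j<k. of_nat j ^ n) / (of_nat k)\<^sup>2)
     = (\<Sum>k=1..p-1. (\<Sum>r\<le>n. of_nat (Suc n choose r) * bernoulli_num r * of_nat k ^ (Suc n - r)) / (of_nat k)\<^sup>2)"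
    unfolding bernoulli_faulhaber by (simp add: sum_distrib_left del: of_nat_Suc)
  also have "\<dots> = (\<Sum>r\<le>n. of_nat (Suc n choose r) * bernoulli_num r * (\<Sum>k=1..p-1. of_nat k ^ (Suc n - r) / (of_nat k)\<^sup>2))"
    unfolding sum_distrib_left sum_divide_distrib by (subst sum.swap) (simp add: mult.assoc)
  also have "\<dots> \<simeq> (\<Sum>r\<le>n. if r = p - 3 then of_nat (Suc n) * bernoulli_num (p - 3) else 0) (p^1)"
  proof (intro cong_sum)
    fix r assume r: "r \<in> {..n}"
    have B: "Zp (of_nat (Suc n choose r) * bernoulli_num r)"
      using r by (intro pint Zp_bernoulli) (auto simp: n_def)
    let ?s = "\<Sum>k=1..p-1. of_nat k ^ (Suc n - r) / (of_nat k)\<^sup>2 :: rat"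
    \<comment> \<open>The exponent of \<open>k\<close> left after the division by \<open>k^2\<close>
      is \<open>p - 3 - r\<close>: it is -1, or 0, or between 1 and \<open>p - 3\<close>.\<close>
    consider "r = n" | "r = p - 3" | "r < p - 3" using r n by fastforce
    then show "of_nat (Suc n choose r) * bernoulli_num r * ?s
      \<simeq> (if r = p - 3 then of_nat (Suc n) * bernoulli_num (p - 3) else 0) (p^1)"
    proof cases
      case 1
      have "?s = (\<Sum>k=1..p-1. 1 / of_nat k ^ 1)"
        using 1 by (intro sum.cong) (auto simp: power2_eq_square)
      also have "\<dots> \<simeq> 0 (p^1)" using p_gt_3 by (intro inverse_power_sum_cong_0) auto
      finally have "of_nat (Suc n choose r) * bernoulli_num r * ?s
        \<simeq> of_nat (Suc n choose r) * bernoulli_num r * 0 (p^1)" using B by (rule cong_mult_left)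
      moreover have "r \<noteq> p - 3" using 1 n by simp
      ultimately show ?thesis by (simp only: if_False mult_zero_right)
    next
      case 2
      have "?s = (\<Sum>k=1..p-1. 1)"
        using 2 n by (intro sum.cong) (auto simp: power2_eq_square)
      also have "\<dots> = of_nat (Suc n)" using n by simp
      finally have s: "?s = of_nat (Suc n)" .
      have "even (p - 3)" using odd_p p_gt_3 by simp
      then have "of_nat (Suc n choose r) \<simeq> 1 (p^1)"
        using cong_choose_pred'[of "p - 3"] 2 n p_gt_3 by simp
      then have "bernoulli_num r * of_nat (Suc n) * of_nat (Suc n choose r) \<simeq> bernoulli_num r * of_nat (Suc n) * 1 (p^1)"
        using 2 by (intro cong_mult_left pint Zp_bernoulli) auto
      then show ?thesis using 2 unfolding s by (simp add: mult_ac del: of_nat_Suc binomial_Suc_Suc)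
    next
      case 3
      have "?s = (\<Sum>k=1..p-1. of_nat k ^ (Suc n - r - 2))"
        using 3 n by (intro sum.cong refl) (auto simp: power_diff power2_eq_square)
      also have "\<dots> = (\<Sum>k=0..p-1. of_nat k ^ (Suc n - r - 2))"
        using 3 n by (intro sum.mono_neutral_left) (auto simp: Suc_le_eq)
      also have "\<dots> \<simeq> 0 (p^1)" using 3 n by (intro power_sum_cong_0) auto
      finally have "of_nat (Suc n choose r) * bernoulli_num r * ?s
        \<simeq> of_nat (Suc n choose r) * bernoulli_num r * 0 (p^1)" using B by (rule cong_mult_left)
      then show ?thesis using 3 by simp
    qed
  qed
  also have "(\<Sum>r\<le>n. if r = p - 3 then of_nat (Suc n) * bernoulli_num (p - 3) else 0) = of_nat (Suc n) * bernoulli_num (p - 3)"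
    using n by (simp del: of_nat_Suc)
  finally have "(\<Sum>k=1..p-1. harmonic (k - 1) / (of_nat k)\<^sup>2) \<simeq> bernoulli_num (p - 3) (p^1)"
    by (rule cong_cancel) (use n p_gt_3 in \<open>intro unit_p_less; simp\<close>)
  moreover have "weight3_sum = (\<Sum>k=1..p-1. harmonic (k - 1) / (of_nat k)\<^sup>2) + (\<Sum>k=1..p-1. 1 / of_nat k ^ 3)"
    unfolding weight3_sum_def sum.distrib[symmetric]
  proof (intro sum.cong refl)
    fix k assume "k \<in> {1..p-1}"
    then obtain l where "k = Suc l" by (cases k) auto
    then show "harmonic k / (of_nat k)\<^sup>2 = harmonic (k - 1) / (of_nat k)\<^sup>2 + 1 / of_nat k ^ 3"
      by (simp add: add_divide_distrib power2_eq_square power3_eq_cube del: of_nat_Suc)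
  qed
  moreover have "(\<Sum>k=1..p-1. 1 / of_nat k ^ 3) \<simeq> 0 (p^1)"
    using p_gt_3 odd_p by (intro inverse_power_sum_cong_0) (auto simp: le_Suc_eq elim!: oddE)
  ultimately show ?thesis using cong_add[of 1 _ "bernoulli_num (p - 3)" _ 0] by simp
qed

lemma harmonic2_pred_cong_halves: "harmonic2 (p - 1) \<simeq> 2 * harmonic_half2 + 2 * P * harmonic_half3 (p^2)"
proof -
  have "harmonic2 (p - 1) = (\<Sum>k=1..h. 1 / (of_nat k)\<^sup>2 + 1 / (P - of_nat k)\<^sup>2)"
    unfolding harmonic2_def sum_p_halves using h_less
    by (intro sum.cong refl) (auto simp: of_nat_p_minus)
  also have "\<dots> \<simeq> (\<Sum>k=1..h. 1 / (of_nat k)\<^sup>2 + (1 / (of_nat k)\<^sup>2 + 2 * P / of_nat k ^ 3)) (p^2)"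
    by (intro cong_sum cong_add cong_refl reflect_inverse_square_cong unit_p_half_range)
  also have "\<dots> = 2 * harmonic_half2 + 2 * P * harmonic_half3"
    by (simp add: harmonic_half2_def harmonic2_def harmonic_half3_def sum.distrib sum_distrib_left)
  finally show ?thesis .
qed

text \<open>All indices here are \<open>2 i\<close> or \<open>p - 2 i\<close>, so pulling out the
  powers of 2 leads back to the half range, with other coefficients than in
  \<open>harmonic2_pred_cong_halves\<close>.\<close>

lemma harmonic2_pred_cong_parity: "harmonic2 (p - 1) \<simeq> harmonic_half2 / 2 + P * harmonic_half3 / 4 (p^2)"
proof -
  have "harmonic2 (p - 1) = (\<Sum>i=1..h. 1 / (2 * of_nat i)\<^sup>2 + 1 / (P - 2 * of_nat i)\<^sup>2)"
    unfolding harmonic2_def sum_p_parity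
  proof (intro sum.cong refl)
    fix i assume "i \<in> {1..h}"
    then have "of_nat (p - 2 * i) = P - of_nat (2 * i)"
      by (intro of_nat_p_minus two_mult_le_p)
    then have "of_nat (p - 2 * i) = P - 2 * of_nat i"
      by (simp only: of_nat_mult of_nat_numeral)
    then show "1 / (of_nat (2 * i))\<^sup>2 + 1 / (of_nat (p - 2 * i))\<^sup>2 = 1 / (2 * of_nat i)\<^sup>2 + 1 / (P - 2 * of_nat i)\<^sup>2"
      by (simp only: of_nat_mult of_nat_numeral)
  qed
  also have "\<dots> \<simeq> (\<Sum>i=1..h. 1 / (2 * of_nat i)\<^sup>2 + (1 / (2 * of_nat i)\<^sup>2 + 2 * P / (2 * of_nat i) ^ 3)) (p^2)"
    by (intro cong_sum cong_add cong_refl reflect_inverse_square_cong unit_p_mult unit_p_numeral unit_p_half_range)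
  also have "\<dots> = (\<Sum>i=1..h. 1 / 2 * (1 / (of_nat i)\<^sup>2) + P / 4 * (1 / of_nat i ^ 3))"
  proof (intro sum.cong refl)
    fix i
    have "1 / (2 * x)\<^sup>2 + (1 / (2 * x)\<^sup>2 + 2 * y / (2 * x) ^ 3) = 1 / 2 * (1 / x\<^sup>2) + y / 4 * (1 / x ^ 3)" for x y :: rat
    proof -
      have "(2 * x)\<^sup>2 = 4 * x\<^sup>2" "(2 * x) ^ 3 = 8 * x ^ 3" by (simp_all add: power_mult_distrib)
      then show ?thesis by (cases "x = 0") (simp_all add: field_simps)
    qed
    then show "1 / (2 * of_nat i)\<^sup>2 + (1 / (2 * of_nat i)\<^sup>2 + 2 * P / (2 * of_nat i) ^ 3)
      = 1 / 2 * (1 / (of_nat i)\<^sup>2) + P / 4 * (1 / of_nat i ^ 3)" .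
  qed
  also have "\<dots> = 1 / 2 * harmonic_half2 + P / 4 * harmonic_half3"
    by (simp only: harmonic_half2_def harmonic2_def harmonic_half3_def sum.distrib sum_distrib_left)
  also have "\<dots> = harmonic_half2 / 2 + P * harmonic_half3 / 4" by simp
  finally show ?thesis .
qed

text \<open>Write \<open>A\<close> and \<open>T\<close> for the half sums of weight two and three.
  The two evaluations of \<open>harmonic2 (p - 1)\<close> are \<open>2 A + 2 P T\<close> and
  \<open>A / 2 + P T / 4\<close>; equating them gives \<open>3/2 A = - 7/4 P T\<close>.\<close>

lemma harmonic_half2_cong: "harmonic_half2 \<simeq> - (7 / 6) * P * harmonic_half3 (p^2)"
proof -
  have "2 * harmonic_half2 + 2 * P * harmonic_half3 \<simeq> harmonic_half2 / 2 + P * harmonic_half3 / 4 (p^2)"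
    by (rule cong_trans[OF cong_sym[OF harmonic2_pred_cong_halves] harmonic2_pred_cong_parity])
  from cong_diff[OF this cong_refl[of _ "harmonic_half2 / 2 + 2 * P * harmonic_half3"]]
  have "3 / 2 * harmonic_half2 \<simeq> 3 / 2 * (- (7 / 6) * P * harmonic_half3) (p^2)"
    by (simp add: algebra_simps)
  then show ?thesis by (rule cong_cancel) (intro unit_p_divide unit_p_numeral)
qed

lemma harmonic2_pred_cong: "harmonic2 (p - 1) \<simeq> - (1 / 3) * P * harmonic_half3 (p^2)"
proof -
  have "harmonic2 (p - 1) \<simeq> 2 * harmonic_half2 + 2 * P * harmonic_half3 (p^2)"
    by (rule harmonic2_pred_cong_halves)
  also have "\<dots> \<simeq> 2 * (- (7 / 6) * P * harmonic_half3) + 2 * P * harmonic_half3 (p^2)"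
    by (intro cong_add cong_mult_left harmonic_half2_cong cong_refl pint)
  finally show ?thesis by (simp add: algebra_simps)
qed

text \<open>The alternating binomial sum of \<open>1 / k^2\<close> at \<open>n = p - 1\<close>, with
  \<open>C(p-1, k)\<close> expanded modulo \<open>p^2\<close>. The square of
  \<open>harmonic (p - 1)\<close> dies by Wolstenholme, and the two multiples of
  \<open>harmonic2 (p - 1)\<close> combine to \<open>3/2\<close>.\<close>

lemma weight3_sum_cong: "P * weight3_sum \<simeq> 3 / 2 * harmonic2 (p - 1) (p^2)"
proof -
  have "(\<Sum>k=1..p-1. (-1) ^ Suc k * of_nat ((p - 1) choose k) / (of_nat k)\<^sup>2)
    \<simeq> (\<Sum>k=1..p-1. (-1) ^ Suc k * ((-1) ^ k * (1 - P * harmonic k)) / (of_nat k)\<^sup>2) (p^2)"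
    by (intro cong_sum cong_divide cong_mult_left cong_choose_pred unit_p_power unit_p_range pint) auto
  also have "\<dots> = (\<Sum>k=1..p-1. P * (harmonic k / (of_nat k)\<^sup>2) - 1 / (of_nat k)\<^sup>2)"
    by (intro sum.cong refl) (simp add: diff_divide_distrib flip: power_add)
  also have "\<dots> = P * weight3_sum - harmonic2 (p - 1)"
    by (simp add: weight3_sum_def harmonic2_def sum_subtractf sum_distrib_left)
  finally have 1: "P * weight3_sum - harmonic2 (p - 1) \<simeq> ((harmonic (p - 1))\<^sup>2 + harmonic2 (p - 1)) / 2 (p^2)"
    unfolding alternating_choose_div_square_sum by (rule cong_sym)
  have "(harmonic (p - 1))\<^sup>2 \<simeq> 0 (p^2)"
    using cong_mono[OF cong_mult_0[OF harmonic_pred_cong_0 harmonic_pred_cong_0], of 2] by (simp add: power2_eq_square)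
  then have "((harmonic (p - 1))\<^sup>2 + harmonic2 (p - 1)) / 2 \<simeq> (0 + harmonic2 (p - 1)) / 2 (p^2)"
    by (intro cong_divide cong_add cong_refl unit_p_numeral)
  from cong_add[OF cong_trans[OF 1 this] cong_refl[of _ "harmonic2 (p - 1)"]]
  show ?thesis by (simp add: algebra_simps)
qed

lemma harmonic_half3_cong: "harmonic_half3 \<simeq> - 2 * weight3_sum (p^1)"
proof -
  have "3 / 2 * harmonic2 (p - 1) \<simeq> 3 / 2 * (- (1 / 3) * P * harmonic_half3) (p^2)"
    by (intro cong_mult_left harmonic2_pred_cong pint unit_p_numeral)
  then have "P * weight3_sum \<simeq> P * (- (1 / 2) * harmonic_half3) (p^Suc 1)"
    using cong_trans[OF weight3_sum_cong] by (simp add: mult_ac numeral_2_eq_2)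
  then have "weight3_sum \<simeq> - (1 / 2) * harmonic_half3 (p^1)" by (simp only: cong_P_iff)
  then have "- 2 * weight3_sum \<simeq> - 2 * (- (1 / 2) * harmonic_half3) (p^1)"
    by (rule cong_mult_left) (intro pint)
  then show ?thesis by (simp add: cong_sym)
qed

lemma harmonic_half2_cong_0: "harmonic_half2 \<simeq> 0 (p^1)"
proof -
  have "harmonic_half2 \<simeq> - (7 / 6) * P * harmonic_half3 (p^1)"
    by (rule cong_mono[OF harmonic_half2_cong]) simp
  also have "\<dots> \<simeq> 0 (p^1)"
    by (rule cong_0_divide_I[of "- (7 / 6) * harmonic_half3"]) (auto intro!: pint unit_p_numeral)
  finally show ?thesis .
qed


text \<open>Folding \<open>weight3_sum\<close>, written \<open>W\<close>, by \<open>k\<close> to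
  \<open>p - k\<close> gives \<open>W = 2 V - T\<close> with \<open>T\<close> for
  \<open>harmonic_half3\<close>. In the exact formula for the convolution the product term dies and
  \<open>V - 2 T = W/2 - 3/2 T\<close> remains; \<open>T = - 2 W\<close> then gives
  \<open>7/2 W\<close>.\<close>

lemma convolution_cong: "(\<Sum>i=1..h. harmonic2 (h - i) / of_nat i) \<simeq> 7 / 2 * weight3_sum (p^1)"
proof -
  define V where "V = (\<Sum>k=1..h. harmonic k / (of_nat k)\<^sup>2)"
  have "weight3_sum = (\<Sum>k=1..h. harmonic k / (of_nat k)\<^sup>2 + harmonic (p - k) * (1 / (P - of_nat k))\<^sup>2)"
    unfolding weight3_sum_def sum_p_halves using h_less
    by (intro sum.cong refl) (auto simp: of_nat_p_minus power_divide)
  also have "\<dots> \<simeq> (\<Sum>k=1..h. harmonic k / (of_nat k)\<^sup>2 + harmonic (k - 1) * (- (1 / of_nat k))\<^sup>2) (p^1)"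
  proof (intro cong_sum cong_add cong_refl cong_mult cong_power reflect_inverse_cong unit_p_half_range pint)
    fix k assume k: "k \<in> {1..h}"
    then have e: "p - 1 - (k - 1) = p - k" by auto
    have "k - 1 < p" using k h_less by auto
    from harmonic_reflect_cong'[OF this] show "harmonic (p - k) \<simeq> harmonic (k - 1) (p^1)"
      unfolding e .
    show "k - 1 < p" using k h_less by auto
    show "unit_p (P - of_nat k)" using k by (intro unit_p_P_minus unit_p_half_range)
  qed
  also have "\<dots> = (\<Sum>k=1..h. 2 * (harmonic k / (of_nat k)\<^sup>2) - 1 / of_nat k ^ 3)"
  proof (intro sum.cong refl)
    fix k assume "k \<in> {1..h}"
    then obtain l where "k = Suc l" by (cases k) auto
    then show "harmonic k / (of_nat k)\<^sup>2 + harmonic (k - 1) * (- (1 / of_nat k))\<^sup>2 = 2 * (harmonic k / (of_nat k)\<^sup>2) - 1 / of_nat k ^ 3"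
      by (simp add: field_simps power2_eq_square power3_eq_cube del: of_nat_Suc)
  qed
  also have "\<dots> = 2 * V - harmonic_half3"
    by (simp add: V_def harmonic_half3_def sum_subtractf sum_distrib_left)
  finally have "weight3_sum \<simeq> 2 * V - harmonic_half3 (p^1)" .
  from cong_divide[OF cong_add[OF this cong_refl[of _ harmonic_half3]] unit_p_numeral(1)]
  have V: "V \<simeq> (weight3_sum + harmonic_half3) / 2 (p^1)" by (simp add: cong_sym)
  have "harmonic h * harmonic_half2 \<simeq> harmonic h * 0 (p^1)"
    using h_less by (intro cong_mult_left harmonic_half2_cong_0 pint)
  then have "harmonic h * harmonic_half2 + V - 2 * harmonic_half3
     \<simeq> harmonic h * 0 + (weight3_sum + harmonic_half3) / 2 - 2 * harmonic_half3 (p^1)"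
    by (intro cong_diff cong_add V cong_refl)
  also have "harmonic h * 0 + (weight3_sum + harmonic_half3) / 2 - 2 * harmonic_half3
     = weight3_sum / 2 - 3 / 2 * harmonic_half3" by (simp add: field_simps)
  also have "\<dots> \<simeq> weight3_sum / 2 - 3 / 2 * (- 2 * weight3_sum) (p^1)"
    by (intro cong_diff cong_refl cong_mult_left harmonic_half3_cong pint unit_p_numeral)
  finally show ?thesis
    unfolding sum_harmonic2_convolution V_def harmonic_half2_def harmonic_half3_def by simp
qed

section \<open>Weighted sums of \<open>g_k\<close> modulo \<open>p^4\<close>\<close>

lemma cong_scale: "a \<simeq> b (p^m) \<Longrightarrow> n = k + m \<Longrightarrow> P ^ k * a \<simeq> P ^ k * b (p^n)"
  by (simp only: cong_scale_iff)

lemma unit_p_P_plus: "unit_p a \<Longrightarrow> unit_p (P + a)"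
  using unit_p_uminus[OF unit_p_P_minus[OF unit_p_uminus]] unit_p_P_minus[OF unit_p_uminus, of a] by simp

lemma unit_p_odd:
  assumes i: "i < p" "i \<noteq> h" shows "unit_p (of_nat (2 * i + 1))"
proof (rule unit_p_of_nat)
  show "\<not> p dvd 2 * i + 1"
  proof
    assume "p dvd 2 * i + 1"
    then obtain l where l: "2 * i + 1 = p * l" by blast
    moreover have "2 * i + 1 < p * 2" using i by simp
    ultimately have "l < 2" "l \<noteq> 0" by (auto intro: ccontr)
    then have "l = 1" by simp
    then show False using l i p_eq by simp
  qed
qed

lemma Zp_P_div_odd [pint]:
  assumes "i < p" shows "Zp (P / of_nat (2 * i + 1))"
proof (cases "i = h")
  case True
  then have "of_nat (2 * i + 1) = P" using p_eq by metis
  then show ?thesis by simp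
next
  case False
  then show ?thesis by (intro Zp_divide unit_p_odd assms pint)
qed

lemma Zp_g_coeff [pint]: "Zp (g_coeff n i)" and Zp_f_coeff [pint]: "Zp (f_coeff n i)"
  unfolding g_coeff_def f_coeff_def by (intro pint)+

text \<open>The sign in \<open>trunc_sinc_sum\<close> is 1 because \<open>p - 1\<close> is even. The
  closed form contains the weight squared, and squaring is the origin of the factor 2 in front of
  \<open>P^2\<close>.\<close>

lemma weighted_g_coeff_sum_cong:
  assumes "i < p"
  shows "(\<Sum>k=0..p-1. (1 - P\<^sup>2 * harmonic2 k) * g_coeff k i)
    \<simeq> P / of_nat (2 * i + 1) * (1 - 2 * P\<^sup>2 * harmonic2 i) (p^4)"
proof -
  have "(\<Sum>k=0..p-1. (1 - P\<^sup>2 * harmonic2 k) * g_coeff k i) \<simeq> (\<Sum>k=0..p-1. trunc_sinc p k * g_coeff k i) (p^4)"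
    using p_gt_3 by (intro cong_sum cong_mult cong_sym[OF cong_trunc_sinc] cong_refl pint) auto
  also have "(\<Sum>k=0..p-1. trunc_sinc p k * g_coeff k i) = P / of_nat (2 * i + 1) * (trunc_sinc p i)\<^sup>2"
    using trunc_sinc_sum[OF assms] p_minus_1 unfolding g_coeff_def by simp
  also have "\<dots> \<simeq> P / of_nat (2 * i + 1) * (1 - P\<^sup>2 * harmonic2 i)\<^sup>2 (p^4)"
    using assms by (intro cong_mult_left cong_power cong_trunc_sinc pint) auto
  also have "\<dots> \<simeq> P / of_nat (2 * i + 1) * (1 - 2 * P\<^sup>2 * harmonic2 i) (p^4)"
  proof (rule cong_mult_left[OF _ Zp_P_div_odd[OF assms]])
    have "(1 - P\<^sup>2 * harmonic2 i)\<^sup>2 - (1 - 2 * P\<^sup>2 * harmonic2 i) = P ^ 4 * (harmonic2 i)\<^sup>2"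
      by (simp add: power2_eq_square power4_eq_xxxx algebra_simps)
    then show "(1 - P\<^sup>2 * harmonic2 i)\<^sup>2 \<simeq> 1 - 2 * P\<^sup>2 * harmonic2 i (p^4)"
      using assms by (intro cong_0_divide_I[of "(harmonic2 i)\<^sup>2"] pint)
  qed
  finally show ?thesis .
qed

lemma poly_g_poly_less_p: "k < p \<Longrightarrow> poly (g_poly k) x = (\<Sum>i=0..p-1. g_coeff k i * x ^ i)"
  unfolding poly_g_poly by (rule sum.mono_neutral_left) (auto simp: g_coeff_eq_0)

lemma Zp_poly_g_poly [pint]: "Zp x \<Longrightarrow> Zp (poly (g_poly k) x)"
  unfolding poly_g_poly by (intro pint)

lemma Zp_g_num [pint]: "Zp (g_num k)"
  unfolding g_num_def by (intro pint)

lemma weighted_g_poly_sum_cong: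
  assumes "Zp x"
  shows "(\<Sum>k=0..p-1. (1 - P\<^sup>2 * harmonic2 k) * poly (g_poly k) x)
    \<simeq> (\<Sum>k=0..p-1. P / of_nat (2 * k + 1) * (1 - 2 * P\<^sup>2 * harmonic2 k) * x ^ k) (p^4)"
proof -
  have "(\<Sum>k=0..p-1. (1 - P\<^sup>2 * harmonic2 k) * poly (g_poly k) x)
    = (\<Sum>k=0..p-1. \<Sum>i=0..p-1. (1 - P\<^sup>2 * harmonic2 k) * g_coeff k i * x ^ i)"
    using p_gt_3 by (intro sum.cong refl) (simp add: poly_g_poly_less_p sum_distrib_left mult.assoc)
  also have "\<dots> = (\<Sum>i=0..p-1. (\<Sum>k=0..p-1. (1 - P\<^sup>2 * harmonic2 k) * g_coeff k i) * x ^ i)"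
    unfolding sum_distrib_right by (rule sum.swap)
  also have "\<dots> \<simeq> (\<Sum>k=0..p-1. P / of_nat (2 * k + 1) * (1 - 2 * P\<^sup>2 * harmonic2 k) * x ^ k) (p^4)"
    using assms p_gt_3 by (intro cong_sum cong_mult weighted_g_coeff_sum_cong cong_refl pint) auto
  finally show ?thesis .
qed

text \<open>The two summands symmetric to the middle one, whose denominators are \<open>p \<plusminus> 2 i\<close>.\<close>

definition centre_pair :: "nat \<Rightarrow> rat" where
  "centre_pair i = P / (P + 2 * of_nat i) * (1 - 2 * P\<^sup>2 * harmonic2 (h + i))
    + P / (P - 2 * of_nat i) * (1 - 2 * P\<^sup>2 * harmonic2 (h - i))"

text \<open>The assumption makes \<open>x^(h-i)\<close> and \<open>x^(h+i)\<close> equal, so the two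
  terms of a symmetric pair share their power of \<open>x\<close>. The middle denominator is exactly
  \<open>P\<close>.\<close>

lemma sum_p_odd_denominators:
  assumes "x\<^sup>2 = 1"
  shows "(\<Sum>k=0..p-1. P / of_nat (2 * k + 1) * (1 - 2 * P\<^sup>2 * harmonic2 k) * x ^ k)
    = (1 - 2 * P\<^sup>2 * harmonic_half2) * x ^ h + x ^ h * (\<Sum>i=1..h. x ^ i * centre_pair i)"
proof -
  have h: "of_nat (2 * h + 1) = P" using p_eq by metis
  have "P / of_nat (2 * (h + i) + 1) * (1 - 2 * P\<^sup>2 * harmonic2 (h + i)) * x ^ (h + i)
      + P / of_nat (2 * (h - i) + 1) * (1 - 2 * P\<^sup>2 * harmonic2 (h - i)) * x ^ (h - i)
      = x ^ h * (x ^ i * centre_pair i)" if "i \<in> {1..h}" for i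
  proof -
    have "of_nat (2 * (h + i) + 1) = P + 2 * of_nat i" unfolding h[symmetric] by simp
    moreover have "of_nat (2 * (h - i) + 1) = P - 2 * of_nat i" unfolding h[symmetric] using that by (simp add: of_nat_diff)
    moreover have "x ^ (h - i) = x ^ h * x ^ i"
    proof -
      have "x ^ (h - i) = x ^ (h - i) * (x\<^sup>2) ^ i" using assms by simp
      also have "\<dots> = x ^ (h - i + 2 * i)" by (simp only: power_add power_mult)
      also have "h - i + 2 * i = h + i" using that by simp
      finally show ?thesis by (simp add: power_add)
    qed
    ultimately show ?thesis by (simp only: centre_pair_def power_add) (simp add: algebra_simps)
  qed
  then show ?thesis
    unfolding sum_p_centre sum_distrib_left h harmonic_half2_def by simp
qed

text \<open>The parts of order \<open>p\<close> cancel, since the two fractions add up to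
  \<open>2 P^2 / (P^2 - 4 i^2)\<close>. In the harmonic parts both the values of
  \<open>harmonic2\<close> and the denominators are opposite modulo \<open>p\<close>, so these
  contributions reinforce each other.\<close>

lemma centre_pair_cong:
  assumes i: "i \<in> {1..h}"
  shows "centre_pair i \<simeq> - (1 / 2 * P ^ 2) * (1 / (of_nat i)\<^sup>2) + 2 * P ^ 3 * (harmonic2 (h - i) / of_nat i) (p^4)"
proof -
  define d a b :: rat where "d = of_nat i" and "a = harmonic2 (h + i)" and "b = harmonic2 (h - i)"
  have d: "unit_p d" unfolding d_def using i by (rule unit_p_half_range)
  have d2: "unit_p (2 * d)" using d by (intro unit_p_mult unit_p_numeral)
  have u: "unit_p (P + 2 * d)" "unit_p (P - 2 * d)" using d2 unit_p_P_plus unit_p_P_minus by auto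
  have nz: "P + 2 * d \<noteq> 0" "P - 2 * d \<noteq> 0" "d \<noteq> 0" using unit_pD(2)[OF u(1)] unit_pD(2)[OF u(2)] unit_pD(2)[OF d] by auto
  have Z: "Zp a" "Zp b" unfolding a_def b_def using i p_eq by (auto intro: pint)
  have ab: "a \<simeq> - b (p^1)"
  proof -
    have e: "p - 1 - (h - i) = h + i" using i p_eq by auto
    have "h - i < p" using h_less by simp
    from harmonic2_reflect_cong'[OF this] show ?thesis unfolding e a_def b_def .
  qed
  have "centre_pair i = P ^ 2 * (2 / ((P + 2 * d) * (P - 2 * d))) - P ^ 3 * (2 * (a * (1 / (P + 2 * d)) + b * (1 / (P - 2 * d))))"
  proof -
    have "P / (P + 2 * d) + P / (P - 2 * d) = P ^ 2 * (2 / ((P + 2 * d) * (P - 2 * d)))"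
      using nz by (simp add: field_simps power2_eq_square)
    then show ?thesis unfolding centre_pair_def a_def[symmetric] b_def[symmetric] d_def[symmetric]
      by (simp add: algebra_simps power2_eq_square power3_eq_cube)
  qed
  also have "\<dots> \<simeq> P ^ 2 * (- (1 / 2) * (1 / d\<^sup>2)) - P ^ 3 * (2 * (- b * (1 / (2 * d)) + b * - (1 / (2 * d)))) (p^4)"
  proof (intro cong_diff)
    show "P ^ 2 * (2 / ((P + 2 * d) * (P - 2 * d))) \<simeq> P ^ 2 * (- (1 / 2) * (1 / d\<^sup>2)) (p^4)"
    proof (rule cong_scale)
      have "2 / ((P + 2 * d) * (P - 2 * d)) - (- (1 / 2) * (1 / d\<^sup>2)) = P ^ 2 * (1 / (2 * d\<^sup>2 * ((P + 2 * d) * (P - 2 * d))))"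
      proof -
        define w where "w = (P + 2 * d) * (P - 2 * d)"
        have "w \<noteq> 0" unfolding w_def mult_eq_0_iff using nz by blast
        moreover have "P ^ 2 = w + 4 * d\<^sup>2" by (simp add: w_def algebra_simps power2_eq_square)
        ultimately show ?thesis unfolding w_def[symmetric] using nz by (simp add: field_simps power2_eq_square)
      qed
      then show "2 / ((P + 2 * d) * (P - 2 * d)) \<simeq> - (1 / 2) * (1 / d\<^sup>2) (p^2)"
        using u d by (intro cong_0_divide_I[of "1 / (2 * d\<^sup>2 * ((P + 2 * d) * (P - 2 * d)))"] pint unit_p_mult unit_p_power unit_p_numeral)
    qed simp
    have "1 / (P - - (2 * d)) \<simeq> - (1 / - (2 * d)) (p^1)" by (rule reflect_inverse_cong[OF unit_p_uminus[OF d2]])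
    then have "1 / (P + 2 * d) \<simeq> 1 / (2 * d) (p^1)" by simp
    then show "P ^ 3 * (2 * (a * (1 / (P + 2 * d)) + b * (1 / (P - 2 * d))))
        \<simeq> P ^ 3 * (2 * (- b * (1 / (2 * d)) + b * - (1 / (2 * d)))) (p^4)"
      using Z u by (intro cong_scale[where m = 1] cong_mult_left cong_add cong_mult[OF ab] reflect_inverse_cong d2 pint) auto
  qed
  also have "\<dots> = - (1 / 2 * P ^ 2) * (1 / d\<^sup>2) + 2 * P ^ 3 * (b / d)"
    using nz by (simp add: field_simps)
  finally show ?thesis unfolding d_def b_def .
qed

end

subsection \<open>Euler numbers and the two halves of a binomial expansion\<close>

lemma euler_fps:
  "Abs_fps (\<lambda>n. euler_num n / fact n) * (fps_exp 1 + fps_exp (-1)) = 2"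
proof -
  let ?d = "fps_exp 1 + fps_exp (-1) :: rat fps"
  have "fps_nth ?d 0 \<noteq> 0" by simp
  then have "?d dvd 2" by (simp only: unit_imp_dvd fps_is_unit_iff not_False_eq_True)
  then have "2 / ?d * ?d = 2" by (rule dvd_div_mult_self)
  moreover have "Abs_fps (\<lambda>n. euler_num n / fact n) = 2 / ?d"
    by (rule fps_ext) (simp only: fps_nth_Abs_fps euler_num_def nonzero_mult_div_cancel_left[OF fact_nonzero])
  ultimately show ?thesis by simp
qed

lemma fps_mult_egf_nth:
  "fact r * fps_nth (Abs_fps (\<lambda>n. e n / fact n) * Abs_fps (\<lambda>n. b n / fact n)) r
    = (\<Sum>j\<le>r. of_nat (r choose j) * e j * b (r - j) :: rat)"
proof -
  have "fact r * fps_nth (Abs_fps (\<lambda>n. e n / fact n) * Abs_fps (\<lambda>n. b n / fact n)) r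
    = (\<Sum>j\<le>r. fact r * (e j / fact j * (b (r - j) / fact (r - j))))"
    by (simp add: fps_mult_nth atLeast0AtMost sum_distrib_left)
  also have "\<dots> = (\<Sum>j\<le>r. of_nat (r choose j) * e j * b (r - j))"
    by (intro sum.cong refl) (simp add: binomial_fact)
  finally show ?thesis .
qed

lemma euler_num_recurrence:
  "(\<Sum>j\<le>r. of_nat (r choose j) * euler_num j * (1 + (-1) ^ (r - j))) = (if r = 0 then 2 else 0)"
proof -
  have "fps_exp 1 + fps_exp (-1) = Abs_fps (\<lambda>n. (1 + (-1) ^ n) / fact n :: rat)"
    by (rule fps_ext) (simp add: add_divide_distrib)
  then have "(\<Sum>j\<le>r. of_nat (r choose j) * euler_num j * (1 + (-1) ^ (r - j))) = fact r * fps_nth (2 :: rat fps) r"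
    using fps_mult_egf_nth[of r euler_num "\<lambda>n. 1 + (-1) ^ n"] euler_fps by simp
  also have "\<dots> = (if r = 0 then 2 else 0)" by (simp add: fps_numeral_nth)
  finally show ?thesis .
qed

text \<open>The alternating sum of the odd exponentials telescopes against
  \<open>e^t + e^(-t)\<close> to \<open>1 - (-1)^n e^(2nt)\<close>, and odd \<open>n\<close> makes
  the sign positive. Multiplying by the Euler generating function and comparing coefficients gives
  the formula.\<close>

lemma alternating_odd_power_sum:
  assumes "odd n"
  shows "2 * (\<Sum>k<n. (-1) ^ k * of_nat (2 * k + 1) ^ r)
    = euler_num r + (\<Sum>j\<le>r. of_nat (r choose j) * euler_num j * of_nat (2 * n) ^ (r - j))"
proof -
  let ?E = "Abs_fps (\<lambda>n. euler_num n / fact n)" and ?d = "fps_exp 1 + fps_exp (-1) :: rat fps"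
  define S :: "nat \<Rightarrow> rat fps" where "S n = (\<Sum>k<n. fps_const ((-1) ^ k) * fps_exp (of_nat (2 * k + 1)))" for n
  have "S n * ?d = 1 - fps_const ((-1) ^ n) * fps_exp (of_nat (2 * n))" for n
  proof (induction n)
    case (Suc n)
    have "fps_exp (of_nat (2 * n + 1)) * ?d = fps_exp (of_nat (2 * Suc n)) + fps_exp (of_nat (2 * n))"
    proof -
      have "fps_exp (of_nat (2 * n + 1)) * fps_exp 1 = fps_exp (of_nat (2 * Suc n) :: rat)"
        "fps_exp (of_nat (2 * n + 1)) * fps_exp (-1) = fps_exp (of_nat (2 * n) :: rat)"
        by (simp_all flip: fps_exp_add_mult)
      then show ?thesis by (simp only: distrib_left)
    qed
    moreover have "S (Suc n) = S n + fps_const ((-1) ^ n) * fps_exp (of_nat (2 * n + 1))"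
      by (simp add: S_def)
    ultimately have "S (Suc n) * ?d = 1 - fps_const ((-1) ^ n) * fps_exp (of_nat (2 * n))
        + fps_const ((-1) ^ n) * (fps_exp (of_nat (2 * Suc n)) + fps_exp (of_nat (2 * n)))"
      by (simp only: distrib_right Suc mult.assoc)
    also have "\<dots> = 1 - (- fps_const ((-1) ^ n)) * fps_exp (of_nat (2 * Suc n))"
      by (simp add: distrib_left del: fps_const_neg)
    also have "- fps_const ((-1) ^ n) = fps_const ((-1) ^ Suc n :: rat)" by simp
    finally show ?case .
  qed (simp add: S_def)
  then have "?E * (1 + fps_exp (of_nat (2 * n))) = ?E * (S n * ?d)"
    using assms by (simp flip: fps_const_neg)
  also have "\<dots> = (?E * ?d) * S n" by (simp only: mult_ac)
  also have "\<dots> = 2 * S n" unfolding euler_fps ..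
  finally have "fact r * fps_nth (2 * S n) r = fact r * fps_nth (?E + ?E * Abs_fps (\<lambda>m. of_nat (2 * n) ^ m / fact m)) r"
    by (simp add: distrib_left fps_exp_def)
  then have "fact r * fps_nth (2 * S n) r = euler_num r + (\<Sum>j\<le>r. of_nat (r choose j) * euler_num j * of_nat (2 * n) ^ (r - j))"
    using fps_mult_egf_nth[of r euler_num "\<lambda>m. of_nat (2 * n) ^ m"] by (simp add: distrib_left)
  moreover have "fact r * fps_nth (2 * S n) r = 2 * (\<Sum>k<n. (-1) ^ k * of_nat (2 * k + 1) ^ r)"
  proof -
    have "fps_nth (2 * S n) r = 2 * fps_nth (S n) r" by (metis fps_mult_left_const_nth numeral_fps_const)
    moreover have "fact r * fps_nth (S n) r = (\<Sum>k<n. (-1) ^ k * of_nat (2 * k + 1) ^ r)"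
      unfolding S_def fps_sum_nth sum_distrib_left by (intro sum.cong refl) simp
    ultimately show ?thesis by simp
  qed
  ultimately show ?thesis by simp
qed

text \<open>Writing \<open>(1 + x)\<^sup>n = even_part (x\<^sup>2) n + x odd_part (x\<^sup>2) n\<close> avoids adjoining \<open>\<surd>-3\<close>.\<close>

definition odd_part :: "rat \<Rightarrow> nat \<Rightarrow> rat" where
  "odd_part w n = (\<Sum>k\<le>n. of_nat (n choose (2 * k + 1)) * w ^ k)"

definition even_part :: "rat \<Rightarrow> nat \<Rightarrow> rat" where
  "even_part w n = (\<Sum>k\<le>n. of_nat (n choose (2 * k)) * w ^ k)"

lemma odd_part_Suc: "odd_part w (Suc n) = odd_part w n + even_part w n"
proof -
  have "odd_part w (Suc n) = (\<Sum>k\<le>n. of_nat (Suc n choose (2 * k + 1)) * w ^ k)"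
    unfolding odd_part_def by (simp add: binomial_eq_0 del: binomial_Suc_Suc)
  also have "\<dots> = (\<Sum>k\<le>n. of_nat (n choose (2 * k + 1)) * w ^ k + of_nat (n choose (2 * k)) * w ^ k)"
    by (intro sum.cong refl) (simp add: algebra_simps)
  finally show ?thesis by (simp only: odd_part_def even_part_def sum.distrib)
qed

lemma even_part_Suc: "even_part w (Suc n) = even_part w n + w * odd_part w n"
proof -
  have "even_part w (Suc n) = 1 + (\<Sum>k\<le>n. of_nat (Suc n choose (2 * Suc k)) * w ^ Suc k)"
    unfolding even_part_def by (subst sum.atMost_Suc_shift) simp
  also have "(\<Sum>k\<le>n. of_nat (Suc n choose (2 * Suc k)) * w ^ Suc k)
    = (\<Sum>k\<le>n. of_nat (n choose (2 * Suc k)) * w ^ Suc k + w * (of_nat (n choose (2 * k + 1)) * w ^ k))"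
    by (intro sum.cong refl) (simp add: algebra_simps)
  also have "1 + \<dots> = (1 + (\<Sum>k\<le>n. of_nat (n choose (2 * Suc k)) * w ^ Suc k)) + w * odd_part w n"
    by (simp only: sum.distrib odd_part_def sum_distrib_left add.assoc)
  also have "1 + (\<Sum>k\<le>n. of_nat (n choose (2 * Suc k)) * w ^ Suc k) = (\<Sum>k\<le>Suc n. of_nat (n choose (2 * k)) * w ^ k)"
    by (subst sum.atMost_Suc_shift) simp
  also have "\<dots> = even_part w n"
    unfolding even_part_def by (simp add: binomial_eq_0)
  finally show ?thesis .
qed

lemma even_odd_part_1: "odd_part 1 (Suc n) = 2 ^ n \<and> even_part 1 (Suc n) = 2 ^ n"
proof (induction n)
  case 0
  then show ?case by (simp add: odd_part_def even_part_def)
next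
  case (Suc n)
  then show ?case by (simp add: odd_part_Suc[of _ "Suc n"] even_part_Suc[of _ "Suc n"])
qed

text \<open>This is \<open>(1 + sqrt(-3))^6 = 64\<close>, carried out by six steps of the
  recurrences for the parts.\<close>

lemma even_odd_part_minus_3:
  "odd_part (-3) (n + 6) = 64 * odd_part (-3) n \<and> even_part (-3) (n + 6) = 64 * even_part (-3) n"
  by (simp add: odd_part_Suc even_part_Suc eval_nat_numeral)

text \<open>The sign in the second pair comes from
  \<open>(1 + sqrt(-3))^5 = 16 (1 - sqrt(-3))\<close>. Only exponents prime to 6 matter, since the
  exponent will be \<open>p\<close>.\<close>

lemma even_odd_part_minus_3_mod_6:
  "odd_part (-3) (6 * q + 1) = 2 ^ (6 * q)" "even_part (-3) (6 * q + 1) = 2 ^ (6 * q)"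
  "odd_part (-3) (6 * q + 5) = - (2 ^ (6 * q + 4))" "even_part (-3) (6 * q + 5) = 2 ^ (6 * q + 4)"
proof -
  have 0: "odd_part (-3) 0 = 0" "even_part (-3) 0 = 1" by (simp_all add: odd_part_def even_part_def)
  have "odd_part (-3) (6 * q) = 0 \<and> even_part (-3) (6 * q) = 2 ^ (6 * q)"
  proof (induction q)
    case (Suc q)
    then show ?case using even_odd_part_minus_3[of "6 * q"] by (simp add: add.commute power_add)
  qed (simp add: 0)
  then show "odd_part (-3) (6 * q + 1) = 2 ^ (6 * q)" "even_part (-3) (6 * q + 1) = 2 ^ (6 * q)"
    "odd_part (-3) (6 * q + 5) = - (2 ^ (6 * q + 4))" "even_part (-3) (6 * q + 5) = 2 ^ (6 * q + 4)"
    by (simp_all add: odd_part_Suc even_part_Suc eval_nat_numeral)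
qed

lemma Legendre_3: "Legendre a 3 = (if a mod 3 = 0 then 0 else if a mod 3 = 1 then 1 else -1)"
proof -
  have sq: "y\<^sup>2 mod 3 = 0 \<or> y\<^sup>2 mod 3 = 1" for y :: int
  proof -
    have "y mod 3 = 0 \<or> y mod 3 = 1 \<or> y mod 3 = 2" by presburger
    moreover have "y\<^sup>2 mod 3 = (y mod 3)\<^sup>2 mod 3" by (simp add: power_mod)
    ultimately show ?thesis by auto
  qed
  have "QuadRes 3 a" if "a mod 3 = 1"
    unfolding QuadRes_def using that by (intro exI[of _ 1]) (simp add: cong_def)
  moreover have "\<not> QuadRes 3 a" if "a mod 3 \<noteq> 0" "a mod 3 \<noteq> 1"
    using that by (metis QuadRes_def cong_def sq)
  ultimately show ?thesis by (auto simp: Legendre_def cong_def)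
qed

lemma sum_weighted_split:
  fixes c :: rat
  shows "(\<Sum>k\<in>A. (1 - c * w k) * g k) = (\<Sum>k\<in>A. g k) - c * (\<Sum>k\<in>A. g k * w k)"
  unfolding sum_distrib_left sum_subtractf[symmetric] by (intro sum.cong refl) (simp add: algebra_simps)

context large_prime
begin

theorem sum_g_num_cong:
  "(\<Sum>k=1..p-1. g_num k)
    \<simeq> P\<^sup>2 * (\<Sum>k=1..p-1. g_num k * harmonic2 k) + 7 / 6 * P ^ 3 * bernoulli_num (p - 3) (p^4)"
proof -
  define B c where "B = bernoulli_num (p - 3)" and "c = (\<Sum>i=1..h. harmonic2 (h - i) / of_nat i)"
  have c: "P ^ 3 * c \<simeq> P ^ 3 * (7 / 2 * B) (p^4)"
  proof (rule cong_scale)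
    have "c \<simeq> 7 / 2 * weight3_sum (p^1)" unfolding c_def by (rule convolution_cong)
    also have "\<dots> \<simeq> 7 / 2 * B (p^1)"
      unfolding B_def by (intro cong_mult_left weight3_sum_cong_bernoulli pint unit_p_numeral)
    finally show "c \<simeq> 7 / 2 * B (p^1)" .
  qed simp
  have h2: "P ^ 2 * harmonic_half2 \<simeq> P ^ 3 * (7 / 3 * B) (p^4)"
  proof -
    have "P ^ 2 * harmonic_half2 \<simeq> P ^ 2 * (- (7 / 6) * P * harmonic_half3) (p^4)"
      by (rule cong_scale[OF harmonic_half2_cong]) simp
    also have "P ^ 2 * (- (7 / 6) * P * harmonic_half3) = P ^ 3 * (- (7 / 6) * harmonic_half3)"
      by (simp add: power2_eq_square power3_eq_cube)
    also have "\<dots> \<simeq> P ^ 3 * (- (7 / 6) * (- 2 * B)) (p^4)"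
    proof (rule cong_scale)
      have "harmonic_half3 \<simeq> - 2 * weight3_sum (p^1)" by (rule harmonic_half3_cong)
      also have "\<dots> \<simeq> - 2 * B (p^1)"
        unfolding B_def by (intro cong_mult_left weight3_sum_cong_bernoulli pint)
      finally show "- (7 / 6) * harmonic_half3 \<simeq> - (7 / 6) * (- 2 * B) (p^1)"
        by (intro cong_mult_left pint unit_p_numeral)
    qed simp
    finally show ?thesis by simp
  qed
  have "(\<Sum>k=0..p-1. (1 - P\<^sup>2 * harmonic2 k) * g_num k)
      \<simeq> (\<Sum>k=0..p-1. P / of_nat (2 * k + 1) * (1 - 2 * P\<^sup>2 * harmonic2 k) * 1 ^ k) (p^4)"
    unfolding g_num_def by (intro weighted_g_poly_sum_cong pint)
  also have "\<dots> = 1 - 2 * (P\<^sup>2 * harmonic_half2) + (\<Sum>i=1..h. centre_pair i)"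
    by (subst sum_p_odd_denominators) simp_all
  also have "\<dots> \<simeq> 1 - 2 * (P\<^sup>2 * harmonic_half2)
      + (\<Sum>i=1..h. - (1 / 2 * P ^ 2) * (1 / (of_nat i)\<^sup>2) + 2 * P ^ 3 * (harmonic2 (h - i) / of_nat i)) (p^4)"
    by (intro cong_add cong_refl cong_sum centre_pair_cong)
  also have "\<dots> = 1 - 5 / 2 * (P ^ 2 * harmonic_half2) + 2 * (P ^ 3 * c)"
    unfolding sum.distrib sum_distrib_left[symmetric] harmonic2_def[symmetric] harmonic_half2_def c_def
    by simp
  \<comment> \<open>The coefficient \<open>5 / 2\<close> joins the 2 of the middle term with the
    \<open>1 / 2\<close> of the pairs. The final constant is
    \<open>7 - 5/2 * 7/3 = 7/6\<close>.\<close>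
  also have "\<dots> \<simeq> 1 - 5 / 2 * (P ^ 3 * (7 / 3 * B)) + 2 * (P ^ 3 * (7 / 2 * B)) (p^4)"
    by (intro cong_add cong_diff cong_refl cong_mult_left c h2 pint unit_p_numeral)
  also have "\<dots> = 1 + 7 / 6 * P ^ 3 * B" by simp
  finally have main: "(\<Sum>k=0..p-1. (1 - P\<^sup>2 * harmonic2 k) * g_num k) \<simeq> 1 + 7 / 6 * P ^ 3 * B (p^4)" .
  have "(\<Sum>k=0..p-1. (1 - P\<^sup>2 * harmonic2 k) * g_num k) = 1 + (\<Sum>k=1..p-1. (1 - P\<^sup>2 * harmonic2 k) * g_num k)"
    by (subst sum.atLeast_Suc_atMost) (simp_all add: g_num_eq g_coeff_def)
  also have "(\<Sum>k=1..p-1. (1 - P\<^sup>2 * harmonic2 k) * g_num k)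
      = (\<Sum>k=1..p-1. g_num k) - P\<^sup>2 * (\<Sum>k=1..p-1. g_num k * harmonic2 k)"
    by (rule sum_weighted_split)
  finally have "1 + ((\<Sum>k=1..p-1. g_num k) - P\<^sup>2 * (\<Sum>k=1..p-1. g_num k * harmonic2 k)) \<simeq> 1 + 7 / 6 * P ^ 3 * B (p^4)"
    using main by simp
  from cong_add[OF cong_diff[OF this cong_refl[of _ 1]] cong_refl[of _ "P\<^sup>2 * (\<Sum>k=1..p-1. g_num k * harmonic2 k)"]]
  show ?thesis by (simp add: B_def add.commute)
qed

lemma sum_g_num_cong_0: "(\<Sum>k=1..p-1. g_num k) \<simeq> 0 (p^2)"
proof -
  have B: "Zp (bernoulli_num (p - 3))" by (intro Zp_bernoulli) simp
  have "(\<Sum>k=1..p-1. g_num k) \<simeq> P\<^sup>2 * (\<Sum>k=1..p-1. g_num k * harmonic2 k) + 7 / 6 * P ^ 3 * bernoulli_num (p - 3) (p^2)"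
    by (rule cong_mono[OF sum_g_num_cong]) simp
  also have "\<dots> = P\<^sup>2 * ((\<Sum>k=1..p-1. g_num k * harmonic2 k) + 7 / 6 * P * bernoulli_num (p - 3))"
    by (simp add: distrib_left power2_eq_square power3_eq_cube)
  also have "\<dots> \<simeq> 0 (p^2)"
    using B p_gt_3 by (intro cong_0_I pint unit_p_numeral) auto
  finally show ?thesis .
qed

lemma Zp_euler [pint]: "Zp (euler_num r)"
proof (induction r rule: less_induct)
  case (less r)
  have "{..r} = insert r {..<r}" by auto
  then have "2 * euler_num r = (if r = 0 then 2 else 0) - (\<Sum>j<r. of_nat (r choose j) * euler_num j * (1 + (-1) ^ (r - j)))"
    using euler_num_recurrence[of r] by simp
  also have "Zp \<dots>" using less by (intro Zp_diff pint) auto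
  finally have "Zp (2 * euler_num r / 2)" by (intro Zp_divide unit_p_numeral)
  then show ?case by simp
qed

definition alternating_half_sum :: rat where
  "alternating_half_sum = (\<Sum>i=1..h. (-1) ^ i / (of_nat i)\<^sup>2)"

lemma Zp_alternating_half_sum [pint]: "Zp alternating_half_sum"
  unfolding alternating_half_sum_def by (intro pint unit_p_power unit_p_half_range)

text \<open>The alternating sum of \<open>(2k+1)^(p-3)\<close> over \<open>k < p\<close> is
  evaluated twice. By the Euler numbers it is \<open>E_(p-3)\<close>, as every other term carries a
  power of \<open>2 p\<close>. Paired around \<open>k = h\<close>, its terms are even powers of
  \<open>P + 2 i\<close> and \<open>P - 2 i\<close>, which Fermat turns into
  \<open>1 / (2 i)^2\<close>.\<close>

lemma alternating_half_sum_cong: "alternating_half_sum \<simeq> 2 * (-1) ^ h * euler_num (p - 3) (p^1)"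
proof -
  define r where "r = p - 3"
  have r: "even r" "r \<noteq> 0" "p - 1 - 2 = r" using odd_p p_gt_3 by (auto simp: r_def)
  define S where "S = (\<Sum>k=0..p-1. (-1) ^ k * of_nat (2 * k + 1) ^ r :: rat)"
  have "{0..p-1} = {..<p}" using p_gt_3 by auto
  then have "2 * S = euler_num r + (\<Sum>j\<le>r. of_nat (r choose j) * euler_num j * of_nat (2 * p) ^ (r - j))"
    unfolding S_def using alternating_odd_power_sum[OF odd_p, of r] by simp
  also have "\<dots> \<simeq> euler_num r + (\<Sum>j\<le>r. if j = r then euler_num r else 0) (p^1)"
  proof (intro cong_add cong_refl cong_sum)
    fix j assume j: "j \<in> {..r}"
    show "of_nat (r choose j) * euler_num j * of_nat (2 * p) ^ (r - j) \<simeq> (if j = r then euler_num r else 0) (p^1)"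
    proof (cases "j = r")
      case False
      then obtain d where "r - j = Suc d" using j by (metis atMost_iff diff_is_0_eq' le_antisym not0_implies_Suc diff_diff_cancel minus_nat.diff_0)
      then have "of_nat (r choose j) * euler_num j * of_nat (2 * p) ^ (r - j)
          = P ^ 1 * (of_nat (r choose j) * euler_num j * 2 * of_nat (2 * p) ^ d)" by simp
      also have "\<dots> \<simeq> 0 (p^1)" by (intro cong_0_I pint)
      finally show ?thesis using False by simp
    qed simp
  qed
  also have "euler_num r + (\<Sum>j\<le>r. if j = r then euler_num r else 0) = 2 * euler_num r" by simp
  finally have 1: "S \<simeq> euler_num r (p^1)" by (rule cong_cancel) (rule unit_p_numeral)
  have h: "of_nat (2 * h + 1) = P" using p_eq by metis
  have "S = (-1) ^ h * P ^ r + (\<Sum>i=1..h. (-1) ^ (h + i) * ((P + 2 * of_nat i) ^ r + (P - 2 * of_nat i) ^ r))"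
  proof -
    have "(-1) ^ (h + i) * of_nat (2 * (h + i) + 1) ^ r + (-1) ^ (h - i) * of_nat (2 * (h - i) + 1) ^ r
      = (-1) ^ (h + i) * ((P + 2 * of_nat i) ^ r + (P - 2 * of_nat i) ^ r)" if "i \<in> {1..h}" for i
    proof -
      have "of_nat (2 * (h + i) + 1) = P + 2 * of_nat i" unfolding h[symmetric] by simp
      moreover have "of_nat (2 * (h - i) + 1) = P - 2 * of_nat i" unfolding h[symmetric] using that by (simp add: of_nat_diff)
      moreover have "(-1) ^ (h - i) = ((-1) ^ (h + i) :: rat)" using that by (simp add: minus_one_power_iff)
      ultimately show ?thesis by (simp only: distrib_left)
    qed
    then show ?thesis unfolding S_def sum_p_centre h by simp
  qed
  also have "\<dots> \<simeq> (-1) ^ h * 0 + (\<Sum>i=1..h. (-1) ^ (h + i) * (1 / (2 * of_nat i)\<^sup>2 + 1 / (2 * of_nat i)\<^sup>2)) (p^1)"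
  proof (intro cong_add cong_sum cong_mult_left pint)
    show "P ^ r \<simeq> 0 (p^1)" using r(2) by (intro cong_0_divide_I[of "P ^ (r - 1)"] pint) (simp add: power_eq_if)
    fix i assume i: "i \<in> {1..h}"
    have "1 / of_nat (2 * i) ^ 2 \<simeq> of_nat (2 * i) ^ (p - 1 - 2) (p^1)"
      using i p_eq p_gt_3 by (intro inverse_power_cong) auto
    then have e: "(2 * of_nat i) ^ r \<simeq> 1 / (2 * of_nat i)\<^sup>2 (p^1)"
      using r by (auto intro: cong_sym)
    have "(P + 2 * of_nat i) ^ r \<simeq> (2 * of_nat i) ^ r (p^1)"
      by (intro cong_power cong_0_divide_I[of 1] pint) simp
    then show "(P + 2 * of_nat i) ^ r \<simeq> 1 / (2 * of_nat i)\<^sup>2 (p^1)" using e by (rule cong_trans)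
    have "(P - 2 * of_nat i) ^ r \<simeq> (- (2 * of_nat i)) ^ r (p^1)"
      by (intro cong_power cong_0_divide_I[of 1] pint) simp
    also have "(- (2 * of_nat i)) ^ r = (2 * of_nat i :: rat) ^ r" using r by simp
    also note e
    finally show "(P - 2 * of_nat i) ^ r \<simeq> 1 / (2 * of_nat i)\<^sup>2 (p^1)" .
  qed
  also have "(-1) ^ h * 0 + (\<Sum>i=1..h. (-1) ^ (h + i) * (1 / (2 * of_nat i)\<^sup>2 + 1 / (2 * of_nat i)\<^sup>2))
      = (-1) ^ h / 2 * alternating_half_sum"
    unfolding alternating_half_sum_def sum_distrib_left mult_zero_right add_0_left
    by (intro sum.cong refl) (simp add: power_add power_mult_distrib)
  finally have "euler_num r \<simeq> (-1) ^ h / 2 * alternating_half_sum (p^1)"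
    by (rule cong_trans[OF cong_sym[OF 1]])
  then have "2 * (-1) ^ h * euler_num r \<simeq> 2 * (-1) ^ h * ((-1) ^ h / 2 * alternating_half_sum) (p^1)"
    by (rule cong_mult_left) (intro pint)
  also have "2 * (-1) ^ h * ((-1) ^ h / 2 * alternating_half_sum) = alternating_half_sum"
    by (simp flip: power_add mult.assoc)
  finally show ?thesis unfolding r_def by (rule cong_sym)
qed

text \<open>Euler's criterion gives the congruence modulo \<open>p\<close>; both sides have absolute
  value at most 1, and \<open>p > 3\<close>, so they are equal.\<close>

lemma Legendre_minus_1: "of_int (Legendre (-1) (int p)) = ((-1) ^ h :: rat)"
proof -
  have "[Legendre (-1) (int p) = (-1) ^ ((p - 1) div 2)] (mod int p)"
    using euler_criterion[of p "-1"] prime_p p_gt_3 by simp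
  then have "int p dvd Legendre (-1) (int p) - (-1) ^ h"
    by (simp add: h_def cong_iff_dvd_diff)
  moreover have "\<bar>Legendre (-1) (int p) - (-1) ^ h\<bar> < int p"
    using p_gt_3 by (auto simp: Legendre_def minus_one_power_iff)
  ultimately have "Legendre (-1) (int p) - (-1) ^ h = 0"
    using dvd_imp_le_int[of "Legendre (-1) (int p) - (-1) ^ h" "int p"] by fastforce
  then show ?thesis by simp
qed

text \<open>Modulo \<open>p^3\<close> the half sum of weight two and the cubic part of each pair
  disappear. The quadratic parts give \<open>-1/2\<close> times \<open>alternating_half_sum\<close>,
  whose factor 2 makes the coefficient of the Euler number -1.\<close>

theorem sum_g_poly_minus_1_cong:
  "(\<Sum>k=0..p-1. poly (g_poly k) (-1))
    \<simeq> (-1) ^ h + P\<^sup>2 * ((\<Sum>k=0..p-1. poly (g_poly k) (-1) * harmonic2 k) - euler_num (p - 3)) (p^3)"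
proof -
  let ?G = "\<lambda>k. poly (g_poly k) (-1)"
  have "(\<Sum>k=0..p-1. (1 - P\<^sup>2 * harmonic2 k) * ?G k)
      \<simeq> (\<Sum>k=0..p-1. P / of_nat (2 * k + 1) * (1 - 2 * P\<^sup>2 * harmonic2 k) * (-1) ^ k) (p^3)"
    by (rule cong_mono[OF weighted_g_poly_sum_cong]) (auto intro: pint)
  also have "\<dots> = (-1) ^ h * (1 - 2 * (P\<^sup>2 * harmonic_half2) + (\<Sum>i=1..h. (-1) ^ i * centre_pair i))"
    by (subst sum_p_odd_denominators) (simp_all add: algebra_simps)
  also have "\<dots> \<simeq> (-1) ^ h * (1 - 2 * 0 + (\<Sum>i=1..h. (-1) ^ i * (P ^ 2 * (- (1 / 2) * (1 / (of_nat i)\<^sup>2))))) (p^3)"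
  proof (intro cong_mult_left[OF _ Zp_power] cong_add cong_diff[OF cong_refl] cong_sum)
    have "P\<^sup>2 * harmonic_half2 \<simeq> P\<^sup>2 * 0 (p^3)" by (rule cong_scale[OF harmonic_half2_cong_0]) simp
    then have "P\<^sup>2 * harmonic_half2 \<simeq> 0 (p^3)" by simp
    then show "2 * (P\<^sup>2 * harmonic_half2) \<simeq> 2 * 0 (p^3)" by (rule cong_mult_left) (rule Zp_numeral)
    fix i assume i: "i \<in> {1..h}"
    have "centre_pair i \<simeq> - (1 / 2 * P ^ 2) * (1 / (of_nat i)\<^sup>2) + 2 * P ^ 3 * (harmonic2 (h - i) / of_nat i) (p^3)"
      using centre_pair_cong[OF i] by (rule cong_mono) simp
    also have "\<dots> \<simeq> - (1 / 2 * P ^ 2) * (1 / (of_nat i)\<^sup>2) (p^3)"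
      using i h_less by (intro cong_0_divide_I[of "2 * (harmonic2 (h - i) / of_nat i)"] pint unit_p_half_range) auto
    also have "- (1 / 2 * P ^ 2) * (1 / (of_nat i)\<^sup>2) = P ^ 2 * (- (1 / 2) * (1 / (of_nat i)\<^sup>2))" by simp
    finally show "centre_pair i \<simeq> P ^ 2 * (- (1 / 2) * (1 / (of_nat i)\<^sup>2)) (p^3)" .
  qed (auto intro: pint)
  also have "\<dots> = (-1) ^ h + P ^ 2 * (- (1 / 2) * (-1) ^ h * alternating_half_sum)"
  proof -
    have "(\<Sum>i=1..h. (-1) ^ i * (P ^ 2 * (- (1 / 2) * (1 / (of_nat i)\<^sup>2)))) = P ^ 2 * (- (1 / 2) * alternating_half_sum)"
      unfolding alternating_half_sum_def sum_distrib_left by (intro sum.cong refl) simp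
    then show ?thesis by (simp only:) (simp add: algebra_simps)
  qed
  also have "\<dots> \<simeq> (-1) ^ h + P ^ 2 * (- (1 / 2) * (-1) ^ h * (2 * (-1) ^ h * euler_num (p - 3))) (p^3)"
    by (intro cong_add cong_refl cong_scale[where m = 1] cong_mult_left alternating_half_sum_cong pint unit_p_numeral) simp
  also have "- (1 / 2) * (-1) ^ h * (2 * (-1) ^ h * euler_num (p - 3)) = - euler_num (p - 3)"
    by (simp flip: power_add mult.assoc)
  finally have main: "(\<Sum>k=0..p-1. (1 - P\<^sup>2 * harmonic2 k) * ?G k) \<simeq> (-1) ^ h + P ^ 2 * - euler_num (p - 3) (p^3)" .
  have "(\<Sum>k=0..p-1. (1 - P\<^sup>2 * harmonic2 k) * ?G k) = (\<Sum>k=0..p-1. ?G k) - P\<^sup>2 * (\<Sum>k=0..p-1. ?G k * harmonic2 k)"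
    by (rule sum_weighted_split)
  from cong_add[OF main[unfolded this] cong_refl[of _ "P\<^sup>2 * (\<Sum>k=0..p-1. ?G k * harmonic2 k)"]]
  show ?thesis by (simp add: algebra_simps)
qed


section \<open>Binomial expansions with exponent \<open>p\<close> and the character modulo 3\<close>

lemma cong_choose_p:
  assumes "Suc j < p"
  shows "of_nat (p choose Suc j) \<simeq> P * ((-1) ^ j / of_nat (Suc j)) (p^2)"
proof -
  have "of_nat (p choose Suc j) = P ^ 1 * (of_nat ((p - 1) choose j) / of_nat (Suc j))"
    using of_nat_choose_Suc_Suc[of "p - 1" j] p_gt_3 by simp
  also have "\<dots> \<simeq> P ^ 1 * ((-1) ^ j / of_nat (Suc j)) (p^2)"
    using assms by (intro cong_scale[where m = 1] cong_divide cong_choose_pred' unit_p_less) auto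
  finally show ?thesis by simp
qed

lemma odd_part_p: "odd_part w p = (\<Sum>k<h. of_nat (p choose (2 * k + 1)) * w ^ k) + w ^ h"
proof -
  have "odd_part w p = (\<Sum>k<Suc h. of_nat (p choose (2 * k + 1)) * w ^ k)"
    unfolding odd_part_def
  proof (rule sum.mono_neutral_right)
    show "\<forall>k\<in>{..p} - {..<Suc h}. of_nat (p choose (2 * k + 1)) * w ^ k = 0"
    proof
      fix k assume "k \<in> {..p} - {..<Suc h}"
      then have "p < 2 * k + 1" using p_eq by simp
      then show "of_nat (p choose (2 * k + 1)) * w ^ k = 0" by (simp add: binomial_eq_0)
    qed
  qed (use h_less in auto)
  moreover have "p choose (2 * h + 1) = 1" using p_eq by (metis binomial_n_n)
  ultimately show ?thesis by (simp only: sum.lessThan_Suc of_nat_1 mult_1)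
qed

lemma even_part_p: "even_part w p = 1 + (\<Sum>i=1..h. of_nat (p choose (2 * i)) * w ^ i)"
proof -
  have "even_part w p = (\<Sum>k=0..h. of_nat (p choose (2 * k)) * w ^ k)"
    unfolding even_part_def
  proof (rule sum.mono_neutral_right)
    show "\<forall>k\<in>{..p} - {0..h}. of_nat (p choose (2 * k)) * w ^ k = 0"
    proof
      fix k assume "k \<in> {..p} - {0..h}"
      then have "p < 2 * k" using p_eq by simp
      then show "of_nat (p choose (2 * k)) * w ^ k = 0" by (simp add: binomial_eq_0)
    qed
  qed (use h_less in auto)
  then show ?thesis by (simp add: sum.atLeast_Suc_atMost)
qed

text \<open>Modulo \<open>p^2\<close>, \<open>C(p, 2k+1)\<close> is \<open>P / (2k+1)\<close> for
  \<open>k < h\<close>. The last coefficient \<open>C(p, p) = 1\<close> is not of this form, hence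
  the subtraction of \<open>w ^ h\<close>.\<close>

lemma odd_denominator_sum_cong:
  assumes "Zp w"
  shows "P * (\<Sum>k<h. w ^ k / of_nat (2 * k + 1)) \<simeq> odd_part w p - w ^ h (p^2)"
proof -
  have "P * (\<Sum>k<h. w ^ k / of_nat (2 * k + 1)) = (\<Sum>k<h. (P * ((-1) ^ (2 * k) / of_nat (Suc (2 * k)))) * w ^ k)"
    unfolding sum_distrib_left by (intro sum.cong refl) simp
  also have "\<dots> \<simeq> (\<Sum>k<h. of_nat (p choose Suc (2 * k)) * w ^ k) (p^2)"
    using assms p_eq by (intro cong_sum cong_mult cong_refl cong_sym[OF cong_choose_p] pint) auto
  finally show ?thesis by (simp add: odd_part_p del: binomial_Suc_Suc)
qed

text \<open>At even positive index the sign is reversed, and the exceptional coefficient is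
  \<open>C(p, 0) = 1\<close>.\<close>

lemma even_denominator_sum_cong:
  assumes "Zp w"
  shows "P * (\<Sum>i=1..h. w ^ i / of_nat (2 * i)) \<simeq> 1 - even_part w p (p^2)"
proof -
  have "P * (\<Sum>i=1..h. w ^ i / of_nat (2 * i)) = - (\<Sum>i=1..h. (P * ((-1) ^ (2 * i - 1) / of_nat (Suc (2 * i - 1)))) * w ^ i)"
    unfolding sum_distrib_left sum_negf[symmetric]
  proof (intro sum.cong refl)
    fix i assume "i \<in> {1..h}"
    then obtain l where "i = Suc l" by (cases i) auto
    then show "P * (w ^ i / of_nat (2 * i)) = - (P * ((-1) ^ (2 * i - 1) / of_nat (Suc (2 * i - 1))) * w ^ i)"
      by simp
  qed
  also have "\<dots> \<simeq> - (\<Sum>i=1..h. of_nat (p choose Suc (2 * i - 1)) * w ^ i) (p^2)"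
    using assms p_eq by (intro cong_uminus cong_sum cong_mult cong_refl cong_sym[OF cong_choose_p] pint) auto
  also have "(\<Sum>i=1..h. of_nat (p choose Suc (2 * i - 1)) * w ^ i) = (\<Sum>i=1..h. of_nat (p choose (2 * i)) * w ^ i)"
    by (intro sum.cong refl) auto
  finally show ?thesis by (simp add: even_part_p)
qed

definition chi3 :: rat where "chi3 = of_int (Legendre (int p) 3)"

lemma p_mod_6: "p mod 6 = 1 \<or> p mod 6 = 5"
proof -
  have "\<not> 3 dvd p"
  proof
    assume "3 dvd p"
    then have "3 = p" by (intro primes_dvd_imp_eq prime_p) auto
    then show False using p_gt_3 by simp
  qed
  then have "p mod 6 mod 3 \<noteq> 0" by (simp add: mod_mod_cancel dvd_eq_mod_eq_0)
  moreover have "p mod 6 mod 2 = 1" using odd_p by (simp add: mod_mod_cancel odd_iff_mod_2_eq_one)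
  moreover have "p mod 6 < 6" by simp
  then have "p mod 6 = 0 \<or> p mod 6 = 1 \<or> p mod 6 = 2 \<or> p mod 6 = 3 \<or> p mod 6 = 4 \<or> p mod 6 = 5" by linarith
  ultimately show ?thesis by auto
qed

text \<open>\<open>1 + sqrt(-3)\<close> is twice a primitive sixth root of unity, so its power of
  exponent \<open>p\<close> is \<open>2^(p-1) (1 + chi3 sqrt(-3))\<close>.\<close>

lemma chi3_parts:
  "chi3 = 1 \<or> chi3 = -1" "odd_part (-3) p = chi3 * 2 ^ (p - 1)" "even_part (-3) p = 2 ^ (p - 1)"
proof -
  have *: "chi3 = (if p mod 6 = 1 then 1 else -1)"
  proof -
    have "int p mod 3 = int (p mod 3)" by (simp add: zmod_int)
    moreover have "p mod 3 = (if p mod 6 = 1 then 1 else 2)"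
      using p_mod_6 mod_mod_cancel[of 3 6 p] by auto
    ultimately show ?thesis by (simp add: chi3_def Legendre_3)
  qed
  then show "chi3 = 1 \<or> chi3 = -1" by simp
  define q where "q = p div 6"
  have "p = 6 * q + p mod 6" by (simp add: q_def)
  then have "p = 6 * q + 1 \<and> p mod 6 = 1 \<or> p = 6 * q + 5 \<and> p mod 6 = 5"
    using p_mod_6 by auto
  then have "odd_part (-3) p = chi3 * 2 ^ (p - 1) \<and> even_part (-3) p = 2 ^ (p - 1)"
  proof
    assume "p = 6 * q + 1 \<and> p mod 6 = 1"
    then have p: "p = 6 * q + 1" "chi3 = 1" using * by auto
    show ?thesis unfolding p(2) unfolding p(1) by (simp only: even_odd_part_minus_3_mod_6) simp
  next
    assume "p = 6 * q + 5 \<and> p mod 6 = 5"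
    then have p: "p = 6 * q + 5" "chi3 = - 1" using * by auto
    show ?thesis unfolding p(2) unfolding p(1) by (simp only: even_odd_part_minus_3_mod_6) simp
  qed
  then show "odd_part (-3) p = chi3 * 2 ^ (p - 1)" "even_part (-3) p = 2 ^ (p - 1)" by auto
qed

lemma Zp_chi3 [pint]: "Zp chi3" unfolding chi3_def by (rule pint)

lemma two_power_cong: "2 ^ (p - 1) \<simeq> 1 (p^1)"
  using fermat_cong[of 2] unit_p_numeral by simp

text \<open>Euler's criterion for -3 joined with reciprocity, read off from the odd part: modulo
  \<open>p\<close> only its last term \<open>(-3)^h\<close> remains, while its exact value is
  \<open>chi3 * 2 ^ (p - 1)\<close>.\<close>

lemma minus_3_power_h_cong: "(-3) ^ h \<simeq> chi3 (p^1)"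
proof -
  have "P * (\<Sum>k<h. (-3) ^ k / of_nat (2 * k + 1)) \<simeq> chi3 * 2 ^ (p - 1) - (-3) ^ h (p^1)"
    unfolding chi3_parts(2)[symmetric] by (rule cong_mono[OF odd_denominator_sum_cong]) (auto intro: pint)
  moreover have "P ^ 1 * (\<Sum>k<h. (-3) ^ k / of_nat (2 * k + 1)) \<simeq> 0 (p^1)"
    using h_less by (intro cong_0_I pint unit_p_odd) auto
  ultimately have 0: "chi3 * 2 ^ (p - 1) - (-3) ^ h \<simeq> 0 (p^1)"
    unfolding power_one_right by (rule cong_trans[OF cong_sym])
  have "chi3 * 2 ^ (p - 1) - (-3) ^ h \<simeq> chi3 * 1 - (-3) ^ h (p^1)"
    by (intro cong_diff cong_mult_left two_power_cong cong_refl pint)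
  from cong_trans[OF cong_sym[OF this] 0] have "chi3 - (-3) ^ h \<simeq> 0 (p^1)" by simp
  then have "chi3 \<simeq> (-3) ^ h (p^1)" by (simp only: cong_0_iff[of _ chi3])
  then show ?thesis by (rule cong_sym)
qed

text \<open>The Fermat quotient of 2 cancels: it occurs only multiplied by \<open>(-3)\<^sup>h - chi3\<close>.\<close>

lemma fermat_error_product_cong: "(2 ^ (p - 1) - 1) * ((-3) ^ h - chi3) \<simeq> 0 (p^2)"
proof -
  have "2 ^ (p - 1) - 1 \<simeq> 0 (p^1)" "(-3) ^ h - chi3 \<simeq> 0 (p^1)"
    using two_power_cong minus_3_power_h_cong by (simp_all only: cong_0_iff[of _ "2 ^ (p - 1)"] cong_0_iff[of _ "(-3) ^ h"])
  from cong_mult_0[OF this] show ?thesis by (simp add: numeral_2_eq_2)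
qed

theorem sum_g_poly_minus_3_cong: "(\<Sum>k=0..p-1. poly (g_poly k) (-3)) \<simeq> chi3 (p^2)"
proof -
  let ?G = "\<lambda>k. poly (g_poly k) (-3)"
  have Z3: "Zp (-3)" by (intro pint)
  have "(\<Sum>k=0..p-1. ?G k) = (\<Sum>k=0..p-1. (1 - P\<^sup>2 * harmonic2 k) * ?G k) + P\<^sup>2 * (\<Sum>k=0..p-1. ?G k * harmonic2 k)"
    unfolding sum_weighted_split by simp
  also have "\<dots> \<simeq> (\<Sum>k=0..p-1. P / of_nat (2 * k + 1) * (1 - 2 * P\<^sup>2 * harmonic2 k) * (-3) ^ k) + 0 (p^2)"
  proof (intro cong_add)
    show "(\<Sum>k=0..p-1. (1 - P\<^sup>2 * harmonic2 k) * ?G k)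
      \<simeq> (\<Sum>k=0..p-1. P / of_nat (2 * k + 1) * (1 - 2 * P\<^sup>2 * harmonic2 k) * (-3) ^ k) (p^2)"
      by (rule cong_mono[OF weighted_g_poly_sum_cong[OF Z3]]) simp
    show "P\<^sup>2 * (\<Sum>k=0..p-1. ?G k * harmonic2 k) \<simeq> 0 (p^2)"
      using Z3 p_gt_3 by (intro cong_0_I pint) auto
  qed
  also have "(\<Sum>k=0..p-1. P / of_nat (2 * k + 1) * (1 - 2 * P\<^sup>2 * harmonic2 k) * (-3) ^ k) + 0
     \<simeq> (\<Sum>k=0..p-1. P / of_nat (2 * k + 1) * (-3) ^ k) (p^2)"
    unfolding add_0_right
  proof (intro cong_sum)
    fix k assume "k \<in> {0..p-1}"
    then have k: "k < p" using p_gt_3 by auto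
    then have "Zp (- (2 * (P / of_nat (2 * k + 1)) * harmonic2 k * (-3) ^ k))"
      by (intro Zp_uminus Zp_mult Zp_P_div_odd Zp_harmonic2 Zp_power Z3 Zp_numeral)
    then show "P / of_nat (2 * k + 1) * (1 - 2 * P\<^sup>2 * harmonic2 k) * (-3) ^ k \<simeq> P / of_nat (2 * k + 1) * (-3) ^ k (p^2)"
      by (rule cong_0_divide_I) (simp add: algebra_simps)
  qed
  also have "(\<Sum>k=0..p-1. P / of_nat (2 * k + 1) * (-3) ^ k)
     = (-3) ^ h + ((\<Sum>i=1..h. P / (P + 2 * of_nat i) * (-3) ^ (h + i)) + (\<Sum>k<h. P / of_nat (2 * k + 1) * (-3) ^ k))"
  proof -
    have h: "of_nat (2 * h + 1) = P" using p_eq by metis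
    have "(\<Sum>i=1..h. P / of_nat (2 * (h - i) + 1) * (-3) ^ (h - i)) = (\<Sum>k<h. P / of_nat (2 * k + 1) * (-3) ^ k)"
      by (rule sum.reindex_bij_witness[of _ "\<lambda>k. h - k" "\<lambda>i. h - i"]) auto
    moreover have "of_nat (2 * (h + i) + 1) = P + 2 * of_nat i" for i unfolding h[symmetric] by simp
    ultimately show ?thesis unfolding sum_p_centre sum.distrib h by (simp only:) simp
  qed
  also have "\<dots> \<simeq> (-3) ^ h + ((-3) ^ h * (1 - even_part (-3) p) + (odd_part (-3) p - (-3) ^ h)) (p^2)"
  proof (intro cong_add cong_refl)
    have "(\<Sum>i=1..h. P / (P + 2 * of_nat i) * (-3) ^ (h + i)) = P ^ 1 * (\<Sum>i=1..h. (-3) ^ (h + i) * (1 / (P - - (2 * of_nat i))))"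
      unfolding sum_distrib_left by (intro sum.cong refl) simp
    also have "\<dots> \<simeq> P ^ 1 * (\<Sum>i=1..h. (-3) ^ (h + i) * - (1 / - (2 * of_nat i))) (p^2)"
      by (intro cong_scale[where m = 1] cong_sum cong_mult_left reflect_inverse_cong unit_p_uminus unit_p_mult unit_p_numeral unit_p_half_range Zp_power Z3) simp_all
    also have "\<dots> = (-3) ^ h * (P * (\<Sum>i=1..h. (-3) ^ i / of_nat (2 * i)))"
      unfolding sum_distrib_left by (intro sum.cong refl) (simp add: power_add)
    also have "\<dots> \<simeq> (-3) ^ h * (1 - even_part (-3) p) (p^2)"
      by (intro cong_mult_left even_denominator_sum_cong Zp_power Z3)
    finally show "(\<Sum>i=1..h. P / (P + 2 * of_nat i) * (-3) ^ (h + i)) \<simeq> (-3) ^ h * (1 - even_part (-3) p) (p^2)" .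
    have "(\<Sum>k<h. P / of_nat (2 * k + 1) * (-3) ^ k) = P * (\<Sum>k<h. (-3) ^ k / of_nat (2 * k + 1))"
      unfolding sum_distrib_left by (intro sum.cong refl) simp
    then show "(\<Sum>k<h. P / of_nat (2 * k + 1) * (-3) ^ k) \<simeq> odd_part (-3) p - (-3) ^ h (p^2)"
      using odd_denominator_sum_cong[OF Z3] by simp
  qed
  \<comment> \<open>With \<open>w = (-3)^h\<close> and \<open>T = 2^(p-1)\<close> the total is
    \<open>w - w T + chi3 T\<close>, whose distance from \<open>chi3\<close> factors into two terms
    that are both divisible by \<open>p\<close>.\<close>
  also have "(-3) ^ h + ((-3) ^ h * (1 - even_part (-3) p) + (odd_part (-3) p - (-3) ^ h))
      = chi3 - (2 ^ (p - 1) - 1) * ((-3) ^ h - chi3)"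
    unfolding chi3_parts by (simp add: algebra_simps)
  also have "\<dots> \<simeq> chi3 - 0 (p^2)" by (intro cong_diff cong_refl fermat_error_product_cong)
  finally show ?thesis by simp
qed

text \<open>The exact identity at \<open>n = p\<close> makes the sum of \<open>(4 k + 3) g_k\<close>
  divisible by \<open>p^2\<close>. The sum of the \<open>g_k\<close> with \<open>k >= 1\<close>
  vanishes modulo \<open>p^2\<close> as well, so only the 3 from \<open>k = 0\<close> is
  left.\<close>

theorem sum_k_g_num_cong: "(\<Sum>k=1..p-1. of_nat k * g_num k) \<simeq> - (3 / 4) (p^2)"
proof -
  \<comment> \<open>Catalan numbers are integers; this matters at \<open>k = p - 1\<close>, where
    the defining denominator is \<open>p\<close>.\<close>
  have cat: "catalan_num k = of_nat (2 * k choose k) - of_nat (2 * k choose Suc k)" for k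
  proof -
    have "of_nat (Suc k) * (of_nat (2 * k choose Suc k) :: rat) = of_nat k * of_nat (2 * k choose k)"
      using of_nat_choose_Suc_right[of k "2 * k"] by simp
    then show ?thesis by (simp add: catalan_num_def field_simps)
  qed
  have "(\<Sum>k=0..p-1. of_nat (4 * k + 3) * g_num k) = P\<^sup>2 * (3 * (\<Sum>k=0..p-1. of_nat (((p - 1) choose k)\<^sup>2) * catalan_num k))"
    using p_gt_3 by (subst weighted_g_num_sum) auto
  also have "\<dots> \<simeq> 0 (p^2)" unfolding cat by (intro cong_0_I pint)
  also have "(\<Sum>k=0..p-1. of_nat (4 * k + 3) * g_num k) = 4 * (\<Sum>k=1..p-1. of_nat k * g_num k) + 3 * (\<Sum>k=1..p-1. g_num k) + 3"
    by (subst sum.atLeast_Suc_atMost) (simp_all add: g_num_eq[of 0] g_coeff_def sum_distrib_left sum.distrib algebra_simps)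
  finally have "4 * (\<Sum>k=1..p-1. of_nat k * g_num k) + 3 * (\<Sum>k=1..p-1. g_num k) + 3 \<simeq> 0 (p^2)" .
  from cong_diff[OF this cong_add[OF cong_mult_left[OF sum_g_num_cong_0, of 3] cong_refl[of _ 3]]]
  have "4 * (\<Sum>k=1..p-1. of_nat k * g_num k) \<simeq> 4 * (- (3 / 4)) (p^2)" by simp
  then show ?thesis by (rule cong_cancel) (rule unit_p_numeral)
qed

section \<open>Central binomial coefficients modulo \<open>p\<close> and the Fermat quotient of
  3\<close>

text \<open>\<open>C(2k, k) = (-4)^k C(-1/2, k)\<close>, and \<open>h\<close> is congruent to
  \<open>-1/2\<close> modulo \<open>p\<close>.\<close>

lemma cong_central_choose: "k \<le> h \<Longrightarrow> of_nat (2 * k choose k) \<simeq> (-4) ^ k * of_nat (h choose k) (p^1)"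
proof (induction k)
  case (Suc k)
  have u: "unit_p (of_nat (Suc k))" using Suc.prems h_less by (intro unit_p_less) auto
  have 1: "of_nat (h choose Suc k) = (of_nat h - of_nat k) / of_nat (Suc k) * (of_nat (h choose k) :: rat)"
    using of_nat_choose_Suc_right[of k h] by (simp add: field_simps del: of_nat_Suc)
  have 2: "2 * (of_nat h - of_nat k) = P - of_nat (2 * k + 1)" unfolding P_eq by simp
  have "of_nat (2 * Suc k choose Suc k) \<simeq> 2 * of_nat (2 * k + 1) / of_nat (Suc k) * ((-4) ^ k * of_nat (h choose k)) (p^1)"
    unfolding central_binomial_Suc using Suc u by (intro cong_mult_left pint) auto
  also have "2 * of_nat (2 * k + 1) / of_nat (Suc k) * ((-4) ^ k * of_nat (h choose k))
    \<simeq> (-4) ^ Suc k * of_nat (h choose Suc k) (p^1)"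
  proof (rule cong_0_divide_I)
    show "Zp (2 / of_nat (Suc k) * ((-4) ^ k * of_nat (h choose k)))" using u by (intro pint)
    have "(-4) ^ Suc k * of_nat (h choose Suc k) = - 2 * (2 * (of_nat h - of_nat k)) / of_nat (Suc k) * ((-4) ^ k * of_nat (h choose k) :: rat)"
      unfolding 1 by (simp add: field_simps del: of_nat_Suc)
    then show "2 * of_nat (2 * k + 1) / of_nat (Suc k) * ((-4) ^ k * of_nat (h choose k)) - (-4) ^ Suc k * of_nat (h choose Suc k)
        = P ^ 1 * (2 / of_nat (Suc k) * ((-4) ^ k * of_nat (h choose k)))"
      unfolding 2 by (simp only: power_one_right) (simp add: field_simps del: of_nat_Suc)
  qed
  finally show ?case .
qed simp

text \<open>In this range \<open>p\<close> divides \<open>(2 i)!\<close> but not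
  \<open>i!\<close>.\<close>

lemma central_choose_cong_0:
  assumes "h < i" "i < p" shows "of_nat (2 * i choose i) \<simeq> 0 (p^1)"
proof -
  have "p dvd (2 * i choose i)"
  proof -
    have "p dvd fact (2 * i)" using assms p_eq prime_p by (simp add: prime_dvd_fact_iff)
    moreover have "fact (2 * i) = fact i * fact i * (2 * i choose i)"
      using binomial_fact_lemma[of i "2 * i"] by simp
    moreover have "\<not> p dvd fact i" using assms prime_p by (simp add: prime_dvd_fact_iff)
    ultimately show ?thesis using prime_p by (metis prime_dvd_multD)
  qed
  then obtain l where "2 * i choose i = p * l" by blast
  then have "of_nat (2 * i choose i) = P ^ 1 * (of_nat l :: rat)" by simp
  also have "\<dots> \<simeq> 0 (p^1)" by (intro cong_0_I pint)
  finally show ?thesis .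
qed

text \<open>Modulo \<open>p\<close> this is \<open>binomial_harmonic_sum\<close> with
  \<open>y = -4\<close>. Multiplied by \<open>p\<close>, its two terms can be read off modulo
  \<open>p^2\<close> from the expansions of \<open>(1 + 1)^p\<close> and
  \<open>(1 + sqrt(-3))^p\<close>.\<close>

lemma sum_central_choose_harmonic_cong:
  "(\<Sum>k\<le>h. of_nat (2 * k choose k) * harmonic k) \<simeq> - (chi3 * fermat_quotient p 3) (p^1)"
proof -
  let ?w = "(-3) ^ h :: rat" and ?T = "2 ^ (p - 1) :: rat"
  have Z3: "Zp (-3)" by (intro pint)
  define S where "S = (\<Sum>k\<le>h. of_nat (h choose k) * (-4) ^ k * harmonic k)"
  have S: "(\<Sum>k\<le>h. of_nat (2 * k choose k) * harmonic k) \<simeq> S (p^1)"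
  proof -
    have "(\<Sum>k\<le>h. of_nat (2 * k choose k) * harmonic k) \<simeq> (\<Sum>k\<le>h. (-4) ^ k * of_nat (h choose k) * harmonic k) (p^1)"
      using h_less by (intro cong_sum cong_mult cong_central_choose cong_refl pint) auto
    then show ?thesis by (simp add: S_def mult_ac)
  qed
  have S_eq: "S = ?w * harmonic h - (\<Sum>k=1..h. (-3) ^ (h - k) / of_nat k)"
    unfolding S_def binomial_harmonic_sum by simp
  have H: "P * harmonic h \<simeq> - 2 * (?T - 1) (p^2)"
  proof -
    have "p = Suc (p - 1)" using p_gt_3 by simp
    then have "even_part 1 p = ?T" using even_odd_part_1[of "p - 1"] by simp
    then have "P * (\<Sum>i=1..h. 1 ^ i / of_nat (2 * i)) \<simeq> 1 - ?T (p^2)"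
      using even_denominator_sum_cong[of 1] by simp
    from cong_mult_left[OF this, of 2]
    have "2 * (P * (\<Sum>i=1..h. 1 ^ i / of_nat (2 * i))) \<simeq> 2 * (1 - ?T) (p^2)" by simp
    also have "2 * (P * (\<Sum>i=1..h. 1 ^ i / of_nat (2 * i))) = P * harmonic h"
      unfolding harmonic_def sum_distrib_left by (intro sum.cong refl) simp
    finally show ?thesis by simp
  qed
  have R: "P * (\<Sum>k=1..h. (-3) ^ (h - k) / of_nat k) \<simeq> - 2 * (chi3 * ?T - ?w) (p^2)"
  proof -
    have "(\<Sum>k=1..h. (-3) ^ (h - k) / of_nat k) = (\<Sum>j<h. (-3) ^ j / of_nat (h - j))"
      by (rule sum.reindex_bij_witness[of _ "\<lambda>k. h - k" "\<lambda>i. h - i"]) auto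
    \<comment> \<open>Since \<open>2 (h - j) = P - (2 j + 1)\<close>, reflection leads to the odd
      denominators that occur in the odd part.\<close>
    also have "\<dots> = (\<Sum>j<h. 2 * (-3) ^ j * (1 / (P - of_nat (2 * j + 1))))"
    proof (intro sum.cong refl)
      fix j assume "j \<in> {..<h}"
      then have "P - of_nat (2 * j + 1) = 2 * of_nat (h - j)" by (simp add: P_eq of_nat_diff)
      then show "(-3) ^ j / of_nat (h - j) = 2 * (-3) ^ j * (1 / (P - of_nat (2 * j + 1)))" by simp
    qed
    finally have "P * (\<Sum>k=1..h. (-3) ^ (h - k) / of_nat k) = P ^ 1 * (\<Sum>j<h. 2 * (-3) ^ j * (1 / (P - of_nat (2 * j + 1))))"
      by simp
    also have "\<dots> \<simeq> P ^ 1 * (\<Sum>j<h. 2 * (-3) ^ j * - (1 / of_nat (2 * j + 1))) (p^2)"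
      using h_less by (intro cong_scale[where m = 1] cong_sum cong_mult_left reflect_inverse_cong unit_p_odd Zp_mult Zp_numeral Zp_power Z3) auto
    also have "\<dots> = - 2 * (P * (\<Sum>j<h. (-3) ^ j / of_nat (2 * j + 1)))"
      unfolding sum_distrib_left by (intro sum.cong refl) simp
    also have "\<dots> \<simeq> - 2 * (odd_part (-3) p - ?w) (p^2)"
      by (intro cong_mult_left odd_denominator_sum_cong Z3 pint)
    finally show ?thesis unfolding chi3_parts .
  qed
  have "P * S = ?w * (P * harmonic h) - P * (\<Sum>k=1..h. (-3) ^ (h - k) / of_nat k)"
    unfolding S_eq by (simp add: algebra_simps)
  also have "\<dots> \<simeq> ?w * (- 2 * (?T - 1)) - - 2 * (chi3 * ?T - ?w) (p^2)"
    by (intro cong_diff R cong_mult_left[OF H] Zp_power Z3)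
  also have "\<dots> = - 2 * ((?T - 1) * (?w - chi3)) - 2 * (?w - chi3)"
    by (simp add: algebra_simps)
  also have "\<dots> \<simeq> - 2 * 0 - chi3 * (3 ^ (p - 1) - 1) (p^2)"
  proof (intro cong_diff cong_mult_left[OF fermat_error_product_cong] pint)
    have "?w - chi3 \<simeq> 0 (p^1)" using minus_3_power_h_cong by (simp only: cong_0_iff[of _ "(-3) ^ h"])
    from cong_mult_0[OF this this] have "(?w - chi3) * (?w - chi3) \<simeq> 0 (p^2)" by (simp add: numeral_2_eq_2)
    then have "- chi3 * ((?w - chi3) * (?w - chi3)) \<simeq> - chi3 * 0 (p^2)" by (rule cong_mult_left) (intro pint)
    \<comment> \<open>Since \<open>?w^2 = 3^(p-1)\<close> and \<open>chi3^2 = 1\<close>, completing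
      the square expresses the linear error of \<open>?w\<close> by the Fermat quotient of 3 up to
      an error of order \<open>p^2\<close>.\<close>
    moreover have "2 * (?w - chi3) - chi3 * (3 ^ (p - 1) - 1) = - chi3 * ((?w - chi3) * (?w - chi3))"
    proof -
      have "3 ^ (p - 1) = ?w * ?w" unfolding p_minus_1 by (simp add: power_mult flip: power_mult_distrib)
      then show ?thesis using chi3_parts(1) by (auto simp: algebra_simps)
    qed
    ultimately show "2 * (?w - chi3) \<simeq> chi3 * (3 ^ (p - 1) - 1) (p^2)" by (subst cong_0_iff) (simp only: mult_zero_right)
  qed
  also have "- 2 * 0 - chi3 * (3 ^ (p - 1) - 1) = P * - (chi3 * fermat_quotient p 3)"
    by (simp add: fermat_quotient_def)
  finally have "P * S \<simeq> P * - (chi3 * fermat_quotient p 3) (p^Suc 1)" by (simp add: numeral_2_eq_2)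
  then have "S \<simeq> - (chi3 * fermat_quotient p 3) (p^1)" by (simp only: cong_P_iff)
  with S show ?thesis by (rule cong_trans)
qed


lemma unit_p_central_choose: "i \<le> h \<Longrightarrow> unit_p (of_nat (2 * i choose i))"
proof (rule unit_p_of_nat)
  assume i: "i \<le> h"
  have "fact (2 * i) = fact i * fact i * (2 * i choose i)"
    using binomial_fact_lemma[of i "2 * i"] by simp
  then have "(2 * i choose i) dvd fact (2 * i)" by simp
  moreover have "\<not> p dvd fact (2 * i)" using i p_eq prime_p by (simp add: prime_dvd_fact_iff)
  ultimately show "\<not> p dvd (2 * i choose i)" using dvd_trans by blast
qed

text \<open>The coefficient is the product of \<open>(p + j) / j\<close> over
  \<open>1 <= j <= r\<close>, and each factor is 1 modulo \<open>p\<close>.\<close>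

lemma choose_p_cong: "r < p \<Longrightarrow> of_nat ((p + r) choose p) \<simeq> 1 (p^1)"
proof (induction r)
  case (Suc r)
  have u: "unit_p (of_nat (Suc r))" using Suc.prems by (intro unit_p_less) auto
  have "of_nat (Suc (p + r)) * of_nat ((p + r) choose p) = (of_nat (Suc (p + r)) - P) * of_nat (Suc (p + r) choose p)"
    by (rule of_nat_choose_Suc_left)
  then have "of_nat ((p + Suc r) choose p) = of_nat (Suc (p + r)) / of_nat (Suc r) * (of_nat ((p + r) choose p) :: rat)"
    by (simp add: field_simps del: binomial_Suc_Suc)
  also have "\<dots> \<simeq> of_nat (Suc (p + r)) / of_nat (Suc r) * 1 (p^1)"
    using Suc u by (intro cong_mult_left pint) auto
  also have "\<dots> \<simeq> 1 (p^1)"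
    using u by (intro cong_0_divide_I[of "1 / of_nat (Suc r)"] pint) (simp_all add: field_simps unit_p_def)
  finally show ?case .
qed simp

subsection \<open>Sums of \<open>g\<^sub>k / k\<close> and \<open>f\<^sub>k / k\<close>\<close>

definition alt_f_sum :: "nat \<Rightarrow> rat" where
  "alt_f_sum i = (\<Sum>k=1..p-1. (-1) ^ k * f_coeff k i / of_nat k)"

definition alt_f_harmonic_sum :: "nat \<Rightarrow> rat" where
  "alt_f_harmonic_sum i = (\<Sum>k=1..p-1. (-1) ^ k * f_coeff k i / of_nat k * harmonic k)"

lemma f_coeff_0_right: "k \<ge> 1 \<Longrightarrow> f_coeff k 0 = 0"
  by (auto simp: f_coeff_def)

lemma alt_f_sum_eq: "1 \<le> i \<Longrightarrow> alt_f_sum i = P * (of_nat (2 * i choose p) * (of_nat ((p - 1) choose i))\<^sup>2 / (of_nat i)\<^sup>2)"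
  unfolding alt_f_sum_def using alternating_f_coeff_sum[of i "p - 1"] p_gt_3 p_minus_1 by simp

text \<open>\<open>2 * i choose p\<close> is 0 in the lower half and 1 modulo \<open>p\<close> in
  the upper half. The factor \<open>P\<close> in front raises the precision to
  \<open>p^2\<close>.\<close>

lemma alt_f_sum_cong:
  assumes "i \<in> {1..p-1}"
  shows "alt_f_sum i \<simeq> P * (if i \<le> h then 0 else 1 / (of_nat i)\<^sup>2) (p^2)"
proof (cases "i \<le> h")
  case True
  then have "2 * i < p" using p_eq by simp
  then show ?thesis using True assms by (simp add: alt_f_sum_eq binomial_eq_0)
next
  case False
  define r where "r = 2 * i - p"
  have r: "2 * i = p + r" "r < p" using False assms p_eq by (auto simp: r_def)
  have u: "unit_p ((of_nat i)\<^sup>2)" using assms by (intro unit_p_power unit_p_range)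
  have "alt_f_sum i = P ^ 1 * (of_nat ((p + r) choose p) * (of_nat ((p - 1) choose i))\<^sup>2 / (of_nat i)\<^sup>2)"
    using assms r(1) by (simp add: alt_f_sum_eq)
  also have "\<dots> \<simeq> P ^ 1 * (1 * ((-1) ^ i)\<^sup>2 / (of_nat i)\<^sup>2) (p^2)"
    using assms r(2) u by (intro cong_scale[where m = 1] cong_divide cong_mult choose_p_cong cong_power cong_choose_pred' pint) auto
  finally show ?thesis using False by (simp flip: power_mult)
qed

text \<open>\<open>C(2i, k) C(k, i) = C(2i, i) C(i, k-i)\<close> exposes the central coefficient.
  This covers the indices above \<open>h\<close>, where the closed form of the harmonic sum does not
  apply because \<open>2 * i > p - 1\<close>.\<close>

lemma f_coeff_cong_0:
  assumes "h < i" "i < p" shows "f_coeff k i \<simeq> 0 (p^1)"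
proof (cases "i \<le> k \<and> k \<le> 2 * i")
  case True
  then have "f_coeff k i = of_nat (2 * i choose i) * of_nat ((i choose (k - i)) * (k choose i))"
    using choose_mult[of i k "2 * i"] by (simp add: f_coeff_def power2_eq_square flip: of_nat_mult) (simp add: mult_ac)
  also have "\<dots> \<simeq> 0 * of_nat ((i choose (k - i)) * (k choose i)) (p^1)"
    by (intro cong_mult central_choose_cong_0[OF assms] cong_refl pint)
  finally show ?thesis by simp
qed (auto simp: f_coeff_def binomial_eq_0)

lemma alt_f_harmonic_sum_cong:
  assumes "i \<in> {1..p-1}"
  shows "alt_f_harmonic_sum i \<simeq> (if i \<le> h then (of_nat (2 * i choose i) - 1) / (of_nat i)\<^sup>2 else 0) (p^1)"
proof (cases "i \<le> h")
  case True
  then show ?thesis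
    unfolding alt_f_harmonic_sum_def using assms p_minus_1
    by (subst alternating_f_coeff_harmonic_sum) auto
next
  case False
  have "alt_f_harmonic_sum i \<simeq> (\<Sum>k=1..p-1. (-1) ^ k * 0 / of_nat k * harmonic k) (p^1)"
    unfolding alt_f_harmonic_sum_def using assms False
    by (intro cong_sum cong_mult cong_divide f_coeff_cong_0 unit_p_range cong_refl pint) auto
  then show ?thesis using False by simp
qed

lemma Zp_alt_f_harmonic_sum [pint]: "Zp (alt_f_harmonic_sum i)"
  unfolding alt_f_harmonic_sum_def by (intro pint unit_p_range) auto

text \<open>The transform at \<open>N = p - 1\<close>: Wolstenholme removes the harmonic number, and
  \<open>C(p-1, k)\<close> becomes \<open>(-1)^k (1 - P H_k)\<close>, which separates the two
  alternating sums.\<close>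

lemma sum_g_coeff_div_cong: "(\<Sum>k=1..p-1. g_coeff k i / of_nat k) \<simeq> alt_f_sum i - P * alt_f_harmonic_sum i (p^2)"
proof -
  have "(\<Sum>k=1..p-1. g_coeff k i / of_nat k)
    = f_coeff 0 i * harmonic (p - 1) + (\<Sum>k=1..p-1. of_nat ((p - 1) choose k) * (f_coeff k i / of_nat k))"
    by (simp only: sum_g_coeff_over_index times_divide_eq_right)
  also have "\<dots> \<simeq> f_coeff 0 i * 0 + (\<Sum>k=1..p-1. (-1) ^ k * (1 - P * harmonic k) * (f_coeff k i / of_nat k)) (p^2)"
    by (intro cong_add cong_mult_left[OF harmonic_pred_cong_0] cong_sum cong_mult cong_choose_pred cong_refl pint unit_p_range) auto
  also have "\<dots> = alt_f_sum i - P * alt_f_harmonic_sum i"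
    unfolding alt_f_sum_def alt_f_harmonic_sum_def sum_distrib_left sum_subtractf[symmetric] mult_zero_right add_0_left
    by (intro sum.cong refl) (simp add: algebra_simps diff_divide_distrib)
  finally show ?thesis .
qed

theorem sum_g_coeff_div_cong_0: "(\<Sum>k=1..p-1. g_coeff k i / of_nat k) \<simeq> 0 (p^1)"
proof -
  have "alt_f_sum i \<simeq> 0 (p^1)"
  proof -
    consider "i = 0" | "i \<in> {1..p-1}" | "i \<ge> p" using p_gt_3 by fastforce
    then show ?thesis
    proof cases
      case 1
      then have "alt_f_sum i = 0" by (simp add: alt_f_sum_def f_coeff_0_right)
      then show ?thesis by simp
    next
      case 2
      have "alt_f_sum i \<simeq> P * (if i \<le> h then 0 else 1 / (of_nat i)\<^sup>2) (p^1)"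
        by (rule cong_mono[OF alt_f_sum_cong[OF 2]]) simp
      also have "\<dots> = P ^ 1 * (if i \<le> h then 0 else 1 / (of_nat i)\<^sup>2)" by simp
      also have "\<dots> \<simeq> 0 (p^1)" using 2 by (intro cong_0_I) (auto intro!: pint unit_p_power unit_p_range)
      finally show ?thesis .
    next
      case 3
      then have "alt_f_sum i = 0" unfolding alt_f_sum_def using p_gt_3 by (intro sum.neutral) (auto simp: f_coeff_eq_0)
      then show ?thesis by simp
    qed
  qed
  moreover have "P ^ 1 * alt_f_harmonic_sum i \<simeq> 0 (p^1)" by (intro cong_0_I pint)
  ultimately have "alt_f_sum i - P ^ 1 * alt_f_harmonic_sum i \<simeq> 0 - 0 (p^1)" by (rule cong_diff)
  then have "alt_f_sum i - P * alt_f_harmonic_sum i \<simeq> 0 (p^1)" by simp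
  with cong_mono[OF sum_g_coeff_div_cong] show ?thesis by (rule cong_trans) simp
qed

text \<open>Over all \<open>k\<close> from 0 to \<open>p - 1\<close> the squares of
  \<open>k choose j\<close> sum to 0 modulo \<open>p\<close>, because the closed form is
  \<open>P / (2 j + 1)\<close> times an integral number and \<open>C(2j, j)\<close> is a unit. The
  shift of \<open>k\<close> loses the last square, that of \<open>C(p-1, j)\<close>, which is
  1.\<close>

lemma sum_shifted_choose_square_cong:
  assumes "j < h" shows "(\<Sum>k=1..p-1. (of_nat ((k - 1) choose j))\<^sup>2) \<simeq> - 1 (p^1)"
proof -
  have j: "j < p" "j \<noteq> h" using assms h_less by auto
  have "(\<Sum>k=0..p-1. (1 - P\<^sup>2 * harmonic2 k) * g_coeff k j) \<simeq> P / of_nat (2 * j + 1) * (1 - 2 * P\<^sup>2 * harmonic2 j) (p^1)"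
    by (rule cong_mono[OF weighted_g_coeff_sum_cong[OF j(1)]]) simp
  also have "\<dots> \<simeq> 0 (p^1)"
    using j unit_p_odd[OF j] by (intro cong_0_divide_I[of "1 / of_nat (2 * j + 1) * (1 - 2 * P\<^sup>2 * harmonic2 j)"] pint) auto
  finally have 1: "(\<Sum>k=0..p-1. (1 - P\<^sup>2 * harmonic2 k) * g_coeff k j) \<simeq> 0 (p^1)" .
  have "(\<Sum>k=0..p-1. g_coeff k j) = (\<Sum>k=0..p-1. (1 - P\<^sup>2 * harmonic2 k) * g_coeff k j) + P ^ 1 * (P * (\<Sum>k=0..p-1. g_coeff k j * harmonic2 k))"
    unfolding sum_weighted_split by (simp add: power2_eq_square)
  also have "\<dots> \<simeq> 0 + 0 (p^1)" using p_gt_3 by (intro cong_add 1 cong_0_I pint) auto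
  also have "(\<Sum>k=0..p-1. g_coeff k j) = of_nat (2 * j choose j) * (\<Sum>k=0..p-1. (of_nat (k choose j))\<^sup>2)"
    unfolding sum_distrib_left by (intro sum.cong refl) (simp add: g_coeff_def)
  finally have "of_nat (2 * j choose j) * (\<Sum>k=0..p-1. (of_nat (k choose j))\<^sup>2) \<simeq> of_nat (2 * j choose j) * 0 (p^1)" by simp
  then have 2: "(\<Sum>k=0..p-1. (of_nat (k choose j))\<^sup>2) \<simeq> 0 (p^1)"
    using assms by (elim cong_cancel) (intro unit_p_central_choose; simp)
  have "(\<Sum>k=0..p-1. (of_nat (k choose j))\<^sup>2) = (\<Sum>k=1..p-1. (of_nat ((k - 1) choose j))\<^sup>2) + ((of_nat ((p - 1) choose j))\<^sup>2 :: rat)"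
  proof -
    have "p - 1 = Suc (p - 2)" using p_gt_3 by simp
    then have "(\<Sum>k=0..p-1. (of_nat (k choose j))\<^sup>2) = (\<Sum>k=0..p-2. (of_nat (k choose j))\<^sup>2) + ((of_nat ((p - 1) choose j))\<^sup>2 :: rat)"
      by (simp only: sum.atLeast0_atMost_Suc)
    also have "(\<Sum>k=0..p-2. (of_nat (k choose j))\<^sup>2 :: rat) = (\<Sum>k=1..p-1. (of_nat ((k - 1) choose j))\<^sup>2)"
      using p_gt_3 by (intro sum.reindex_bij_witness[of _ "\<lambda>k. k - 1" Suc]) auto
    finally show ?thesis .
  qed
  then have "(\<Sum>k=1..p-1. (of_nat ((k - 1) choose j))\<^sup>2) = (\<Sum>k=0..p-1. (of_nat (k choose j))\<^sup>2) - ((of_nat ((p - 1) choose j))\<^sup>2 :: rat)"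
    by simp
  also have "\<dots> \<simeq> 0 - ((-1) ^ j)\<^sup>2 (p^1)"
    using j by (intro cong_diff 2 cong_power cong_choose_pred' pint)
  finally show ?thesis by (simp flip: power_mult)
qed

lemma choose_absorb: "k \<ge> 1 \<Longrightarrow> i \<ge> 1 \<Longrightarrow> (of_nat (k choose i) :: rat) = of_nat k / of_nat i * of_nat ((k - 1) choose (i - 1))"
  using of_nat_choose_Suc_Suc[of "k - 1" "i - 1"] by simp

text \<open>Square \<open>C(k-1, i+1) = C(k, i+1) - C(k-1, i)\<close> and divide by
  \<open>k\<close>. The first square sums to 0 by \<open>sum_g_coeff_div_cong_0\<close>, the second
  is the induction hypothesis, and the mixed term is \<open>-2 / (i+1)\<close> times the sum of
  squares just found to be -1.\<close>

lemma sum_pred_choose_square_div_cong: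
  "i \<le> h \<Longrightarrow> (\<Sum>k=1..p-1. (of_nat ((k - 1) choose i))\<^sup>2 / of_nat k) \<simeq> 2 * harmonic i (p^1)"
proof (induction i)
  case 0
  have "harmonic (p - 1) \<simeq> 0 (p^1)" by (rule cong_mono[OF harmonic_pred_cong_0]) simp
  then show ?case by (simp add: harmonic_def)
next
  case (Suc i)
  have u: "unit_p (of_nat (Suc i))" using Suc.prems h_less by (intro unit_p_less) auto
  have G: "(\<Sum>k=1..p-1. (of_nat (k choose Suc i))\<^sup>2 / of_nat k) \<simeq> 0 (p^1)"
  proof -
    have "(\<Sum>k=1..p-1. g_coeff k (Suc i) / of_nat k) = of_nat (2 * Suc i choose Suc i) * (\<Sum>k=1..p-1. (of_nat (k choose Suc i))\<^sup>2 / of_nat k)"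
      unfolding sum_distrib_left g_coeff_def by (intro sum.cong refl) (simp del: binomial_Suc_Suc mult_Suc_right)
    then have "of_nat (2 * Suc i choose Suc i) * (\<Sum>k=1..p-1. (of_nat (k choose Suc i))\<^sup>2 / of_nat k) \<simeq> of_nat (2 * Suc i choose Suc i) * 0 (p^1)"
      using sum_g_coeff_div_cong_0[of "Suc i"] by simp
    then show ?thesis by (rule cong_cancel) (rule unit_p_central_choose[OF Suc.prems])
  qed
  have "(\<Sum>k=1..p-1. (of_nat ((k - 1) choose Suc i))\<^sup>2 / of_nat k)
    = (\<Sum>k=1..p-1. (of_nat ((k - 1) choose i))\<^sup>2 / of_nat k) + (\<Sum>k=1..p-1. (of_nat (k choose Suc i))\<^sup>2 / of_nat k)
      - 2 / of_nat (Suc i) * (\<Sum>k=1..p-1. (of_nat ((k - 1) choose i))\<^sup>2 :: rat)"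
    unfolding sum_distrib_left sum.distrib[symmetric] sum_subtractf[symmetric]
  proof (intro sum.cong refl)
    fix k assume "k \<in> {1..p-1}"
    then obtain l where k: "k = Suc l" by (cases k) auto
    define a b where "a = (of_nat (l choose i) :: rat)" and "b = (of_nat (k choose Suc i) :: rat)"
    have "b = of_nat k / of_nat (Suc i) * a"
      unfolding a_def b_def k by (rule of_nat_choose_Suc_Suc)
    then have "a * b / of_nat k = a\<^sup>2 / of_nat (Suc i)" using k by (simp add: power2_eq_square del: of_nat_Suc)
    moreover have "(of_nat (l choose Suc i) :: rat) = b - a" unfolding a_def b_def k by simp
    moreover have "(b - a)\<^sup>2 / of_nat k = a\<^sup>2 / of_nat k + b\<^sup>2 / of_nat k - 2 * (a * b / of_nat k)"
      by (simp add: power2_diff diff_divide_distrib add_divide_distrib mult_ac)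
    ultimately show "(of_nat ((k - 1) choose Suc i) :: rat)\<^sup>2 / of_nat k
      = (of_nat ((k - 1) choose i))\<^sup>2 / of_nat k + (of_nat (k choose Suc i))\<^sup>2 / of_nat k - 2 / of_nat (Suc i) * (of_nat ((k - 1) choose i))\<^sup>2"
      unfolding a_def[symmetric] b_def[symmetric] k diff_Suc_1 by (simp add: a_def b_def k del: of_nat_Suc binomial_Suc_Suc)
  qed
  also have "\<dots> \<simeq> 2 * harmonic i + 0 - 2 / of_nat (Suc i) * - 1 (p^1)"
    using Suc u by (intro cong_diff cong_add cong_mult_left[OF sum_shifted_choose_square_cong] G pint) auto
  finally show ?case by (simp add: algebra_simps)
qed

theorem sum_g_num_pred_div_cong:
  "(\<Sum>k=1..p-1. g_num (k - 1) / of_nat k) \<simeq> - (chi3 * 2 * fermat_quotient p 3) (p^1)"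
proof -
  define T :: "nat \<Rightarrow> rat" where "T i = (\<Sum>k=1..p-1. (of_nat ((k - 1) choose i))\<^sup>2 / of_nat k)" for i
  have "(\<Sum>k=1..p-1. g_num (k - 1) / of_nat k) = (\<Sum>k=1..p-1. \<Sum>i=0..p-1. of_nat (2 * i choose i) * ((of_nat ((k - 1) choose i))\<^sup>2 / of_nat k))"
  proof (intro sum.cong refl)
    fix k assume k: "k \<in> {1..p-1}"
    have "g_num (k - 1) = (\<Sum>i=0..p-1. g_coeff (k - 1) i)"
      using poly_g_poly_less_p[of "k - 1" 1] k by (auto simp: g_num_def)
    then show "g_num (k - 1) / of_nat k = (\<Sum>i=0..p-1. of_nat (2 * i choose i) * ((of_nat ((k - 1) choose i))\<^sup>2 / of_nat k))"
      by (simp add: g_coeff_def sum_divide_distrib mult.commute)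
  qed
  also have "\<dots> = (\<Sum>i=0..p-1. of_nat (2 * i choose i) * T i)"
    unfolding T_def sum_distrib_left by (rule sum.swap)
  also have "\<dots> \<simeq> (\<Sum>i=0..p-1. if i \<le> h then of_nat (2 * i choose i) * (2 * harmonic i) else 0) (p^1)"
  proof (intro cong_sum)
    fix i assume i: "i \<in> {0..p-1}"
    show "of_nat (2 * i choose i) * T i \<simeq> (if i \<le> h then of_nat (2 * i choose i) * (2 * harmonic i) else 0) (p^1)"
    proof (cases "i \<le> h")
      case True
      then have "of_nat (2 * i choose i) * T i \<simeq> of_nat (2 * i choose i) * (2 * harmonic i) (p^1)"
        unfolding T_def by (intro cong_mult_left sum_pred_choose_square_div_cong pint)
      then show ?thesis using True by simp
    next
      case False
      have "Zp (T i)" unfolding T_def by (intro pint unit_p_range)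
      then have "of_nat (2 * i choose i) * T i \<simeq> 0 * T i (p^1)"
        using False i p_gt_3 by (intro cong_mult central_choose_cong_0 cong_refl pint) auto
      then show ?thesis using False by simp
    qed
  qed
  also have "(\<Sum>i=0..p-1. if i \<le> h then of_nat (2 * i choose i) * (2 * harmonic i) else 0)
      = (\<Sum>i\<le>h. 2 * (of_nat (2 * i choose i) * harmonic i))"
    using h_less by (intro sum.mono_neutral_cong_right) auto
  also have "\<dots> \<simeq> 2 * - (chi3 * fermat_quotient p 3) (p^1)"
    unfolding sum_distrib_left[symmetric] by (intro cong_mult_left sum_central_choose_harmonic_cong pint)
  finally show ?thesis by (simp add: mult_ac)
qed

section \<open>Apery's identity modulo \<open>p\<close> and the sums at
  \<open>x = -1\<close>\<close>

text \<open>Modulo \<open>p\<close> the product does not depend on \<open>j\<close>: for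
  \<open>i + 1 = p - j\<close> the ratios of consecutive central coefficients match, because
  \<open>j (2 i + 1)\<close> and \<open>(2 j + 1) (i + 1)\<close> agree modulo \<open>p\<close>. The
  value -2 is that at \<open>j = 1\<close>.\<close>

lemma central_choose_reflect_cong:
  assumes "1 \<le> j" "j \<le> h"
  shows "of_nat (2 * (p - j) choose (p - j)) / P * (of_nat j * of_nat (2 * j choose j)) \<simeq> - 2 (p^1)"
  using assms
proof (induction j rule: nat_induct_at_least)
  case base
  define n where "n = p - 2"
  have n: "p - 1 = Suc n" "2 * (p - 1) = Suc (p + n - 1)" "p = Suc (Suc n)" "2 * (p - 1) = p + n" "n < p"
    using p_gt_3 by (auto simp: n_def)
  have "P * (of_nat (2 * (p - 1) choose p) :: rat) = of_nat (p - 1) * of_nat (2 * (p - 1) choose (p - 1))"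
    using of_nat_choose_Suc_right[of "p - 1" "2 * (p - 1)"] p_gt_3 by (simp add: of_nat_diff)
  then have "of_nat (2 * (p - 1) choose (p - 1)) / P = of_nat ((p + n) choose p) / (of_nat (p - 1) :: rat)"
    using p_gt_3 n(4) by (simp add: field_simps)
  also have "\<dots> \<simeq> 1 / of_nat (p - 1) (p^1)"
    using n p_gt_3 by (intro cong_divide choose_p_cong unit_p_less) auto
  also have "1 / of_nat (p - 1) = 1 / (P - 1)" using p_gt_3 by (simp add: of_nat_diff)
  also have "\<dots> \<simeq> - (1 / 1) (p^1)" by (rule reflect_inverse_cong[OF unit_p_1])
  finally have "of_nat (2 * (p - 1) choose (p - 1)) / P * 2 \<simeq> - 1 * 2 (p^1)"
    by (intro cong_mult cong_refl pint) auto
  then show ?case by simp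
next
  case (Suc j)
  define i where "i = p - Suc j"
  have i: "p - j = Suc i" "of_nat (2 * i + 1) = 2 * P - of_nat (2 * j + 1)" "of_nat (Suc i) = P - of_nat j" "h < i" "i < p"
    using Suc.prems h_less p_eq by (auto simp: i_def of_nat_diff)
  have uo: "unit_p (of_nat (2 * i + 1))" using i by (intro unit_p_odd) auto
  have uj: "unit_p (of_nat (2 * j + 1))" using Suc.prems p_eq by (intro unit_p_less) auto
  have Zc: "Zp (of_nat (2 * i choose i) / P)"
    using central_choose_cong_0[OF i(4,5)] by (simp add: pcong_def)
  define c where "c = of_nat (2 * i choose i) / P"
  have e1: "of_nat (2 * (p - j) choose (p - j)) / P = 2 * of_nat (2 * i + 1) / of_nat (Suc i) * c"
    unfolding i(1) central_binomial_Suc c_def by simp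
  have e2: "of_nat (Suc j) * of_nat (2 * Suc j choose Suc j) = 2 * of_nat (2 * j + 1) * (of_nat (2 * j choose j) :: rat)"
    unfolding central_binomial_Suc by (simp del: of_nat_Suc)
  have ui: "unit_p (of_nat (Suc i))"
  proof (rule unit_p_less)
    show "Suc i < p" using i(1)[symmetric] Suc.hyps Suc.prems p_gt_3 by simp
  qed simp
  have IH: "2 * of_nat (2 * i + 1) / of_nat (Suc i) * c * (of_nat j * of_nat (2 * j choose j)) \<simeq> - 2 (p^1)"
    using Suc.IH Suc.prems unfolding e1 by simp
  have "of_nat j * of_nat (2 * i + 1) - of_nat (2 * j + 1) * of_nat (Suc i) = P ^ 1 * (2 * of_nat j - of_nat (2 * j + 1))"
    unfolding i by (simp add: algebra_simps)
  then have "of_nat j * of_nat (2 * i + 1) \<simeq> of_nat (2 * j + 1) * of_nat (Suc i) (p^1)"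
    by (intro cong_0_divide_I[of "2 * of_nat j - of_nat (2 * j + 1)"] pint)
  then have "2 / of_nat (Suc i) * c * of_nat (2 * j choose j) * (of_nat j * of_nat (2 * i + 1))
      \<simeq> 2 / of_nat (Suc i) * c * of_nat (2 * j choose j) * (of_nat (2 * j + 1) * of_nat (Suc i)) (p^1)"
    using ui Zc[folded c_def] by (intro cong_mult_left pint)
  also have "2 / of_nat (Suc i) * c * of_nat (2 * j choose j) * (of_nat (2 * j + 1) * of_nat (Suc i))
      = c * (2 * of_nat (2 * j + 1) * of_nat (2 * j choose j))"
    by (simp del: of_nat_Suc)
  finally have "2 * of_nat (2 * i + 1) / of_nat (Suc i) * c * (of_nat j * of_nat (2 * j choose j))
      \<simeq> c * (2 * of_nat (2 * j + 1) * of_nat (2 * j choose j)) (p^1)"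
    by (simp add: mult_ac del: of_nat_Suc)
  from cong_trans[OF cong_sym[OF this] IH] show ?case
    unfolding e2 c_def i_def .
qed

definition central_half_sum :: rat where
  "central_half_sum = (\<Sum>i=1..h. (-1) ^ i * of_nat (2 * i choose i) / (of_nat i)\<^sup>2)"

text \<open>\<open>C(p-1+k, k)\<close> is \<open>P / k\<close> times \<open>C(p+k-1, p)\<close>, a
  unit congruent to 1. So \<open>P\<close> cancels the single \<open>p\<close> in each denominator
  of the second sum, leaving \<open>-1 / k^2\<close>, while it annihilates the first sum modulo
  \<open>p\<close>.\<close>

lemma apery_left_cong: "P * ((\<Sum>k=1..p-1. 1 / (of_nat k) ^ 3)
    + (\<Sum>k=1..p-1. (-1) ^ Suc k / (of_nat k ^ 3 * of_nat ((p - 1) choose k) * of_nat ((p - 1 + k) choose k))) / 2) \<simeq> 0 (p^1)"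
proof -
  have t: "P * ((-1) ^ Suc k / (of_nat k ^ 3 * of_nat ((p - 1) choose k) * of_nat ((p - 1 + k) choose k))) \<simeq> - (1 / of_nat k ^ 2) (p^1)"
    if k: "k \<in> {1..p-1}" for k
  proof -
    obtain r where r: "k = Suc r" "r < p" using k by (cases k) auto
    have u: "unit_p (of_nat k)" using k by (rule unit_p_range)
    have "(p - 1 + k) = Suc (p - 1 + r)" using r by simp
    then have "(of_nat ((p - 1 + k) choose k) :: rat) = of_nat (p - 1 + k) / of_nat k * of_nat ((p - 1 + r) choose r)"
      unfolding r(1) using of_nat_choose_Suc_Suc[of "p - 1 + r" r] by simp
    also have "of_nat (p - 1 + k) / of_nat k * (of_nat ((p - 1 + r) choose r) :: rat) = P / of_nat k * of_nat ((p + r) choose p)"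
    proof -
      have "p + r = Suc (p - 1 + r)" "p = Suc (p - 1)" using p_gt_3 by auto
      then have "(of_nat ((p + r) choose p) :: rat) = of_nat (p + r) / P * of_nat ((p - 1 + r) choose (p - 1))"
        using of_nat_choose_Suc_Suc[of "p - 1 + r" "p - 1"] by simp
      moreover have "(p - 1 + r) choose (p - 1) = (p - 1 + r) choose r"
        using binomial_symmetric[of r "p - 1 + r"] by simp
      moreover have "p - 1 + k = p + r" using r p_gt_3 by simp
      ultimately show ?thesis by simp
    qed
    finally have c: "(of_nat ((p - 1 + k) choose k) :: rat) = P / of_nat k * of_nat ((p + r) choose p)" .
    have c1: "of_nat ((p + r) choose p) \<simeq> 1 (p^1)" using r by (intro choose_p_cong)
    have c2: "of_nat ((p - 1) choose k) \<simeq> (-1) ^ k (p^1)" using k p_gt_3 by (intro cong_choose_pred') auto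
    have s: "unit_p ((-1) ^ k)" by (intro unit_p_power unit_p_uminus unit_p_1)
    have u1: "unit_p (of_nat ((p + r) choose p))" using unit_p_cong[OF unit_p_1 c1] .
    have u2: "unit_p (of_nat ((p - 1) choose k))" using unit_p_cong[OF s c2] .
    have "P * ((-1) ^ Suc k / (of_nat k ^ 3 * of_nat ((p - 1) choose k) * of_nat ((p - 1 + k) choose k)))
      = (-1) ^ Suc k / of_nat k ^ 2 * (1 / (of_nat ((p - 1) choose k) * of_nat ((p + r) choose p)))"
      unfolding c using unit_pD(2)[OF u] unit_pD(2)[OF u1] unit_pD(2)[OF u2]
      by (simp add: field_simps power2_eq_square power3_eq_cube)
    also have "\<dots> \<simeq> (-1) ^ Suc k / of_nat k ^ 2 * (1 / ((-1) ^ k * 1)) (p^1)"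
      using c1 c2 s u u1 u2 unit_pD
      by (intro cong_mult_left cong_inverse cong_mult unit_p_mult unit_p_power unit_p_uminus unit_p_1 pint) auto
    also have "\<dots> = - (1 / of_nat k ^ 2)" by simp
    finally show ?thesis .
  qed
  have "P * ((\<Sum>k=1..p-1. 1 / (of_nat k) ^ 3)
    + (\<Sum>k=1..p-1. (-1) ^ Suc k / (of_nat k ^ 3 * of_nat ((p - 1) choose k) * of_nat ((p - 1 + k) choose k))) / 2)
    = P ^ 1 * (\<Sum>k=1..p-1. 1 / (of_nat k) ^ 3)
    + (\<Sum>k=1..p-1. P * ((-1) ^ Suc k / (of_nat k ^ 3 * of_nat ((p - 1) choose k) * of_nat ((p - 1 + k) choose k)))) / 2"
    by (simp only: sum_distrib_left[symmetric]) (simp only: distrib_left times_divide_eq_right power_one_right)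
  also have "\<dots> \<simeq> 0 + (\<Sum>k=1..p-1. - (1 / of_nat k ^ 2)) / 2 (p^1)"
    by (intro cong_add cong_divide cong_sum t cong_0_I unit_p_numeral pint unit_p_power unit_p_range)
  also have "\<dots> = - (1 / 2) * harmonic2 (p - 1)"
    by (simp add: harmonic2_def sum_negf)
  also have "\<dots> \<simeq> - (1 / 2) * 0 (p^1)"
    by (intro cong_mult_left harmonic2_pred_cong_0 pint unit_p_numeral)
  finally show ?thesis by simp
qed

text \<open>Terms with \<open>k <= h\<close> are integral and die after multiplication by
  \<open>P\<close>. In the terms at \<open>p - k\<close> the central coefficient contains
  \<open>p\<close>, and the reflection formula moves it, inverted, into the numerator. The sign is
  \<open>(-1)^k\<close> since \<open>p\<close> is odd.\<close>

lemma apery_right_cong: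
  "P * (\<Sum>k=1..p-1. (-1) ^ Suc k / (of_nat k ^ 3 * of_nat (2 * k choose k))) \<simeq> 1 / 2 * central_half_sum (p^1)"
proof -
  have "P * (\<Sum>k=1..p-1. (-1) ^ Suc k / (of_nat k ^ 3 * of_nat (2 * k choose k)))
    = (\<Sum>k=1..h. P ^ 1 * ((-1) ^ Suc k / (of_nat k ^ 3 * of_nat (2 * k choose k)))
       + (-1) ^ Suc (p - k) / (of_nat (p - k) ^ 3 * (of_nat (2 * (p - k) choose (p - k)) / P)))"
    unfolding sum_p_halves sum_distrib_left by (intro sum.cong refl) (simp add: algebra_simps)
  also have "\<dots> \<simeq> (\<Sum>k=1..h. 0 + 1 / 2 * ((-1) ^ k * of_nat (2 * k choose k) / (of_nat k)\<^sup>2)) (p^1)"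
  proof (intro cong_sum cong_add cong_0_I)
    fix k assume k: "k \<in> {1..h}"
    have u: "unit_p (of_nat k)" "unit_p (of_nat (2 * k choose k))"
      using k unit_p_half_range unit_p_central_choose by auto
    then show "Zp ((-1) ^ Suc k / (of_nat k ^ 3 * of_nat (2 * k choose k)))"
      by (intro Zp_divide unit_p_mult unit_p_power pint)
    define c x C where "c = of_nat (2 * (p - k) choose (p - k)) / P" and "x = (of_nat k :: rat)" and "C = (of_nat (2 * k choose k) :: rat)"
    have ux: "unit_p x" "unit_p C" using u by (auto simp: x_def C_def)
    have "c * (x * C) \<simeq> - 2 (p^1)"
      unfolding c_def x_def C_def using k by (intro central_choose_reflect_cong) auto
    then have "c * (x * C) / (x * C) \<simeq> - 2 / (x * C) (p^1)" using ux by (intro cong_divide unit_p_mult)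
    then have c: "c \<simeq> - 2 / (x * C) (p^1)" using ux unit_pD by simp
    have u2: "unit_p (- 2 / (x * C))" using ux by (intro unit_p_divide unit_p_uminus unit_p_mult unit_p_numeral)
    have uc: "unit_p c" using unit_p_cong[OF u2 c] .
    have px: "P - x \<simeq> - x (p^1)" by (rule cong_0_divide_I[of 1]) simp_all
    have upx: "unit_p (P - x)" using ux by (intro unit_p_P_minus)
    have sgn: "(-1) ^ Suc (p - k) = ((-1) ^ k :: rat)"
      using k h_less odd_p by (simp add: minus_one_power_iff)
    have "of_nat (p - k) = P - x" unfolding x_def using k h_less by (intro of_nat_p_minus) auto
    then have "(-1) ^ k / (of_nat (p - k) ^ 3 * c) = (-1) ^ k * (1 / ((P - x) ^ 3 * c))" by simp
    also have "\<dots> \<simeq> (-1) ^ k * (1 / ((- x) ^ 3 * (- 2 / (x * C)))) (p^1)"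
      using ux upx uc u2 c px
      by (intro cong_mult_left cong_inverse cong_mult cong_power unit_p_mult unit_p_power unit_p_uminus Zp_power Zp_uminus unit_pD(1)) (auto intro: pint unit_p_1)
    also have "(-1) ^ k * (1 / ((- x) ^ 3 * (- 2 / (x * C)))) = 1 / 2 * ((-1) ^ k * C / x\<^sup>2)"
      using unit_pD(2)[OF ux(1)] unit_pD(2)[OF ux(2)] by (simp add: field_simps power2_eq_square power3_eq_cube)
    finally show "(-1) ^ Suc (p - k) / (of_nat (p - k) ^ 3 * (of_nat (2 * (p - k) choose (p - k)) / P))
       \<simeq> 1 / 2 * ((-1) ^ k * of_nat (2 * k choose k) / (of_nat k)\<^sup>2) (p^1)"
      unfolding sgn c_def x_def C_def .
  qed
  also have "\<dots> = 1 / 2 * central_half_sum"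
    by (simp only: central_half_sum_def sum_distrib_left add_0_left)
  finally show ?thesis .
qed

lemma central_half_sum_cong_0:
  assumes "p > 5" shows "central_half_sum \<simeq> 0 (p^1)"
proof -
  have "5 / 2 * (P * (\<Sum>k=1..p-1. (-1) ^ Suc k / (of_nat k ^ 3 * of_nat (2 * k choose k)))) \<simeq> 5 / 2 * (1 / 2 * central_half_sum) (p^1)"
    by (intro cong_mult_left apery_right_cong pint unit_p_numeral)
  moreover have "5 / 2 * (P * (\<Sum>k=1..p-1. (-1) ^ Suc k / (of_nat k ^ 3 * of_nat (2 * k choose k)))) \<simeq> 0 (p^1)"
    using apery_left_cong unfolding apery_identity by (simp add: mult_ac)
  ultimately have "5 / 2 * (1 / 2 * central_half_sum) \<simeq> 0 (p^1)" by (rule cong_trans[OF cong_sym])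
  then have "5 / 4 * central_half_sum \<simeq> 5 / 4 * 0 (p^1)" by simp
  moreover have "unit_p 5" using unit_p_less[of 5] assms by simp
  ultimately show ?thesis by (elim cong_cancel) (intro unit_p_divide unit_p_numeral)
qed

lemma sum_minus_1_coeff_swap:
  "(\<Sum>k=1..p-1. (\<Sum>i\<le>k. a k i * (-1) ^ i) * w k) = (\<Sum>i=0..p-1. (-1) ^ i * (\<Sum>k=1..p-1. a k i * w k) :: rat)"
  if "\<And>k i. k < i \<Longrightarrow> a k i = 0" for a :: "nat \<Rightarrow> nat \<Rightarrow> rat"
proof -
  have "(\<Sum>k=1..p-1. (\<Sum>i\<le>k. a k i * (-1) ^ i) * w k) = (\<Sum>k=1..p-1. \<Sum>i=0..p-1. (-1) ^ i * (a k i * w k))"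
  proof (intro sum.cong refl)
    fix k assume "k \<in> {1..p-1}"
    then have "(\<Sum>i\<le>k. a k i * (-1) ^ i) = (\<Sum>i=0..p-1. a k i * (-1) ^ i)"
      using that by (intro sum.mono_neutral_left) auto
    then show "(\<Sum>i\<le>k. a k i * (-1) ^ i) * w k = (\<Sum>i=0..p-1. (-1) ^ i * (a k i * w k))"
      by (simp add: sum_distrib_left sum_distrib_right mult_ac)
  qed
  then show ?thesis unfolding sum_distrib_left by (subst (asm) sum.swap)
qed

text \<open>Absorption replaces \<open>C(k, i) / k\<close> by \<open>C(k-1, i-1) / i\<close>, so the
  squares in \<open>g_coeff\<close> cancel \<open>1 / k^2\<close> and the inner sums are known to be
  -1. What remains is \<open>- central_half_sum\<close>.\<close>

theorem sum_g_minus_1_div_square_cong: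
  assumes "p > 5" shows "(\<Sum>k=1..p-1. poly (g_poly k) (-1) / (of_nat k)\<^sup>2) \<simeq> 0 (p^1)"
proof -
  have c: "(\<Sum>k=1..p-1. g_coeff k i * (1 / (of_nat k)\<^sup>2)) \<simeq> (if i \<in> {1..h} then - (of_nat (2 * i choose i) / (of_nat i)\<^sup>2) else 0) (p^1)"
    if i: "i \<in> {0..p-1}" for i
  proof (cases "i = 0")
    case True
    then show ?thesis using harmonic2_pred_cong_0 by (simp add: g_coeff_def harmonic2_def)
  next
    case False
    have u: "unit_p ((of_nat i)\<^sup>2)" using i False by (intro unit_p_power unit_p_range) auto
    define q where "q = (\<Sum>k=1..p-1. (of_nat ((k - 1) choose (i - 1)))\<^sup>2 :: rat)"
    have e: "(\<Sum>k=1..p-1. g_coeff k i * (1 / (of_nat k)\<^sup>2)) = of_nat (2 * i choose i) / (of_nat i)\<^sup>2 * q"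
      unfolding q_def sum_distrib_left
    proof (intro sum.cong refl)
      fix k assume "k \<in> {1..p-1}"
      then show "g_coeff k i * (1 / (of_nat k)\<^sup>2) = of_nat (2 * i choose i) / (of_nat i)\<^sup>2 * (of_nat ((k - 1) choose (i - 1)))\<^sup>2"
        using False by (simp add: g_coeff_def choose_absorb[of k i] power_mult_distrib power_divide)
    qed
    show ?thesis
    proof (cases "i \<le> h")
      case True
      have "q \<simeq> - 1 (p^1)" unfolding q_def using True False by (intro sum_shifted_choose_square_cong) auto
      then have "of_nat (2 * i choose i) / (of_nat i)\<^sup>2 * q \<simeq> of_nat (2 * i choose i) / (of_nat i)\<^sup>2 * - 1 (p^1)"
        using u by (intro cong_mult_left pint)
      then show ?thesis unfolding e using True False by simp
    next
      case h: False
      have "Zp q" unfolding q_def by (intro pint)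
      then have "of_nat (2 * i choose i) / (of_nat i)\<^sup>2 * q \<simeq> 0 / (of_nat i)\<^sup>2 * q (p^1)"
        using u h i p_gt_3 by (intro cong_mult cong_divide central_choose_cong_0 cong_refl pint) auto
      then show ?thesis unfolding e using h by simp
    qed
  qed
  have "(\<Sum>k=1..p-1. poly (g_poly k) (-1) / (of_nat k)\<^sup>2) = (\<Sum>i=0..p-1. (-1) ^ i * (\<Sum>k=1..p-1. g_coeff k i * (1 / (of_nat k)\<^sup>2)))"
    using sum_minus_1_coeff_swap[of g_coeff "\<lambda>k. 1 / (of_nat k)\<^sup>2"] g_coeff_eq_0 by (simp add: poly_g_poly)
  also have "\<dots> \<simeq> (\<Sum>i=0..p-1. (-1) ^ i * (if i \<in> {1..h} then - (of_nat (2 * i choose i) / (of_nat i)\<^sup>2) else 0)) (p^1)"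
    by (intro cong_sum cong_mult_left c pint)
  also have "\<dots> = (\<Sum>i=1..h. - ((-1) ^ i * of_nat (2 * i choose i) / (of_nat i)\<^sup>2))"
    using h_less by (intro sum.mono_neutral_cong_right) auto
  also have "\<dots> = - central_half_sum" by (simp add: central_half_sum_def sum_negf)
  also have "\<dots> \<simeq> - 0 (p^1)" by (intro cong_uminus central_half_sum_cong_0 assms)
  finally show ?thesis by simp
qed

text \<open>The closed form of each coefficient has the numerator \<open>C(2i, i) - 1\<close>; its
  first part sums to \<open>central_half_sum\<close>, which vanishes modulo
  \<open>p\<close>.\<close>

lemma sum_alt_f_harmonic_cong:
  assumes "p > 5" shows "(\<Sum>i=0..p-1. (-1) ^ i * alt_f_harmonic_sum i) \<simeq> - alternating_half_sum (p^1)"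
proof -
  have 0: "alt_f_harmonic_sum 0 = 0" by (simp add: alt_f_harmonic_sum_def f_coeff_0_right)
  have "(\<Sum>i=0..p-1. (-1) ^ i * alt_f_harmonic_sum i)
    \<simeq> (\<Sum>i=0..p-1. (-1) ^ i * (if i \<in> {1..h} then (of_nat (2 * i choose i) - 1) / (of_nat i)\<^sup>2 else 0)) (p^1)"
  proof (intro cong_sum cong_mult_left pint)
    fix i assume "i \<in> {0..p-1}"
    then show "alt_f_harmonic_sum i \<simeq> (if i \<in> {1..h} then (of_nat (2 * i choose i) - 1) / (of_nat i)\<^sup>2 else 0) (p^1)"
      using alt_f_harmonic_sum_cong[of i] 0 by (cases "i = 0") auto
  qed
  also have "\<dots> = (\<Sum>i=1..h. (-1) ^ i * of_nat (2 * i choose i) / (of_nat i)\<^sup>2 - (-1) ^ i / (of_nat i)\<^sup>2)"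
    using h_less by (intro sum.mono_neutral_cong_right) (auto simp: right_diff_distrib diff_divide_distrib)
  also have "\<dots> = central_half_sum - alternating_half_sum"
    by (simp add: central_half_sum_def alternating_half_sum_def sum_subtractf)
  also have "\<dots> \<simeq> 0 - alternating_half_sum (p^1)"
    by (intro cong_diff central_half_sum_cong_0 assms cong_refl)
  finally show ?thesis by simp
qed

theorem sum_f_minus_1_harmonic_cong:
  assumes "p > 5"
  shows "(\<Sum>k=1..p-1. (-1) ^ k * poly (f_poly k) (-1) / of_nat k * harmonic k) \<simeq> - 2 * (-1) ^ h * euler_num (p - 3) (p^1)"
proof -
  have "(\<Sum>k=1..p-1. (-1) ^ k * poly (f_poly k) (-1) / of_nat k * harmonic k)
    = (\<Sum>k=1..p-1. (\<Sum>i\<le>k. f_coeff k i * (-1) ^ i) * ((-1) ^ k / of_nat k * harmonic k))"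
    by (simp add: poly_f_poly mult_ac)
  also have "\<dots> = (\<Sum>i=0..p-1. (-1) ^ i * alt_f_harmonic_sum i)"
    using f_coeff_eq_0 by (subst sum_minus_1_coeff_swap) (auto simp: alt_f_harmonic_sum_def mult_ac)
  also have "\<dots> \<simeq> - alternating_half_sum (p^1)" by (rule sum_alt_f_harmonic_cong[OF assms])
  also have "\<dots> \<simeq> - (2 * (-1) ^ h * euler_num (p - 3)) (p^1)"
    by (intro cong_uminus alternating_half_sum_cong)
  finally show ?thesis by simp
qed

text \<open>Both contributions have order \<open>p\<close> and cancel each other: the alternating
  \<open>f\<close> sums live on the upper half and reflect to \<open>- alternating_half_sum\<close>,
  because \<open>p\<close> is odd, and the harmonic parts have the same value with the opposite sign
  in front.\<close>

theorem sum_g_minus_1_div_cong: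
  assumes "p > 5" shows "(\<Sum>k=1..p-1. poly (g_poly k) (-1) / of_nat k) \<simeq> 0 (p^2)"
proof -
  define b where "b = (\<Sum>i=h+1..p-1. (-1) ^ i / (of_nat i)\<^sup>2 :: rat)"
  have Zb: "Zp b" unfolding b_def by (intro pint unit_p_power unit_p_range) auto
  have b: "b \<simeq> - alternating_half_sum (p^1)"
  proof -
    have "b = (\<Sum>i=1..h. (-1) ^ (p - i) * (1 / (of_nat (p - i)))\<^sup>2)"
      unfolding b_def using p_eq
      by (intro sum.reindex_bij_witness[of _ "\<lambda>i. p - i" "\<lambda>i. p - i"]) (auto simp: power_divide)
    also have "\<dots> \<simeq> (\<Sum>i=1..h. (-1) ^ (p - i) * (- (1 / of_nat i))\<^sup>2) (p^1)"
    proof (intro cong_sum cong_mult_left cong_power Zp_uminus Zp_power Zp_divide Zp_1 unit_p_half_range)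
      fix i assume i: "i \<in> {1..h}"
      then have "of_nat (p - i) = P - of_nat i" using h_less by (intro of_nat_p_minus) auto
      then show "1 / of_nat (p - i) \<simeq> - (1 / of_nat i) (p^1)"
        using reflect_inverse_cong[OF unit_p_half_range[OF i]] by simp
    qed
    also have "\<dots> = - alternating_half_sum"
      unfolding alternating_half_sum_def sum_negf[symmetric]
      using h_less odd_p by (intro sum.cong refl) (auto simp: minus_one_power_iff power_divide)
    finally show ?thesis .
  qed
  have 0: "alt_f_sum 0 = 0" by (simp add: alt_f_sum_def f_coeff_0_right)
  have "(\<Sum>i=0..p-1. (-1) ^ i * alt_f_sum i)
    \<simeq> (\<Sum>i=0..p-1. (-1) ^ i * (if i \<in> {h+1..p-1} then P * (1 / (of_nat i)\<^sup>2) else 0)) (p^2)"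
  proof (intro cong_sum cong_mult_left pint)
    fix i assume "i \<in> {0..p-1}"
    then show "alt_f_sum i \<simeq> (if i \<in> {h+1..p-1} then P * (1 / (of_nat i)\<^sup>2) else 0) (p^2)"
      using alt_f_sum_cong[of i] 0 by (cases "i = 0"; cases "i \<le> h") auto
  qed
  also have "\<dots> = (\<Sum>i=h+1..p-1. P * ((-1) ^ i / (of_nat i)\<^sup>2))"
    by (intro sum.mono_neutral_cong_right) auto
  also have "\<dots> = P * b" by (simp add: b_def sum_distrib_left)
  finally have A: "(\<Sum>i=0..p-1. (-1) ^ i * alt_f_sum i) \<simeq> P * b (p^2)" .
  have "(\<Sum>k=1..p-1. poly (g_poly k) (-1) / of_nat k) = (\<Sum>i=0..p-1. (-1) ^ i * (\<Sum>k=1..p-1. g_coeff k i / of_nat k))"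
    using sum_minus_1_coeff_swap[of g_coeff "\<lambda>k. 1 / of_nat k"] g_coeff_eq_0 by (simp add: poly_g_poly)
  also have "\<dots> \<simeq> (\<Sum>i=0..p-1. (-1) ^ i * (alt_f_sum i - P * alt_f_harmonic_sum i)) (p^2)"
    by (intro cong_sum cong_mult_left sum_g_coeff_div_cong pint)
  also have "\<dots> = (\<Sum>i=0..p-1. (-1) ^ i * alt_f_sum i) - P * (\<Sum>i=0..p-1. (-1) ^ i * alt_f_harmonic_sum i)"
    unfolding sum_distrib_left sum_subtractf[symmetric] by (intro sum.cong refl) (simp add: algebra_simps)
  also have "\<dots> \<simeq> P * b - P * (\<Sum>i=0..p-1. (-1) ^ i * alt_f_harmonic_sum i) (p^2)"
    by (intro cong_diff A cong_refl)
  also have "\<dots> = P ^ 1 * (b - (\<Sum>i=0..p-1. (-1) ^ i * alt_f_harmonic_sum i))" by (simp add: right_diff_distrib)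
  also have "\<dots> \<simeq> P ^ 1 * (- alternating_half_sum - - alternating_half_sum) (p^2)"
    by (intro cong_scale[where m = 1] cong_diff b sum_alt_f_harmonic_cong assms) simp
  finally show ?thesis by simp
qed

end

theorem theorem1p1:
  fixes p :: nat
  assumes "prime p" and "p > 3"
  shows
    "(poly_cong p 4
        (\<Sum>k=0..p-1. Polynomial.smult (1 - (of_nat p)^2 * harmonic2 k) (g_poly k))
        (\<Sum>k=0..p-1. Polynomial.monom (of_nat p / of_nat (2 * k + 1) * (1 - 2 * (of_nat p)^2 * harmonic2 k)) k)
      \<and> rat_cong p 4
        (\<Sum>k=1..p-1. g_num k)
        ((of_nat p)^2 * (\<Sum>k=1..p-1. g_num k * harmonic2 k)
          + 7 / 6 * (of_nat p)^3 * bernoulli_num (p - 3))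
      \<and> rat_cong p 3
        (\<Sum>k=0..p-1. poly (g_poly k) (-1))
        (of_int (Legendre (-1) (int p))
          + (of_nat p)^2 * ((\<Sum>k=0..p-1. poly (g_poly k) (-1) * harmonic2 k) - euler_num (p - 3)))
      \<and> rat_cong p 2
        (\<Sum>k=0..p-1. poly (g_poly k) (-3))
        (of_int (Legendre (int p) 3)))
    \<and>
     (poly_cong p 1
        (\<Sum>k=1..p-1. Polynomial.smult (1 / of_nat k) (g_poly k))
        0
      \<and> rat_cong p 1
        (\<Sum>k=1..p-1. g_num (k - 1) / of_nat k)
        (- (of_int (Legendre (int p) 3) * 2 * fermat_quotient p 3))
      \<and> rat_cong p 2
        (\<Sum>k=1..p-1. of_nat k * g_num k)
        (- (3 / 4))
      \<and> (\<forall>n::nat. n > 0 \<longrightarrow>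
          1 / (3 * (of_nat n)^2) * (\<Sum>k=0..n-1. of_nat (4 * k + 3) * g_num k)
            = (\<Sum>k=0..n-1. of_nat (((n - 1) choose k)^2) * catalan_num k)))
    \<and>
     (p > 5 \<longrightarrow>
        rat_cong p 1
          (\<Sum>k=1..p-1. poly (g_poly k) (-1) / (of_nat k)^2)
          0
      \<and> rat_cong p 2
          (\<Sum>k=1..p-1. poly (g_poly k) (-1) / of_nat k)
          0
      \<and> rat_cong p 1
          (\<Sum>k=1..p-1. (-1)^k * poly (f_poly k) (-1) / of_nat k * harmonic k)
          (- 2 * of_int (Legendre (-1) (int p)) * euler_num (p - 3)))"
proof -
  interpret large_prime p using assms by unfold_locales
  have B: "Zp (bernoulli_num (p - 3))" by (intro Zp_bernoulli) simp
  have less: "k < p" if "k \<in> {0..p-1}" for k using that assms by auto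
  have less': "k < p" if "k \<in> {1..p-1}" for k using that assms by auto
  have q: "Zp (fermat_quotient p 3)"
    using fermat_cong[of 3] unit_p_numeral by (simp add: fermat_quotient_def pcong_def)
  have 1: "poly_cong p 4
        (\<Sum>k=0..p-1. Polynomial.smult (1 - P^2 * harmonic2 k) (g_poly k))
        (\<Sum>k=0..p-1. Polynomial.monom (P / of_nat (2 * k + 1) * (1 - 2 * P^2 * harmonic2 k)) k)"
    unfolding poly_cong_def rat_cong_iff
  proof (intro allI)
    fix i
    define r where "r = P / of_nat (2 * i + 1) * (1 - 2 * P\<^sup>2 * harmonic2 i)"
    have L: "Polynomial.coeff (\<Sum>k=0..p-1. Polynomial.smult (1 - P\<^sup>2 * harmonic2 k) (g_poly k)) i
        = (\<Sum>k=0..p-1. (1 - P\<^sup>2 * harmonic2 k) * g_coeff k i)"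
      by (simp add: Polynomial.coeff_sum coeff_g_poly)
    have R: "Polynomial.coeff (\<Sum>k=0..p-1. Polynomial.monom (P / of_nat (2 * k + 1) * (1 - 2 * P^2 * harmonic2 k)) k) i
        = (if i < p then r else 0)"
      using assms by (auto simp: Polynomial.coeff_sum r_def less_Suc_eq_le)
    show "Zp (Polynomial.coeff (\<Sum>k=0..p-1. Polynomial.monom (P / of_nat (2 * k + 1) * (1 - 2 * P^2 * harmonic2 k)) k) i)
      \<and> Polynomial.coeff (\<Sum>k=0..p-1. Polynomial.smult (1 - P\<^sup>2 * harmonic2 k) (g_poly k)) i
        \<simeq> Polynomial.coeff (\<Sum>k=0..p-1. Polynomial.monom (P / of_nat (2 * k + 1) * (1 - 2 * P^2 * harmonic2 k)) k) i (p^4)"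
    proof (cases "i < p")
      case True
      have "Zp r" unfolding r_def
        by (rule Zp_mult[OF Zp_P_div_odd[OF True]]) (intro pint True)
      then show ?thesis using weighted_g_coeff_sum_cong[OF True] True unfolding L R r_def by simp
    next
      \<comment> \<open>Degrees from \<open>p\<close> on, where both polynomials have coefficient
        0.\<close>
      case False
      then have "(\<Sum>k=0..p-1. (1 - P\<^sup>2 * harmonic2 k) * g_coeff k i) = 0"
      proof (intro sum.neutral ballI)
        fix k assume "k \<in> {0..p-1}"
        then have "k < i" using less[of k] False by simp
        then show "(1 - P\<^sup>2 * harmonic2 k) * g_coeff k i = 0" by (simp add: g_coeff_eq_0)
      qed
      then show ?thesis using False unfolding L R by simp
    qed
  qed
  have 2: "poly_cong p 1 (\<Sum>k=1..p-1. Polynomial.smult (1 / of_nat k) (g_poly k)) 0"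
    unfolding poly_cong_def rat_cong_iff
    using sum_g_coeff_div_cong_0 by (simp add: Polynomial.coeff_sum coeff_g_poly)
  have 3: "1 / (3 * (of_nat n)^2) * (\<Sum>k=0..n-1. of_nat (4 * k + 3) * g_num k)
      = (\<Sum>k=0..n-1. of_nat (((n - 1) choose k)^2) * catalan_num k)" if "n > 0" for n :: nat
    using that unfolding weighted_g_num_sum[OF that] by simp
  show ?thesis
    \<comment> \<open>Besides the congruences already proved, this leaves the integrality of each
      right side.\<close>
    unfolding rat_cong_iff Legendre_minus_1 chi3_def[symmetric]
  proof (intro conjI impI allI 1 2 3 sum_g_num_cong sum_g_poly_minus_1_cong sum_g_poly_minus_3_cong
      sum_g_num_pred_div_cong sum_k_g_num_cong sum_g_minus_1_div_square_cong sum_g_minus_1_div_cong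
      sum_f_minus_1_harmonic_cong)
    show "Zp (P\<^sup>2 * (\<Sum>k=1..p-1. g_num k * harmonic2 k) + 7 / 6 * P ^ 3 * bernoulli_num (p - 3))"
      using B less' by (intro pint unit_p_numeral)
    show "Zp ((-1) ^ h + P\<^sup>2 * ((\<Sum>k=0..p-1. poly (g_poly k) (-1) * harmonic2 k) - euler_num (p - 3)))"
      using less by (intro pint)
    show "Zp (- (chi3 * 2 * fermat_quotient p 3))" using q by (intro pint)
    show "Zp (- (3 / 4))" by (intro pint unit_p_numeral)
    show "Zp (- 2 * (-1) ^ h * euler_num (p - 3))" by (intro pint)
  qed (simp_all add: Zp_chi3)
qed

end
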